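(* Let $X$ be a closed triangulated $n$-manifold equipped with a Morse tiling $\mathcal{T}$ admitting a compatible discrete Morse function. For each $k$, let $b_k(X)$ be the $k$-th Betti number of $X$ and $c_k(\mathcal{T})$ the number of critical tiles of index $k$ of $\mathcal{T}$. Then $b_k(X)\le c_k(\mathcal{T})$ for every $k$, and the Morse inequalities hold: for every $0\le k\le n$, $$\sum_{i=0}^k(-1)^{k-i}b_i(X)\le\sum_{i=0}^k(-1)^{k-i}c_i(\mathcal{T}),$$ with equality if $k=n$.
   Context: Tiles. Let $\Delta_n$ be the closed standard $n$-simplex with facets $\sigma_1,\dots,\sigma_{n+1}$. For $n\ge0$, $0\le k\le n+1$, $T^n_k=\Delta_n\setminus(\sigma_1\cup\dots\cup\sigma_k)$ (for $n=0$ both $T^0_0$ and $T^0_1$ denote a point; $T^n_{n+1}$ is the open simplex; $T^{-1}_0=\emptyset$); subsets of simplices affinely isomorphic to $T^n_k$ are basic tiles of dimension $n$ and order $k$. For $0\le k\le l+1\le n$, $T^{n,l}_k=\Delta_n\setminus(\sigma_1\cup\dots\cup\sigma_k\cup\tau)$ with $\tau$ an $l$-dimensional face not contained in $\sigma_1\cup\dots\cup\sigma_k$ ($\tau=\emptyset$ if $l=-1$); so $T^{n,l}_k=T^n_k\setminus T^l_k$ where $T^l_k=\tau\setminus(\sigma_1\cup\dots\cup\sigma_k)$, and $T^{n,n-1}_k=T^n_{k+1}$. A Morse tile is a subset of a simplex affinely isomorphic to some $T^{n,l}_k$; its dimension is $n$; it is critical of index $k$ if $l=k-1$ (then denoted $C^n_k$),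 and regular otherwise. A Morse tiling of a finite simplicial complex $K$ is a partition of $K$ by Morse tiles (subsets of simplices of $K$) such that for every $j\ge0$ the union of tiles of dimension greater than $j$ is a subcomplex. Discrete Morse theory. $K^{[p]}$ is the set of $p$-simplices of $K$; $\tau>\sigma$ means $\sigma$ is a face of $\tau$. A function $f:K\to\mathbb{R}$ on the set of simplices is a discrete Morse function iff for every $\sigma\in K^{[p]}$: $\#\{\tau\in K^{[p+1]}:\tau>\sigma,\ f(\tau)\le f(\sigma)\}\le1$ and $\#\{\nu\in K^{[p-1]}:\nu<\sigma,\ f(\nu)\ge f(\sigma)\}\le1$. A discrete vector field is a map $W:K\to K\cup\{0\}$ with $W(K^{[p]})\subset K^{[p+1]}\cup\{0\}$; $W(\sigma)=0$ or $\sigma$ is a face of $W(\sigma)$; $W(\sigma)=0$ if $\sigma\in\mathrm{Im}(W)$; and $\#\{v\in K^{[p-1]}:W(v)=\sigma\}\le1$ for all $\sigma\in K^{[p]}$. The gradient vector field $W_f$ of $f$ is: $W_f(\sigma)=\tau$ if $\tau>\sigma$ is a $(p+1)$-simplex with $f(\tau)\le f(\sigma)$ ($\sigma$ of dimension $p$), and $W_f(\sigma)=0$ if there is none. The notion of discrete vector field applies to tiles as well, replacing simplices by the open simplices contained in the tile. Compatibility. Vector fields $W^n_k$ on $T^n_k$ are defined recursively. For $n=0$, $W^0_k=0$. For $n>0$, $W^n_{n+1}=0$. For $k\le n$, choose an ordering $\sigma_{k+1},\dots,\sigma_{n+1}$ of the facets not removed; this yields the partition $T^n_k=T^{n-1}_k\sqcup\dots\sqcup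 T^{n-1}_n\sqcup T^n_{n+1}$ with $T^{n-1}_l=\sigma_{l+1}\setminus(\sigma_1\cup\dots\cup\sigma_l)$; then $W^n_k(T^{n-1}_n)=T^n_{n+1}$, $W^n_k(T^n_{n+1})=0$, and for $k\le l\le n-1$ the restriction of $W^n_k$ to $T^{n-1}_l$ is some vector field $W^{n-1}_l$. All fields obtained this way (for all choices) are denoted $W^n_k$. A discrete vector field on $C^n_k=T^n_k\setminus T^{k-1}_k$ is obtained by restricting any $W^n_k$ to the open simplices of $C^n_k$; a discrete vector field on a regular $T^{n,l}_k=T^n_k\setminus T^l_k$ is obtained by restricting any $W^n_k$ which preserves $T^l_k$ (maps open simplices of $T^l_k$ to open simplices of $T^l_k$ or $0$). A discrete vector field on a Morse tiled complex is compatible with the tiling iff it preserves the tiles and its restriction to each tile is, via some affine isomorphism, one of these fields ($W^n_k$ on basic tiles $T^n_k$; the restriction of some $W^n_k$ to the open simplices of $C^n_k$ on critical tiles $C^n_k$; or the restriction to $T^{n,l}_k$ of some $W^n_k$ which preserves $T^l_k$ on regular tiles $T^{n,l}_k$). A discrete Morse function is compatible with the tiling if its gradient vector field is. A closed manifold is compact without boundary; a triangulated manifold is a finite simplicial complex homeomorphic to it. Betti numbers are ranks of singular homology groups. *)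

theory Defs
  imports "HOL-Analysis.Analysis" "HOL-Homology.Homology"
begin

section \<open>Closed manifolds and Betti numbers\<close>

definition closed_manifold :: "nat \<Rightarrow> 'x topology \<Rightarrow> bool" where
  "closed_manifold n X \<longleftrightarrow>
     compact_space X \<and> Hausdorff_space X \<and> second_countable X \<and>
     (\<forall>x \<in> topspace X. \<exists>U V. openin X U \<and> x \<in> U \<and> openin (Euclidean_space n) V \<and>
        subtopology X U homeomorphic_space subtopology (Euclidean_space n) V)"

definition independent_in :: "('g, 'm) monoid_scheme \<Rightarrow> 'g set \<Rightarrow> bool" where
  "independent_in G A \<longleftrightarrow> finite A \<and> A \<subseteq> carrier G \<and>
     (\<forall>c :: 'g \<Rightarrow> int. (\<Otimes>\<^bsub>G\<^esub>a\<in>A. a [^]\<^bsub>G\<^esub> c a) = \<one>\<^bsub>G\<^esub> \<longrightarrow> (\<forall>a\<in>A. c a = 0))"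

text \<open>The rank of an abelian group: the maximal number of elements independent over the integers.
  As a natural number it is meaningful only for groups of finite rank; the homology groups of
  a space homeomorphic to a finite simplicial complex have finite rank.\<close>

definition abelian_rank :: "('g, 'm) monoid_scheme \<Rightarrow> nat" where
  "abelian_rank G = Sup {card A |A. independent_in G A}"

definition betti :: "nat \<Rightarrow> 'x topology \<Rightarrow> nat" where
  "betti k X = abelian_rank (homology_group (int k) X)"

section \<open>Discrete Morse functions and discrete vector fields\<close>

text \<open>Simplicial complexes are those of the library: finite sets of closed simplices of a Euclidean
  space. They contain the empty set, which does not count as a simplex here. An open simplex is
  represented by its closure, and a vector field by a partial map in which \<^const>\<open>None\<close>
  stands for the value 0.\<close>

definition simplices_dim :: "'a::euclidean_space set set \<Rightarrow> int \<Rightarrow> 'a set set" where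
  "simplices_dim K p = {\<sigma> \<in> K. \<sigma> \<noteq> {} \<and> p simplex \<sigma>}"

definition discrete_morse_function :: "'a::euclidean_space set set \<Rightarrow> ('a set \<Rightarrow> real) \<Rightarrow> bool" where
  "discrete_morse_function K f \<longleftrightarrow>
     (\<forall>p. \<forall>\<sigma> \<in> simplices_dim K p.
        card {\<tau> \<in> simplices_dim K (p + 1). \<sigma> face_of \<tau> \<and> f \<tau> \<le> f \<sigma>} \<le> 1 \<and>
        card {\<nu> \<in> simplices_dim K (p - 1). \<nu> face_of \<sigma> \<and> f \<nu> \<ge> f \<sigma>} \<le> 1)"

definition discrete_vector_field ::
    "'a::euclidean_space set set \<Rightarrow> ('a set \<rightharpoonup> 'a set) \<Rightarrow> bool" where
  "discrete_vector_field K W \<longleftrightarrow>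
     dom W \<subseteq> K - {{}} \<and>
     (\<forall>p. \<forall>\<sigma> \<in> simplices_dim K p.
        (\<forall>\<tau>. W \<sigma> = Some \<tau> \<longrightarrow> \<tau> \<in> simplices_dim K (p + 1) \<and> \<sigma> face_of \<tau>) \<and>
        (\<sigma> \<in> ran W \<longrightarrow> W \<sigma> = None) \<and>
        card {v \<in> simplices_dim K (p - 1). W v = Some \<sigma>} \<le> 1)"

definition gradient_pair ::
    "'a::euclidean_space set set \<Rightarrow> ('a set \<Rightarrow> real) \<Rightarrow> 'a set \<Rightarrow> 'a set \<Rightarrow> bool" where
  "gradient_pair K f \<sigma> \<tau> \<longleftrightarrow>
     (\<exists>p. \<sigma> \<in> simplices_dim K p \<and> \<tau> \<in> simplices_dim K (p + 1) \<and> \<sigma> face_of \<tau> \<and> f \<tau> \<le> f \<sigma>)"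

definition gradient_field ::
    "'a::euclidean_space set set \<Rightarrow> ('a set \<Rightarrow> real) \<Rightarrow> ('a set \<rightharpoonup> 'a set)" where
  "gradient_field K f \<sigma> =
     (if \<exists>\<tau>. gradient_pair K f \<sigma> \<tau> then Some (THE \<tau>. gradient_pair K f \<sigma> \<tau>) else None)"

section \<open>Tiles\<close>

text \<open>The empty set is admitted as the only facet of a point. Thus a \<open>0\<close>-simplex has
  one facet, and removing it or not gives the same set, so that the tiles of dimension \<open>0\<close>
  and order \<open>0\<close> and \<open>1\<close> are both a point.\<close>

definition facets :: "'a::euclidean_space set \<Rightarrow> 'a set set" where
  "facets S = {F. F face_of S \<and> aff_dim F = aff_dim S - 1}"

text \<open>An affine isomorphism carrying a tile of the standard simplex onto a set extends to the whole
  simplex and carries faces to faces. So the tiles isomorphic to the standard ones are obtained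
  directly from an \<open>n\<close>-simplex \<open>S\<close>, a set \<open>R\<close> of \<open>k\<close> of its facets
  and an \<open>l\<close>-dimensional face \<open>\<tau>\<close>, as the difference \<open>S - (\<Union>R \<union> \<tau>)\<close>.\<close>

definition tile_data ::
    "nat \<Rightarrow> int \<Rightarrow> nat \<Rightarrow> 'a::euclidean_space set \<Rightarrow> 'a set set \<Rightarrow> 'a set \<Rightarrow> bool" where
  "tile_data n l k S R \<tau> \<longleftrightarrow>
     int n simplex S \<and> R \<subseteq> facets S \<and> card R = k \<and>
     int k \<le> l + 1 \<and> l + 1 \<le> int n \<and>
     \<tau> face_of S \<and> l simplex \<tau> \<and> (l = -1 \<or> \<not> \<tau> \<subseteq> \<Union>R)"

definition morse_tile ::
    "nat \<Rightarrow> int \<Rightarrow> nat \<Rightarrow> 'a::euclidean_space set \<Rightarrow> 'a set \<Rightarrow> bool" where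
  "morse_tile n l k S T \<longleftrightarrow> (\<exists>R \<tau>. tile_data n l k S R \<tau> \<and> T = S - (\<Union>R \<union> \<tau>))"

definition tile_of_dim :: "nat \<Rightarrow> 'a::euclidean_space set \<Rightarrow> bool" where
  "tile_of_dim n T \<longleftrightarrow> (\<exists>l k S. morse_tile n l k S T)"

definition critical_tile :: "nat \<Rightarrow> 'a::euclidean_space set \<Rightarrow> bool" where
  "critical_tile k T \<longleftrightarrow> (\<exists>n S. morse_tile n (int k - 1) k S T)"

definition morse_tiling :: "'a::euclidean_space set set \<Rightarrow> 'a set set \<Rightarrow> bool" where
  "morse_tiling K \<T> \<longleftrightarrow>
     partition_on (\<Union>K) \<T> \<and>
     (\<forall>T \<in> \<T>. \<exists>S \<in> K. \<exists>n l k. morse_tile n l k S T) \<and>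
     (\<forall>j::nat. \<exists>L \<subseteq> K. simplicial_complex L \<and> \<Union>L = \<Union>{T \<in> \<T>. \<exists>m > j. tile_of_dim m T})"

definition num_critical :: "nat \<Rightarrow> 'a::euclidean_space set set \<Rightarrow> nat" where
  "num_critical k \<T> = card {T \<in> \<T>. critical_tile k T}"

section \<open>Vector fields on tiles and compatibility\<close>

definition open_simplices_in :: "'a::euclidean_space set set \<Rightarrow> 'a set \<Rightarrow> 'a set set" where
  "open_simplices_in K T = {\<sigma> \<in> K. \<sigma> \<noteq> {} \<and> rel_interior \<sigma> \<subseteq> T}"

definition faces :: "'a::euclidean_space set \<Rightarrow> 'a set set" where
  "faces S = {F. F face_of S}"

text \<open>\<open>basic_field n S R W\<close>: \<open>W\<close> is one of the fields on the basic tile \<open>S - \<Union>R\<close>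
  of dimension \<open>n\<close> and order \<open>card R\<close>. The list \<open>xs\<close> orders the facets that are not
  removed; the facets removed from \<open>xs ! i\<close> are its intersections with \<open>R\<close> and with the
  earlier facets of the list.\<close>

primrec basic_field ::
    "nat \<Rightarrow> 'a::euclidean_space set \<Rightarrow> 'a set set \<Rightarrow> ('a set \<rightharpoonup> 'a set) \<Rightarrow> bool" where
  "basic_field 0 S R W \<longleftrightarrow> W = Map.empty"
| "basic_field (Suc m) S R W \<longleftrightarrow>
     (if R = facets S then W = Map.empty
      else \<exists>xs. distinct xs \<and> set xs = facets S - R \<and>
        dom W \<subseteq> open_simplices_in (faces S) (S - \<Union>R) \<and>
        W (last xs) = Some S \<and> W S = None \<and>
        (\<forall>i < length xs - 1.
           let E = R \<union> set (take i xs); F = xs ! i in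
           basic_field m F ((\<lambda>G. F \<inter> G) ` E) (W |` open_simplices_in (faces F) (F - \<Union>E))))"

definition preserves :: "('a set \<rightharpoonup> 'a set) \<Rightarrow> 'a set set \<Rightarrow> bool" where
  "preserves W C \<longleftrightarrow> (\<forall>\<sigma> \<in> C. \<forall>\<tau>. W \<sigma> = Some \<tau> \<longrightarrow> \<tau> \<in> C)"

text \<open>The three disjuncts are the fields on basic, critical and regular tiles contained in \<open>S\<close>.
  In the last one the part \<open>\<tau> - \<Union>R\<close> removed from the basic tile is to be preserved.\<close>

definition tile_field ::
    "'a::euclidean_space set \<Rightarrow> 'a set \<Rightarrow> ('a set \<rightharpoonup> 'a set) \<Rightarrow> bool" where
  "tile_field S T V \<longleftrightarrow>
     (\<exists>n R. int n simplex S \<and> R \<subseteq> facets S \<and> T = S - \<Union>R \<and> basic_field n S R V) \<or>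
     (\<exists>n k R \<tau> W. tile_data n (int k - 1) k S R \<tau> \<and> T = S - (\<Union>R \<union> \<tau>) \<and>
        basic_field n S R W \<and> V = W |` open_simplices_in (faces S) T) \<or>
     (\<exists>n l k R \<tau> W. l \<noteq> int k - 1 \<and> tile_data n l k S R \<tau> \<and> T = S - (\<Union>R \<union> \<tau>) \<and>
        basic_field n S R W \<and> preserves W (open_simplices_in (faces S) (\<tau> - \<Union>R)) \<and>
        V = W |` open_simplices_in (faces S) T)"

definition compatible_field ::
    "'a::euclidean_space set set \<Rightarrow> 'a set set \<Rightarrow> ('a set \<rightharpoonup> 'a set) \<Rightarrow> bool" where
  "compatible_field K \<T> W \<longleftrightarrow>
     discrete_vector_field K W \<and>
     (\<forall>T \<in> \<T>. preserves W (open_simplices_in K T) \<and>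
        (\<exists>S \<in> K. tile_field S T (W |` open_simplices_in K T)))"

definition compatible_morse_function ::
    "'a::euclidean_space set set \<Rightarrow> 'a set set \<Rightarrow> ('a set \<Rightarrow> real) \<Rightarrow> bool" where
  "compatible_morse_function K \<T> f \<longleftrightarrow>
     discrete_morse_function K f \<and> compatible_field K \<T> (gradient_field K f)"

end

theory Submission
  imports Defs
begin

text \<open>Let \<open>W\<close> be the gradient field of a compatible Morse function, and let \<open>u\<^sub>i\<close> be the number of
  \<open>i\<close>-simplices that \<open>W\<close> leaves unmatched. The theorem is the combination of a topological fact,
  which relates the \<open>u\<^sub>i\<close> to the Betti numbers, and a combinatorial one, which identifies \<open>u\<^sub>k\<close> with the
  number of critical tiles of index \<open>k\<close>.

  The topological fact is that there are natural numbers \<open>q\<^sub>i\<close> with \<open>u\<^sub>i = b\<^sub>i + q\<^sub>i + q\<^sub>i\<^sub>-\<^sub>1\<close>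
  (lemma \<open>morse_relation_complex\<close>). The complex is dismantled from the top dimension downwards. If some
  simplex of top dimension is unmatched, it is removed; otherwise all of them are targets of
  \<open>W\<close>, and the pair \<open>\<sigma>, W \<sigma>\<close> with the largest value \<open>f \<sigma>\<close> is removed. The inequalities of a
  discrete Morse function imply that this \<open>\<sigma>\<close> is then a free face, so that the second kind of step is an
  elementary collapse and does not change the homotopy type. In the first kind of step a cell of dimension
  \<open>p\<close> is taken away. The relative homology of attaching a \<open>p\<close>-cell is infinite cyclic in degree \<open>p\<close> and
  trivial otherwise, so in the exact sequence
  \<open>0 \<rightarrow> H\<^sub>p(A) \<rightarrow> H\<^sub>p(X) \<rightarrow> \<int> \<rightarrow> H\<^sub>p\<^sub>-\<^sub>1(A) \<rightarrow> H\<^sub>p\<^sub>-\<^sub>1(X) \<rightarrow> 0\<close> the attachment either raises \<open>b\<^sub>p\<close>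
  by one or lowers \<open>b\<^sub>p\<^sub>-\<^sub>1\<close> by one. In the latter case \<open>q\<^sub>p\<^sub>-\<^sub>1\<close> goes up by one, and the
  relation persists (lemma \<open>rank_cell_attachment\<close>).

  The combinatorial fact is that a critical tile of index \<open>k\<close> contains exactly one unmatched simplex, of
  dimension \<open>k\<close>, and a regular tile none (lemma \<open>tile_field_shape\<close>). It rests on the recursive construction of the
  fields on basic tiles (lemma \<open>basic_field_matching\<close>): they match all faces, except for one vertex
  if the tile is a closed simplex and for the top simplex if the tile is open. Since compatible fields preserve tiles, \<open>u\<^sub>k\<close> is
  the number of critical tiles of index \<open>k\<close>.

  The alternating sum of the differences \<open>u\<^sub>i - b\<^sub>i\<close> up to \<open>k\<close> telescopes to \<open>q\<^sub>k\<close>, which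
  gives the inequalities. By invariance of domain the complex has no simplex of dimension \<open>n + 1\<close>; hence
  \<open>u\<^sub>n\<^sub>+\<^sub>1 = 0\<close>, which forces \<open>q\<^sub>n = 0\<close>, the equality for \<open>k = n\<close>.\<close>


section \<open>Ranks of abelian groups\<close>

text \<open>Gaussian elimination without division: a pivot row clears the column of its pivot after
  cross-multiplication, which keeps all entries integral, and one unknown and one equation disappear.\<close>

lemma underdetermined_integer_system:
  fixes a :: "'i \<Rightarrow> 'j \<Rightarrow> int"
  assumes "finite J" "finite I" "card J < card I"
  shows "\<exists>c. (\<exists>i\<in>I. c i \<noteq> 0) \<and> (\<forall>j\<in>J. (\<Sum>i\<in>I. c i * a i j) = 0)"
  using assms
proof (induction J arbitrary: I a rule: finite_induct)
  case empty
  then obtain i where "i \<in> I" by fastforce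
  then show ?case by (intro exI[of _ "\<lambda>_. 1"]) auto
next
  case (insert j0 J)
  show ?case
  proof (cases "\<forall>i\<in>I. a i j0 = 0")
    case True
    obtain c where "\<exists>i\<in>I. c i \<noteq> 0" "\<forall>j\<in>J. (\<Sum>i\<in>I. c i * a i j) = 0"
      using insert.IH[of I a] insert.prems insert.hyps by auto
    then show ?thesis using True by (intro exI[of _ c]) auto
  next
    case False
    then obtain i0 where i0: "i0 \<in> I" "a i0 j0 \<noteq> 0" by blast
    define a' where "a' = (\<lambda>i j. a i0 j0 * a i j - a i j0 * a i0 j)"
    have "card J < card (I - {i0})"
      using insert.prems insert.hyps i0 by (simp add: card_Diff_singleton)
    then obtain c where c: "\<exists>i\<in>I - {i0}. c i \<noteq> 0"
        "\<forall>j\<in>J. (\<Sum>i\<in>I - {i0}. c i * a' i j) = 0"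
      using insert.IH[of "I - {i0}" a'] insert.prems by auto
    \<comment> \<open>the coefficient of the pivot row is chosen so that column \<open>j0\<close> cancels\<close>
    define d where "d = (\<lambda>i. if i = i0 then - (\<Sum>i\<in>I - {i0}. c i * a i j0) else a i0 j0 * c i)"
    have sum_d: "(\<Sum>i\<in>I. d i * a i j) = (\<Sum>i\<in>I - {i0}. c i * a' i j)" for j
    proof -
      have "(\<Sum>i\<in>I. d i * a i j) = d i0 * a i0 j + (\<Sum>i\<in>I - {i0}. d i * a i j)"
        using i0 insert.prems by (simp add: sum.remove)
      also have "(\<Sum>i\<in>I - {i0}. d i * a i j) = (\<Sum>i\<in>I - {i0}. a i0 j0 * c i * a i j)"
        by (rule sum.cong) (auto simp: d_def)
      also have "d i0 * a i0 j = (\<Sum>i\<in>I - {i0}. - (c i * a i j0 * a i0 j))"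
        by (simp add: d_def sum_distrib_right sum_negf)
      also have "\<dots> + (\<Sum>i\<in>I - {i0}. a i0 j0 * c i * a i j) = (\<Sum>i\<in>I - {i0}. c i * a' i j)"
        unfolding sum.distrib[symmetric] by (rule sum.cong) (auto simp: a'_def algebra_simps)
      finally show ?thesis .
    qed
    have "\<forall>j\<in>insert j0 J. (\<Sum>i\<in>I. d i * a i j) = 0"
      using c(2) by (auto simp: sum_d) (simp add: a'_def)
    moreover have "\<exists>i\<in>I. d i \<noteq> 0" using c(1) i0 by (auto simp: d_def)
    ultimately show ?thesis by blast
  qed
qed

text \<open>Combinations are formed along an indexed family, so that relations can be transported along a
  homomorphism before it is known whether it identifies some of the elements.\<close>

definition zcomb :: "('g, 'm) monoid_scheme \<Rightarrow> ('i \<Rightarrow> 'g) \<Rightarrow> ('i \<Rightarrow> int) \<Rightarrow> 'i set \<Rightarrow> 'g" where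
  "zcomb G x c I = (\<Otimes>\<^bsub>G\<^esub>i\<in>I. x i [^]\<^bsub>G\<^esub> c i)"

lemma independent_in_zcomb:
  "independent_in G A \<longleftrightarrow> finite A \<and> A \<subseteq> carrier G \<and>
     (\<forall>c. zcomb G (\<lambda>a. a) c A = \<one>\<^bsub>G\<^esub> \<longrightarrow> (\<forall>a\<in>A. c a = 0))"
  by (simp add: independent_in_def zcomb_def)

context comm_group
begin

lemma zcomb_closed [simp]: "x ` I \<subseteq> carrier G \<Longrightarrow> zcomb G x c I \<in> carrier G"
  unfolding zcomb_def by (rule finprod_closed) auto

lemma zcomb_empty [simp]: "zcomb G x c {} = \<one>"
  by (simp add: zcomb_def)

lemma zcomb_insert:
  "\<lbrakk>finite I; i \<notin> I; x ` insert i I \<subseteq> carrier G\<rbrakk>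
    \<Longrightarrow> zcomb G x c (insert i I) = x i [^] c i \<otimes> zcomb G x c I"
  unfolding zcomb_def by (subst finprod_insert) auto

lemma zcomb_cong:
  "\<lbrakk>\<And>i. i \<in> I \<Longrightarrow> x i = y i; \<And>i. i \<in> I \<Longrightarrow> c i = d i; y ` I \<subseteq> carrier G\<rbrakk>
    \<Longrightarrow> zcomb G x c I = zcomb G y d I"
  unfolding zcomb_def by (rule finprod_cong') auto

lemma zcomb_0: "(\<And>i. i \<in> I \<Longrightarrow> c i = 0) \<Longrightarrow> zcomb G x c I = \<one>"
  unfolding zcomb_def by (rule finprod_one_eqI) auto

lemma zcomb_add:
  assumes "x ` I \<subseteq> carrier G"
  shows "zcomb G x (\<lambda>i. c i + d i) I = zcomb G x c I \<otimes> zcomb G x d I"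
proof -
  have "zcomb G x (\<lambda>i. c i + d i) I = (\<Otimes>i\<in>I. x i [^] c i \<otimes> x i [^] d i)"
    unfolding zcomb_def by (rule finprod_cong') (use assms in \<open>auto simp: int_pow_mult\<close>)
  also have "\<dots> = zcomb G x c I \<otimes> zcomb G x d I"
    unfolding zcomb_def by (rule finprod_multf) (use assms in auto)
  finally show ?thesis .
qed

lemma zcomb_pow:
  assumes "finite I" "x ` I \<subseteq> carrier G"
  shows "zcomb G x c I [^] (n::int) = zcomb G x (\<lambda>i. n * c i) I"
  using assms
proof (induction I rule: finite_induct)
  case (insert i I)
  then show ?case
    by (simp add: zcomb_insert int_pow_distrib int_pow_pow mult.commute)
qed simp

lemma zcomb_Un:
  assumes "finite I" "finite J" "I \<inter> J = {}" "x ` (I \<union> J) \<subseteq> carrier G"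
  shows "zcomb G x c (I \<union> J) = zcomb G x c I \<otimes> zcomb G x c J"
  unfolding zcomb_def by (rule finprod_Un_disjoint) (use assms in auto)

lemma zcomb_of_zcombs:
  assumes "finite I" "finite J" "x ` J \<subseteq> carrier G"
  shows "zcomb G (\<lambda>i. zcomb G x (a i) J) c I = zcomb G x (\<lambda>j. \<Sum>i\<in>I. c i * a i j) J"
  using assms(1)
proof (induction I rule: finite_induct)
  case empty
  then show ?case by (simp add: zcomb_0)
next
  case (insert i I)
  have "zcomb G (\<lambda>i. zcomb G x (a i) J) c (insert i I)
      = zcomb G x (a i) J [^] c i \<otimes> zcomb G x (\<lambda>j. \<Sum>i\<in>I. c i * a i j) J"
    using insert assms by (subst zcomb_insert) auto
  also have "\<dots> = zcomb G x (\<lambda>j. c i * a i j + (\<Sum>i\<in>I. c i * a i j)) J"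
    using assms by (simp add: zcomb_pow zcomb_add)
  finally show ?case using insert by simp
qed

lemma zcomb_pow_gens:
  assumes "x ` I \<subseteq> carrier G"
  shows "zcomb G (\<lambda>i. x i [^] (N i::int)) c I = zcomb G x (\<lambda>i. N i * c i) I"
  unfolding zcomb_def by (rule finprod_cong') (use assms in \<open>auto simp: int_pow_pow\<close>)

lemma zcomb_reindex:
  assumes "inj_on g I" "x ` g ` I \<subseteq> carrier G"
  shows "zcomb G x c (g ` I) = zcomb G (\<lambda>i. x (g i)) (\<lambda>i. c (g i)) I"
  unfolding zcomb_def by (rule finprod_reindex) (use assms in auto)

text \<open>More than \<open>card Z\<close> elements with multiples in the span of \<open>Z\<close> leave an underdetermined
  system for the coefficients of a relation between them. Only nonzero multiples are asked to lie in the span, so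
  that torsion does not count.\<close>

lemma independent_card_le:
  assumes "finite Z" "Z \<subseteq> carrier G" "independent_in G A"
    and gen: "\<And>a. a \<in> A \<Longrightarrow> \<exists>N::int. N \<noteq> 0 \<and> (\<exists>c. a [^] N = zcomb G (\<lambda>z. z) c Z)"
  shows "card A \<le> card Z"
proof (rule ccontr)
  assume "\<not> card A \<le> card Z"
  moreover have fin: "finite A" and AG: "A \<subseteq> carrier G" using assms(3) by (auto simp: independent_in_def)
  obtain N c where N: "\<And>a. a \<in> A \<Longrightarrow> N a \<noteq> (0::int)"
      "\<And>a. a \<in> A \<Longrightarrow> a [^] N a = zcomb G (\<lambda>z. z) (c a) Z"
    using gen by metis
  ultimately obtain d where d: "\<exists>i\<in>A. d i \<noteq> 0" "\<forall>j\<in>Z. (\<Sum>i\<in>A. d i * c i j) = 0"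
    using underdetermined_integer_system[OF assms(1) fin, of c] by auto
  have "zcomb G (\<lambda>a. a) (\<lambda>a. N a * d a) A = zcomb G (\<lambda>a. a [^] N a) d A"
    using zcomb_pow_gens[of "\<lambda>a. a" A N d] AG by simp
  also have "\<dots> = zcomb G (\<lambda>a. zcomb G (\<lambda>z. z) (c a) Z) d A"
    by (rule zcomb_cong) (use N assms(2) in \<open>auto simp: image_subset_iff\<close>)
  also have "\<dots> = zcomb G (\<lambda>z. z) (\<lambda>j. \<Sum>i\<in>A. d i * c i j) Z"
    by (rule zcomb_of_zcombs) (use assms fin in auto)
  also have "\<dots> = \<one>" by (rule zcomb_0) (use d in auto)
  finally show False
    using assms(3) d(1) N(1) unfolding independent_in_zcomb by (metis mult_eq_0_iff)
qed

end

text \<open>The rank is attached to a subset, so that kernels and images have one without being made into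
  groups. As a relation it also records that the rank is finite.\<close>

definition rank_on :: "('g, 'm) monoid_scheme \<Rightarrow> 'g set \<Rightarrow> nat \<Rightarrow> bool" where
  "rank_on G B r \<longleftrightarrow> (\<exists>A\<subseteq>B. independent_in G A \<and> card A = r) \<and>
     (\<forall>A\<subseteq>B. independent_in G A \<longrightarrow> card A \<le> r)"

lemma rank_on_unique: "\<lbrakk>rank_on G B r; rank_on G B s\<rbrakk> \<Longrightarrow> r = s"
  unfolding rank_on_def by (metis le_antisym)

lemma rank_on_imp_abelian_rank:
  assumes "rank_on G (carrier G) r"
  shows "abelian_rank G = r"
proof -
  have "r \<in> {card A |A. independent_in G A}" "\<forall>x\<in>{card A |A. independent_in G A}. x \<le> r"
    using assms unfolding rank_on_def by (auto simp: independent_in_def)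
  then show ?thesis unfolding abelian_rank_def by (meson cSup_eq_maximum)
qed

lemma rank_on_bounded:
  assumes "\<And>A. \<lbrakk>A \<subseteq> B; independent_in G A\<rbrakk> \<Longrightarrow> card A \<le> r"
  obtains s where "rank_on G B s" "s \<le> r"
proof -
  let ?C = "{card A |A. A \<subseteq> B \<and> independent_in G A}"
  have "?C \<subseteq> {..r}" using assms by auto
  then have fin: "finite ?C" using finite_subset by blast
  have "independent_in G {}" by (simp add: independent_in_def)
  then have ne: "?C \<noteq> {}" by blast
  have "rank_on G B (Max ?C)"
    unfolding rank_on_def using Max_in[OF fin ne] Max_ge[OF fin] by auto
  moreover have "Max ?C \<le> r" using Max_in[OF fin ne] assms by auto
  ultimately show thesis using that by blast
qed

lemma rank_on_mono:
  assumes "rank_on G B r" "B' \<subseteq> B"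
  obtains s where "rank_on G B' s" "s \<le> r"
proof (rule rank_on_bounded[of B' G r])
  fix A assume "A \<subseteq> B'" "independent_in G A"
  then show "card A \<le> r" using assms unfolding rank_on_def by blast
qed (use that in blast)

lemma hom_zcomb:
  assumes f: "f \<in> hom G H" and "comm_group G" "comm_group H" and "finite I" "x ` I \<subseteq> carrier G"
  shows "f (zcomb G x c I) = zcomb H (\<lambda>i. f (x i)) c I"
  using assms(4,5)
proof (induction I rule: finite_induct)
  case empty
  then show ?case
    using assms hom_one[OF f] by (simp add: comm_group.zcomb_empty comm_group_def)
next
  case (insert i I)
  have "f (x i) \<in> carrier H" "(\<lambda>i. f (x i)) ` I \<subseteq> carrier H"
    using insert f by (auto simp: hom_def)
  then show ?case
    using insert assms hom_int_pow[OF f] group.int_pow_closed[of G] comm_group.zcomb_closed[of G x I]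
    by (simp add: comm_group.zcomb_insert hom_mult[OF f] comm_group.axioms(2))
qed

text \<open>A maximal independent set spans up to nonzero multiples: adding \<open>x\<close> creates a relation, and in it the
  coefficient of \<open>x\<close> cannot vanish.\<close>

lemma rank_on_maximal:
  assumes "comm_group G" and B: "B \<subseteq> carrier G"
    and max: "\<And>A'. \<lbrakk>A' \<subseteq> B; independent_in G A'\<rbrakk> \<Longrightarrow> card A' \<le> card A"
    and A: "A \<subseteq> B" "independent_in G A" and x: "x \<in> B"
  shows "\<exists>N::int. N \<noteq> 0 \<and> (\<exists>c. x [^]\<^bsub>G\<^esub> N = zcomb G (\<lambda>z. z) c A)"
proof -
  interpret comm_group G by fact
  have fin: "finite A" and AG: "A \<subseteq> carrier G" and xG: "x \<in> carrier G"
    using A B x by (auto simp: independent_in_def)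
  show ?thesis
  proof (cases "x \<in> A")
    case True
    have "zcomb G (\<lambda>z. z) (\<lambda>z. if z = x then 1 else 0) A
        = zcomb G (\<lambda>z. z) (\<lambda>z. if z = x then 1 else 0) (insert x (A - {x}))"
      using True by (simp add: insert_absorb)
    also have "\<dots> = x [^]\<^bsub>G\<^esub> (1::int) \<otimes>\<^bsub>G\<^esub> zcomb G (\<lambda>z. z) (\<lambda>z. if z = x then 1 else 0) (A - {x})"
      using fin AG xG by (subst zcomb_insert) auto
    also have "zcomb G (\<lambda>z. z) (\<lambda>z. if z = x then 1 else 0) (A - {x}) = \<one>\<^bsub>G\<^esub>"
      by (rule zcomb_0) auto
    finally have "x [^]\<^bsub>G\<^esub> (1::int) = zcomb G (\<lambda>z. z) (\<lambda>z. if z = x then 1 else 0) A"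
      using xG by simp
    then show ?thesis by (intro exI[of _ 1] conjI exI) auto
  next
    case False
    have "\<not> independent_in G (insert x A)"
      using max[of "insert x A"] A x False fin by auto
    then obtain c where c: "zcomb G (\<lambda>z. z) c (insert x A) = \<one>\<^bsub>G\<^esub>" "\<exists>a\<in>insert x A. c a \<noteq> 0"
      unfolding independent_in_zcomb using fin AG xG by auto
    have e: "x [^]\<^bsub>G\<^esub> c x \<otimes>\<^bsub>G\<^esub> zcomb G (\<lambda>z. z) c A = \<one>\<^bsub>G\<^esub>"
      using c(1) fin False AG xG by (simp add: zcomb_insert)
    have "c x \<noteq> 0"
    proof
      assume "c x = 0"
      then have "zcomb G (\<lambda>z. z) c A = \<one>\<^bsub>G\<^esub>" using e AG by simp
      then show False using A(2) c(2) \<open>c x = 0\<close> unfolding independent_in_zcomb by blast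
    qed
    moreover have "x [^]\<^bsub>G\<^esub> c x = zcomb G (\<lambda>z. z) (\<lambda>z. - 1 * c z) A"
    proof -
      have "zcomb G (\<lambda>z. z) c A \<otimes>\<^bsub>G\<^esub> zcomb G (\<lambda>z. z) (\<lambda>z. - 1 * c z) A = zcomb G (\<lambda>z. z) (\<lambda>z. c z + - 1 * c z) A"
        by (rule zcomb_add[symmetric]) (use AG in auto)
      also have "\<dots> = \<one>\<^bsub>G\<^esub>" by (rule zcomb_0) auto
      finally have "zcomb G (\<lambda>z. z) c A \<otimes>\<^bsub>G\<^esub> zcomb G (\<lambda>z. z) (\<lambda>z. - 1 * c z) A = \<one>\<^bsub>G\<^esub>" .
      with e show ?thesis using AG xG
        by (metis image_ident int_pow_closed inv_equality inv_inv zcomb_closed)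
    qed
    ultimately show ?thesis by blast
  qed
qed

text \<open>A relation between preimages is mapped to a relation between the given elements, with the
  same coefficients.\<close>

lemma independent_lift:
  assumes f: "f \<in> hom G H" and G: "comm_group G" and H: "comm_group H"
    and D: "independent_in H D" "D \<subseteq> f ` B" and B: "B \<subseteq> carrier G"
  obtains D' where "D' \<subseteq> B" "inj_on f D'" "f ` D' = D" "independent_in G D'" "card D' = card D"
proof -
  obtain D' where D': "D' \<subseteq> B" "inj_on f D'" "f ` D' = D"
    using subset_image_inj[of D f B] D(2) by metis
  have fin: "finite D'" using D D' by (metis finite_imageD independent_in_def)
  have sub: "D' \<subseteq> carrier G" using D' B by auto
  have "independent_in G D'"
    unfolding independent_in_zcomb
  proof (intro conjI allI impI fin sub)
    fix c assume c: "zcomb G (\<lambda>a. a) c D' = \<one>\<^bsub>G\<^esub>"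
    let ?c = "\<lambda>d. c (the_inv_into D' f d)"
    have "zcomb H (\<lambda>a. a) ?c (f ` D') = zcomb H f (\<lambda>i. ?c (f i)) D'"
      by (rule comm_group.zcomb_reindex[OF H D'(2)]) (use f sub in \<open>auto simp: hom_def\<close>)
    also have "\<dots> = zcomb H f c D'"
      by (rule comm_group.zcomb_cong[OF H])
        (use f sub D' in \<open>auto simp: hom_def the_inv_into_f_f\<close>)
    also have "\<dots> = f (zcomb G (\<lambda>a. a) c D')"
      by (rule hom_zcomb[OF f G H fin, symmetric]) (use sub in auto)
    also have "\<dots> = \<one>\<^bsub>H\<^esub>" using c hom_one[OF f] G H by (simp add: comm_group_def)
    finally have "\<forall>d\<in>D. ?c d = 0" using D(1) D'(3) unfolding independent_in_zcomb by auto
    then show "\<forall>a\<in>D'. c a = 0" using D' by (auto simp: the_inv_into_f_f)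
  qed
  then show thesis using that D' by (metis card_image)
qed

lemma rank_on_hom_image:
  assumes "f \<in> hom G H" "comm_group G" "comm_group H" "rank_on G B r" "B \<subseteq> carrier G"
  obtains s where "rank_on H (f ` B) s" "s \<le> r"
proof (rule rank_on_bounded[of "f ` B" H r])
  fix D assume "D \<subseteq> f ` B" "independent_in H D"
  then obtain D' where "D' \<subseteq> B" "independent_in G D'" "card D' = card D"
    using independent_lift assms by metis
  then show "card D \<le> r" using assms(4) unfolding rank_on_def by metis
qed (use that in blast)

lemma independent_inj_image:
  assumes f: "f \<in> hom G H" and G: "comm_group G" and H: "comm_group H"
    and inj: "inj_on f (carrier G)" and A: "independent_in G A"
  shows "independent_in H (f ` A)"
  unfolding independent_in_zcomb
proof (intro conjI allI impI)
  have fin: "finite A" and sub: "A \<subseteq> carrier G" using A by (auto simp: independent_in_def)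
  show "finite (f ` A)" using fin by simp
  show im: "f ` A \<subseteq> carrier H" using sub f by (auto simp: hom_def)
  fix c assume c: "zcomb H (\<lambda>a. a) c (f ` A) = \<one>\<^bsub>H\<^esub>"
  have "zcomb H (\<lambda>a. a) c (f ` A) = zcomb H f (\<lambda>i. c (f i)) A"
    by (rule comm_group.zcomb_reindex[OF H]) (use inj sub im in \<open>auto intro: inj_on_subset\<close>)
  also have "\<dots> = f (zcomb G (\<lambda>a. a) (\<lambda>i. c (f i)) A)"
    by (rule hom_zcomb[OF f G H fin, symmetric]) (use sub in auto)
  finally have "f (zcomb G (\<lambda>a. a) (\<lambda>i. c (f i)) A) = f \<one>\<^bsub>G\<^esub>"
    using c hom_one[OF f] G H by (simp add: comm_group_def)
  then have "zcomb G (\<lambda>a. a) (\<lambda>i. c (f i)) A = \<one>\<^bsub>G\<^esub>"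
    using inj sub G by (auto dest!: inj_onD intro!: comm_group.zcomb_closed monoid.one_closed
        simp: comm_group_def group_def)
  then show "\<forall>a\<in>f ` A. c a = 0" using A unfolding independent_in_zcomb by auto
qed

lemma rank_on_inj_image:
  assumes f: "f \<in> hom G H" and G: "comm_group G" and H: "comm_group H"
    and inj: "inj_on f (carrier G)" and r: "rank_on G B r" and B: "B \<subseteq> carrier G"
  shows "rank_on H (f ` B) r"
  unfolding rank_on_def
proof (intro conjI allI impI)
  obtain A where A: "A \<subseteq> B" "independent_in G A" "card A = r" using r unfolding rank_on_def by blast
  then have "f ` A \<subseteq> f ` B" "independent_in H (f ` A)" "card (f ` A) = r"
    using independent_inj_image[OF f G H inj] inj_on_subset[OF inj, of A] B
    by (auto simp: card_image)
  then show "\<exists>A\<subseteq>f ` B. independent_in H A \<and> card A = r" by blast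
  fix D assume "D \<subseteq> f ` B" "independent_in H D"
  then obtain D' where "D' \<subseteq> B" "independent_in G D'" "card D' = card D"
    using independent_lift assms by metis
  then show "card D \<le> r" using r unfolding rank_on_def by metis
qed

lemma rank_on_iso:
  assumes "G \<cong> H" "comm_group G" "comm_group H" "rank_on G (carrier G) r"
  shows "rank_on H (carrier H) r"
proof -
  obtain f where "f \<in> iso G H" using assms(1) by (auto simp: is_iso_def)
  then have "f \<in> hom G H" "inj_on f (carrier G)" "f ` carrier G = carrier H"
    by (auto simp: iso_def bij_betw_def)
  then show ?thesis using rank_on_inj_image assms by (metis order_refl)
qed

lemma rank_on_trivial:
  assumes "comm_group G"
  shows "rank_on G {\<one>\<^bsub>G\<^esub>} 0"
proof -
  interpret comm_group G by fact
  have "zcomb G (\<lambda>a. a) (\<lambda>_. 1) {\<one>\<^bsub>G\<^esub>} = \<one>\<^bsub>G\<^esub>"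
    unfolding zcomb_def by (rule finprod_one_eqI) simp
  then have "\<not> independent_in G {\<one>\<^bsub>G\<^esub>}"
    unfolding independent_in_zcomb by auto
  moreover have "independent_in G {}" by (simp add: independent_in_def)
  ultimately have "A = {}" if "A \<subseteq> {\<one>\<^bsub>G\<^esub>}" "independent_in G A" for A
    using that by (auto simp: subset_singleton_iff)
  then show ?thesis unfolding rank_on_def using \<open>independent_in G {}\<close>
    by (metis card.empty empty_subsetI order_refl)
qed

text \<open>A maximal independent subset \<open>A\<close> of the kernel and lifts \<open>E\<close> of a maximal independent subset
  of the image together have the right size. They span up to multiples: some multiple of \<open>f x\<close> is a combination
  in the image; subtracting the same combination of lifts from that multiple of \<open>x\<close> leaves an element of the kernel,
  of which a multiple is a combination of \<open>A\<close>.\<close>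

lemma rank_nullity:
  assumes f: "f \<in> hom G H" and G: "comm_group G" and H: "comm_group H"
    and k: "rank_on G (kernel G H f) k" and r: "rank_on H (f ` carrier G) r"
  shows "rank_on G (carrier G) (k + r)"
proof -
  interpret G: comm_group G by fact
  interpret H: comm_group H by fact
  interpret f: group_hom G H f using f by (simp add: group_hom_def group_hom_axioms_def)
  obtain A where A: "A \<subseteq> kernel G H f" "independent_in G A" "card A = k"
    using k unfolding rank_on_def by blast
  obtain D where D: "D \<subseteq> f ` carrier G" "independent_in H D" "card D = r"
    using r unfolding rank_on_def by blast
  obtain E where E: "E \<subseteq> carrier G" "inj_on f E" "f ` E = D" "independent_in G E" "card E = card D"
    using independent_lift[OF f G H D(2,1)] by blast
  have fin: "finite A" "finite E" and AG: "A \<subseteq> carrier G"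
    using A E by (auto simp: independent_in_def kernel_def)
  have f1: "f (zcomb G (\<lambda>z. z) c A) = \<one>\<^bsub>H\<^esub>" for c
  proof -
    have "f (zcomb G (\<lambda>z. z) c A) = zcomb H f c A"
      by (rule hom_zcomb[OF f G H fin(1)]) (use AG in auto)
    also have "\<dots> = zcomb H (\<lambda>_. \<one>\<^bsub>H\<^esub>) c A"
      by (rule H.zcomb_cong) (use A in \<open>auto simp: kernel_def\<close>)
    also have "\<dots> = \<one>\<^bsub>H\<^esub>" unfolding zcomb_def by (rule H.finprod_one_eqI) simp
    finally show ?thesis .
  qed
  have fE: "f (zcomb G (\<lambda>z. z) c E) = zcomb H (\<lambda>z. z) (\<lambda>d. c (the_inv_into E f d)) D" for c
  proof -
    have "f (zcomb G (\<lambda>z. z) c E) = zcomb H f c E"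
      by (rule hom_zcomb[OF f G H fin(2)]) (use E in auto)
    also have "\<dots> = zcomb H f (\<lambda>i. c (the_inv_into E f (f i))) E"
      by (rule H.zcomb_cong) (use E in \<open>auto simp: the_inv_into_f_f\<close>)
    also have "\<dots> = zcomb H (\<lambda>z. z) (\<lambda>d. c (the_inv_into E f d)) (f ` E)"
      by (rule H.zcomb_reindex[symmetric]) (use E in auto)
    finally show ?thesis using E by simp
  qed
  have disj: "A \<inter> E = {}"
  proof (rule ccontr)
    assume "A \<inter> E \<noteq> {}"
    then obtain x where x: "x \<in> A" "x \<in> E" by blast
    then have "\<one>\<^bsub>H\<^esub> \<in> D" using A E by (force simp: kernel_def)
    moreover have "zcomb H (\<lambda>z. z) (\<lambda>z. if z = \<one>\<^bsub>H\<^esub> then 1 else 0) D = \<one>\<^bsub>H\<^esub>"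
      unfolding zcomb_def by (rule H.finprod_one_eqI) simp
    ultimately show False using D(2) unfolding independent_in_zcomb by fastforce
  qed
  have split: "zcomb G (\<lambda>z. z) c (A \<union> E) = zcomb G (\<lambda>z. z) c A \<otimes>\<^bsub>G\<^esub> zcomb G (\<lambda>z. z) c E" for c
    by (rule G.zcomb_Un) (use fin disj AG E in auto)
  have "independent_in G (A \<union> E)"
    unfolding independent_in_zcomb
  proof (intro conjI allI impI)
    show "finite (A \<union> E)" "A \<union> E \<subseteq> carrier G" using fin AG E by auto
    fix c assume c: "zcomb G (\<lambda>z. z) c (A \<union> E) = \<one>\<^bsub>G\<^esub>"
    then have "f (zcomb G (\<lambda>z. z) c A \<otimes>\<^bsub>G\<^esub> zcomb G (\<lambda>z. z) c E) = \<one>\<^bsub>H\<^esub>" by (simp add: split)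
    then have "f (zcomb G (\<lambda>z. z) c E) = \<one>\<^bsub>H\<^esub>"
      using AG E f1 by simp
    then have "\<forall>d\<in>D. c (the_inv_into E f d) = 0"
      using D(2) unfolding fE independent_in_zcomb by blast
    then have cE: "\<forall>a\<in>E. c a = 0" using E by (auto simp: the_inv_into_f_f)
    then have "zcomb G (\<lambda>z. z) c E = \<one>\<^bsub>G\<^esub>" by (intro G.zcomb_0) auto
    then have "zcomb G (\<lambda>z. z) c A = \<one>\<^bsub>G\<^esub>" using c AG by (simp add: split)
    then have "\<forall>a\<in>A. c a = 0" using A(2) unfolding independent_in_zcomb by blast
    with cE show "\<forall>a\<in>A \<union> E. c a = 0" by auto
  qed
  moreover have "card (A \<union> E) = k + r"
    using fin disj A D E by (simp add: card_Un_disjoint)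
  moreover have "card B \<le> k + r" if B: "B \<subseteq> carrier G" "independent_in G B" for B
  proof -
    have "card B \<le> card (A \<union> E)"
    proof (rule G.independent_card_le)
      fix x assume "x \<in> B"
      then have x: "x \<in> carrier G" using B by auto
      have "\<exists>N::int. N \<noteq> 0 \<and> (\<exists>c. f x [^]\<^bsub>H\<^esub> N = zcomb H (\<lambda>z. z) c D)"
        by (rule rank_on_maximal[OF H, of "f ` carrier G"])
          (use D r x in \<open>auto simp: rank_on_def\<close>)
      then obtain N c where N: "N \<noteq> 0" "f x [^]\<^bsub>H\<^esub> (N::int) = zcomb H (\<lambda>z. z) c D" by blast
      define y where "y = zcomb G (\<lambda>z. z) (\<lambda>e. c (f e)) E"
      have y: "y \<in> carrier G" unfolding y_def by (rule G.zcomb_closed) (use E in auto)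
      have "f y = zcomb H (\<lambda>z. z) (\<lambda>d. c (f (the_inv_into E f d))) D" by (simp add: y_def fE)
      also have "\<dots> = zcomb H (\<lambda>z. z) c D"
        by (rule H.zcomb_cong) (use E D in \<open>auto simp: f_the_inv_into_f independent_in_def\<close>)
      finally have fy: "f y = f (x [^]\<^bsub>G\<^esub> N)" using N x by (simp add: f.hom_int_pow)
      \<comment> \<open>the part of the multiple of \<open>x\<close> that the lifts do not account for\<close>
      define w where "w = x [^]\<^bsub>G\<^esub> N \<otimes>\<^bsub>G\<^esub> inv\<^bsub>G\<^esub> y"
      have w: "w \<in> kernel G H f"
        using x y fy by (simp add: kernel_def w_def)
      have "\<exists>M::int. M \<noteq> 0 \<and> (\<exists>c. w [^]\<^bsub>G\<^esub> M = zcomb G (\<lambda>z. z) c A)"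
        by (rule rank_on_maximal[OF G, of "kernel G H f"])
          (use A k w in \<open>auto simp: rank_on_def kernel_def\<close>)
      then obtain M d where M: "M \<noteq> 0" "w [^]\<^bsub>G\<^esub> (M::int) = zcomb G (\<lambda>z. z) d A" by blast
      define e where "e = (\<lambda>z. if z \<in> A then d z else M * c (f z))"
      have "x [^]\<^bsub>G\<^esub> (N * M) = (w \<otimes>\<^bsub>G\<^esub> y) [^]\<^bsub>G\<^esub> M"
        using x y by (simp add: w_def G.m_assoc G.int_pow_pow)
      also have "\<dots> = w [^]\<^bsub>G\<^esub> M \<otimes>\<^bsub>G\<^esub> y [^]\<^bsub>G\<^esub> M"
        using w y by (simp add: G.int_pow_distrib kernel_def)
      also have "y [^]\<^bsub>G\<^esub> M = zcomb G (\<lambda>z. z) (\<lambda>z. M * c (f z)) E"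
        unfolding y_def by (rule G.zcomb_pow) (use E fin in auto)
      also have "\<dots> = zcomb G (\<lambda>z. z) e E"
        by (rule G.zcomb_cong) (use E disj in \<open>auto simp: e_def\<close>)
      also have "w [^]\<^bsub>G\<^esub> M = zcomb G (\<lambda>z. z) e A"
        unfolding M(2) by (rule G.zcomb_cong) (use AG in \<open>auto simp: e_def\<close>)
      finally have "x [^]\<^bsub>G\<^esub> (N * M) = zcomb G (\<lambda>z. z) e (A \<union> E)" by (simp add: split)
      then show "\<exists>N::int. N \<noteq> 0 \<and> (\<exists>c. x [^]\<^bsub>G\<^esub> N = zcomb G (\<lambda>z. z) c (A \<union> E))"
        using N M by (intro exI[of _ "N * M"]) auto
    qed (use fin AG E B in auto)
    then show ?thesis using \<open>card (A \<union> E) = k + r\<close> by simp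
  qed
  ultimately show ?thesis
    unfolding rank_on_def using AG E by (metis Un_least)
qed

lemma rank_on_integer_group: "rank_on integer_group (carrier integer_group) 1"
proof -
  interpret comm_group integer_group by (rule abelian_integer_group)
  have z: "zcomb integer_group (\<lambda>z. z) c {1} = c 1" for c
    using zcomb_insert[of "{}" 1 "\<lambda>z. z" c] by simp
  have "independent_in integer_group {1}"
    unfolding independent_in_zcomb by (simp add: z)
  moreover have "card A \<le> card {1::int}" if "independent_in integer_group A" for A
  proof (rule independent_card_le)
    fix a
    show "\<exists>N::int. N \<noteq> 0 \<and> (\<exists>c. a [^]\<^bsub>integer_group\<^esub> N = zcomb integer_group (\<lambda>z. z) c {1})"
      by (intro exI[of _ 1] conjI exI[of _ "\<lambda>_. a"]) (auto simp: z)
  qed (use that in auto)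
  ultimately show ?thesis unfolding rank_on_def
    by (metis One_nat_def carrier_integer_group card.empty card.insert empty_iff finite.emptyI subset_UNIV)
qed

text \<open>The number \<open>t\<close> is the rank of the image of \<open>g\<close>: this part of \<open>Z\<close> is new in \<open>B\<close>, and the
  rest injects, up to torsion, into \<open>C\<close> and is lost in \<open>D\<close>.\<close>

lemma five_term_rank:
  assumes comm: "comm_group A" "comm_group B" "comm_group Z" "comm_group C" "comm_group D"
    and hom: "f \<in> hom A B" "g \<in> hom B Z" "h \<in> hom Z C" "j \<in> hom C D"
    and ex: "inj_on f (carrier A)" "kernel B Z g = f ` carrier A" "kernel Z C h = g ` carrier B"
      "kernel C D j = h ` carrier Z" "j ` carrier C = carrier D"
    and rank: "rank_on A (carrier A) a" "rank_on Z (carrier Z) z" "rank_on C (carrier C) c"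
  obtains t where "t \<le> z" "z - t \<le> c" "rank_on B (carrier B) (a + t)"
    "rank_on D (carrier D) (c - (z - t))"
proof -
  have "g ` carrier B \<subseteq> carrier Z" "h ` carrier Z \<subseteq> carrier C"
    using hom by (auto simp: hom_def)
  then obtain t s where t: "rank_on Z (g ` carrier B) t" "t \<le> z" and s: "rank_on C (h ` carrier Z) s" "s \<le> c"
    using rank rank_on_mono by metis
  have "rank_on Z (carrier Z) (t + s)"
    by (rule rank_nullity[OF hom(3) comm(3,4)]) (use t s ex in auto)
  then have z: "z = t + s" using rank rank_on_unique by metis
  have "rank_on B (f ` carrier A) a"
    by (rule rank_on_inj_image) (use hom comm ex rank in auto)
  then have "rank_on B (carrier B) (a + t)"
    by (intro rank_nullity[OF hom(2) comm(2,3)]) (use t ex in auto)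
  moreover obtain d where d: "rank_on D (carrier D) d"
    using rank_on_hom_image[OF hom(4) comm(4,5) rank(3) order_refl] ex(5) by metis
  moreover have "rank_on C (carrier C) (s + d)"
    by (rule rank_nullity[OF hom(4) comm(4,5)]) (use s d ex in auto)
  then have "c = s + d" using rank rank_on_unique by metis
  ultimately show thesis using that[of t] t z by auto
qed

section \<open>Retractions and collapses\<close>

text \<open>A ray from a relative interior point meets the relative frontier only once, since the open segment
  to a point of the closure stays in the relative interior.\<close>

lemma convex_radial_point_unique:
  fixes x :: "'a::euclidean_space"
  assumes S: "convex S" "0 \<in> rel_interior S" and k: "0 < k" "k *\<^sub>R x \<in> rel_frontier S"
    and l: "0 < l" "l *\<^sub>R x \<in> rel_frontier S" and x: "x \<noteq> 0"
  shows "k = l"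
proof -
  have False if kl: "0 < k" "k < l" "k *\<^sub>R x \<in> rel_frontier S" "l *\<^sub>R x \<in> rel_frontier S" for k l
  proof -
    have "l *\<^sub>R x \<in> closure S" using kl by (simp add: rel_frontier_def)
    then have "open_segment 0 (l *\<^sub>R x) \<subseteq> rel_interior S"
      by (rule rel_interior_closure_convex_segment[OF S])
    moreover have "k *\<^sub>R x \<in> open_segment 0 (l *\<^sub>R x)"
      unfolding in_segment using kl x by (auto intro!: exI[of _ "k / l"])
    ultimately show False using kl by (auto simp: rel_frontier_def)
  qed
  then show ?thesis using k l by (metis linorder_neqE_linordered_idom)
qed

text \<open>The factor \<open>d x\<close> moves \<open>x\<close> along its ray to the relative frontier. Because that frontier is
  compact and met once by every ray, the projection onto it is continuous.\<close>

lemma radial_retraction_0: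
  fixes S :: "'a::euclidean_space set"
  assumes S: "convex S" "bounded S" "0 \<in> rel_interior S"
  obtains d where "continuous_on (span S - {0}) (\<lambda>x. d x *\<^sub>R x)"
    "\<And>x. x \<in> span S - {0} \<Longrightarrow> 0 < d x \<and> d x *\<^sub>R x \<in> rel_frontier S"
    "\<And>x. x \<in> rel_frontier S \<Longrightarrow> d x = 1"
proof -
  have "0 \<in> S" using S rel_interior_subset by blast
  then have aff: "affine hull S = span S" by (simp add: affine_hull_span_0 hull_inc)
  have "\<exists>k. 0 < k \<and> k *\<^sub>R x \<in> rel_frontier S" if "x \<in> span S - {0}" for x
    using ray_to_rel_frontier[OF S(2,3), of x] that aff by (metis Diff_iff add_0 insertCI)
  then obtain d where d: "\<And>x. x \<in> span S - {0} \<Longrightarrow> 0 < d x \<and> d x *\<^sub>R x \<in> rel_frontier S"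
    by metis
  have sub: "rel_frontier S \<subseteq> span S - {0}"
    using S(3) aff rel_frontier_affine_hull[of S] by (auto simp: rel_frontier_def)
  have uniq: "k = d x" if "x \<in> span S - {0}" "0 < k" "k *\<^sub>R x \<in> rel_frontier S" for x k
    using convex_radial_point_unique[OF S(1,3) that(2,3)] d[OF that(1)] that(1) by auto
  show thesis
  proof
    show "continuous_on (span S - {0}) (\<lambda>x. d x *\<^sub>R x)"
    proof (rule continuous_on_compact_surface_projection)
      show "compact (rel_frontier S)" using S by (simp add: compact_rel_frontier_bounded)
    qed (use sub d uniq in \<open>auto simp: subspace_imp_cone\<close>)
    show "d x = 1" if "x \<in> rel_frontier S" for x
      using uniq[of x 1] that sub by auto
  qed (use d in auto)
qed

text \<open>The last property is what makes this retraction a deformation of the punctured set: the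
  straight-line homotopy never passes through the puncture.\<close>

lemma radial_retraction:
  fixes S :: "'a::euclidean_space set"
  assumes S: "convex S" "compact S" "b \<in> rel_interior S"
  obtains r where "continuous_on (S - {b}) r" "\<And>x. x \<in> S - {b} \<Longrightarrow> r x \<in> rel_frontier S"
    "\<And>x. x \<in> rel_frontier S \<Longrightarrow> r x = x"
    "\<And>x. x \<in> S - {b} \<Longrightarrow> b \<notin> closed_segment x (r x)"
proof -
  define T where "T = (\<lambda>z. - b + z) ` S"
  have "convex T" "bounded T"
    using S by (simp_all add: T_def convex_translation_eq bounded_translation compact_imp_bounded del: add_uminus_conv_diff uminus_add_conv_diff)
  moreover have T0: "0 \<in> rel_interior T" "rel_frontier T = (\<lambda>z. - b + z) ` rel_frontier S"
    unfolding T_def rel_interior_translation[of "- b" S] rel_frontier_translation[of "- b" S]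
    using S(3) by (auto intro: image_eqI[of _ _ b])
  ultimately obtain d where d: "continuous_on (span T - {0}) (\<lambda>x. d x *\<^sub>R x)"
    "\<And>x. x \<in> span T - {0} \<Longrightarrow> 0 < d x \<and> d x *\<^sub>R x \<in> rel_frontier T"
    "\<And>x. x \<in> rel_frontier T \<Longrightarrow> d x = 1"
    using radial_retraction_0 by metis
  define r where "r = (\<lambda>x. b + d (- b + x) *\<^sub>R (- b + x))"
  have im: "- b + x \<in> span T - {0}" if "x \<in> S - {b}" for x
    using that by (auto simp: T_def intro!: span_base)
  show thesis
  proof
    have "continuous_on (S - {b}) ((\<lambda>x. d x *\<^sub>R x) \<circ> (\<lambda>x. - b + x))"
      by (rule continuous_on_compose)
        (use im in \<open>auto intro!: continuous_intros continuous_on_subset[OF d(1)]\<close>)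
    then show "continuous_on (S - {b}) r"
      unfolding r_def by (auto intro!: continuous_intros simp: o_def)
    show "r x \<in> rel_frontier S" if "x \<in> S - {b}" for x
    proof -
      have "d (- b + x) *\<^sub>R (- b + x) \<in> (\<lambda>z. - b + z) ` rel_frontier S"
        using d(2)[OF im[OF that]] T0 by simp
      then show ?thesis by (auto simp: r_def)
    qed
    show "r x = x" if "x \<in> rel_frontier S" for x
      using d(3)[of "- b + x"] that T0 by (auto simp: r_def)
    show "b \<notin> closed_segment x (r x)" if "x \<in> S - {b}" for x
    proof
      assume "b \<in> closed_segment x (r x)"
      then obtain u where u: "0 \<le> u" "u \<le> 1" "b = (1 - u) *\<^sub>R x + u *\<^sub>R r x"
        by (auto simp: in_segment)
      have "((1 - u) + u * d (- b + x)) *\<^sub>R (x - b) = ((1 - u) *\<^sub>R x + u *\<^sub>R r x) - b"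
        by (simp add: r_def algebra_simps)
      then have "((1 - u) + u * d (- b + x)) = 0" using u(3) that by auto
      moreover have "0 < (1 - u) + u * d (- b + x)"
        using d(2)[OF im[OF that]] u by (cases "u = 0") (auto intro: add_nonneg_pos)
      ultimately show False by simp
    qed
  qed
qed

text \<open>The retraction of \<open>T\<close> is extended by the identity on \<open>A\<close>, and the extension is joined to
  the identity by straight lines.\<close>

lemma glue_retract_homotopy_equivalent:
  fixes A T :: "'a::euclidean_space set"
  assumes A: "closedin (top_of_set (A \<union> T)) A" and T: "closedin (top_of_set (A \<union> T)) T"
    and r: "continuous_on T r" "r \<in> T \<rightarrow> A" "\<And>x. x \<in> A \<inter> T \<Longrightarrow> r x = x"
    and seg: "\<And>x. x \<in> T \<Longrightarrow> closed_segment x (r x) \<subseteq> A \<union> T"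
  shows "top_of_set (A \<union> T) homotopy_equivalent_space top_of_set A"
proof -
  define R where "R = (\<lambda>x. if x \<in> A then x else r x)"
  have cR: "continuous_on (A \<union> T) R"
    unfolding R_def by (rule continuous_on_cases_local) (use A T r in \<open>auto\<close>)
  have RT: "R x = r x" if "x \<in> T" for x using r that by (auto simp: R_def)
  have "homotopic_with_canon (\<lambda>x. True) (A \<union> T) (A \<union> T) R id"
  proof (rule homotopic_with_linear)
    show "closed_segment (R x) (id x) \<subseteq> A \<union> T" if "x \<in> A \<union> T" for x
      using that seg[of x] by (cases "x \<in> A") (auto simp: R_def closed_segment_commute)
  qed (use cR in auto)
  moreover have "retraction_maps (top_of_set (A \<union> T)) (top_of_set A) R id"
    unfolding retraction_maps_def using cR r by (auto simp: R_def Pi_iff)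
  ultimately show ?thesis
    by (metis deformation_retraction_imp_homotopy_equivalent_space id_comp)
qed

lemma punctured_cell_homotopy_equivalent:
  fixes A S :: "'a::euclidean_space set"
  assumes A: "closed A" and S: "convex S" "compact S" "A \<inter> S = rel_frontier S" and b: "b \<in> rel_interior S"
  shows "top_of_set (A \<union> S - {b}) homotopy_equivalent_space top_of_set A"
proof -
  obtain r where r: "continuous_on (S - {b}) r" "\<And>x. x \<in> S - {b} \<Longrightarrow> r x \<in> rel_frontier S"
    "\<And>x. x \<in> rel_frontier S \<Longrightarrow> r x = x"
    "\<And>x. x \<in> S - {b} \<Longrightarrow> b \<notin> closed_segment x (r x)"
    using radial_retraction[OF S(1,2) b] by blast
  have fr: "rel_frontier S \<subseteq> S" using S(3) by blast
  have bA: "b \<notin> A" using b S(3) rel_interior_subset[of S] by (auto simp: rel_frontier_def)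
  then have e: "A \<union> S - {b} = A \<union> (S - {b})" by auto
  show ?thesis unfolding e
  proof (rule glue_retract_homotopy_equivalent)
    have "A = A \<inter> (A \<union> (S - {b}))" "S - {b} = S \<inter> (A \<union> (S - {b}))"
      using bA S(3) by auto
    then show "closedin (top_of_set (A \<union> (S - {b}))) A" "closedin (top_of_set (A \<union> (S - {b}))) (S - {b})"
      using A S compact_imp_closed by (metis closedin_closed_Int inf_commute)+
    show "closed_segment x (r x) \<subseteq> A \<union> (S - {b})" if "x \<in> S - {b}" for x
    proof -
      have "closed_segment x (r x) \<subseteq> S"
        by (rule closed_segment_subset) (use that r(2)[OF that] fr S in auto)
      then show ?thesis using r(4)[OF that] by auto
    qed
  qed (use r S in auto)
qed

text \<open>The situation of an elementary collapse. An absolute retract that is closed is a retract of the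
  ambient space and in particular of \<open>S\<close>; convexity of \<open>S\<close> supplies the homotopy. This replaces the explicit
  projection away from the free face.\<close>

lemma collapse_homotopy_equivalent:
  fixes A S :: "'a::euclidean_space set"
  assumes A: "closed A" and S: "convex S" "compact S" and AR: "AR (A \<inter> S)"
  shows "top_of_set (A \<union> S) homotopy_equivalent_space top_of_set A"
proof -
  have "closed (A \<inter> S)" using A S by (simp add: closed_Int compact_imp_closed)
  then have "(A \<inter> S) retract_of UNIV"
    using AR_imp_absolute_retract_UNIV[OF AR homeomorphic_refl] by blast
  then obtain r where r: "retraction UNIV (A \<inter> S) r" by (auto simp: retract_of_def)
  show ?thesis
  proof (rule glue_retract_homotopy_equivalent)
    show "continuous_on S r" using r continuous_on_subset unfolding retraction_def by blast
    show "closed_segment x (r x) \<subseteq> A \<union> S" if "x \<in> S" for x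
    proof -
      have "closed_segment x (r x) \<subseteq> S"
        by (rule closed_segment_subset) (use that r S in \<open>auto simp: retraction_def Pi_iff\<close>)
      then show ?thesis by blast
    qed
  qed (use A S r in \<open>auto simp: retraction_def Pi_iff compact_imp_closed closed_subset\<close>)
qed

section \<open>Homology of a cell attachment\<close>

lemma homology_exact:
  shows "kernel (relative_homology_group p X S) (homology_group (p-1) (subtopology X S)) (hom_boundary p X S)
      = hom_induced p X {} X S id ` carrier (homology_group p X)"
    and "kernel (homology_group (p-1) (subtopology X S)) (homology_group (p-1) X)
          (hom_induced (p-1) (subtopology X S) {} X {} id)
      = hom_boundary p X S ` carrier (relative_homology_group p X S)"
    and "kernel (homology_group p X) (relative_homology_group p X S) (hom_induced p X {} X S id)
      = hom_induced p (subtopology X S) {} X {} id ` carrier (homology_group p (subtopology X S))"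
  using homology_exactness_axiom_1[of p X S] homology_exactness_axiom_2[of p X S]
    homology_exactness_axiom_3[of p X S] by simp_all

lemma inclusion_inj_if_trivial:
  assumes "trivial_group (relative_homology_group (i + 1) X S)"
  shows "inj_on (hom_induced i (subtopology X S) {} X {} id) (carrier (homology_group i (subtopology X S)))"
proof -
  let ?h = "hom_induced i (subtopology X S) {} X {} id"
  interpret h: group_hom "homology_group i (subtopology X S)" "homology_group i X" ?h
    by (simp add: group_hom_def group_hom_axioms_def hom_induced_hom)
  have "kernel (homology_group i (subtopology X S)) (homology_group i X) ?h
      = hom_boundary (i + 1) X S ` carrier (relative_homology_group (i + 1) X S)"
    using homology_exact(2)[of "i + 1" X S] by simp
  also have "\<dots> = {hom_boundary (i + 1) X S \<one>\<^bsub>relative_homology_group (i + 1) X S\<^esub>}"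
    using assms by (auto simp: trivial_group_def)
  also have "hom_boundary (i + 1) X S \<one>\<^bsub>relative_homology_group (i + 1) X S\<^esub> = \<one>\<^bsub>homology_group i (subtopology X S)\<^esub>"
    using hom_one[OF hom_boundary_hom[of "i + 1" X S]] by simp
  finally show ?thesis using h.inj_iff_trivial_ker by blast
qed

lemma inclusion_surj_if_trivial:
  assumes "trivial_group (relative_homology_group i X S)"
  shows "hom_induced i (subtopology X S) {} X {} id ` carrier (homology_group i (subtopology X S))
    = carrier (homology_group i X)"
proof -
  have "hom_induced i X {} X S id x = \<one>\<^bsub>relative_homology_group i X S\<^esub>" for x
    using hom_induced_carrier[of i X "{}" X S id x] assms by (auto simp: trivial_group_def)
  then show ?thesis unfolding homology_exact(3)[symmetric] by (auto simp: kernel_def)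
qed

text \<open>Away from the degrees \<open>p\<close> and \<open>p - 1\<close> the inclusion induces isomorphisms. In these two
  degrees the exact sequence of the pair reduces to five terms, and the infinite cyclic group either enlarges
  \<open>H\<^sub>p\<close> or is absorbed by \<open>H\<^sub>p\<^sub>-\<^sub>1\<close>.\<close>

lemma rank_attach_infinite_cyclic:
  fixes X :: "'x topology" and b :: "int \<Rightarrow> nat"
  assumes triv: "\<And>i. i \<noteq> p \<Longrightarrow> trivial_group (relative_homology_group i X S)"
    and Z: "relative_homology_group p X S \<cong> integer_group"
    and b: "\<And>i. rank_on (homology_group i (subtopology X S)) (carrier (homology_group i (subtopology X S))) (b i)"
  shows "(\<forall>i. rank_on (homology_group i X) (carrier (homology_group i X)) ((b(p := b p + 1)) i)) \<or>
    1 \<le> b (p - 1) \<and>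
    (\<forall>i. rank_on (homology_group i X) (carrier (homology_group i X)) ((b(p - 1 := b (p - 1) - 1)) i))"
proof -
  let ?Y = "subtopology X S"
  have iso: "rank_on (homology_group i X) (carrier (homology_group i X)) (b i)" if "i \<noteq> p" "i \<noteq> p - 1" for i
  proof -
    have "rank_on (homology_group i X) (hom_induced i ?Y {} X {} id ` carrier (homology_group i ?Y)) (b i)"
      by (rule rank_on_inj_image[OF hom_induced_hom])
        (use b that in \<open>auto intro!: inclusion_inj_if_trivial triv\<close>)
    then show ?thesis using that by (simp add: inclusion_surj_if_trivial triv)
  qed
  have Z1: "rank_on (relative_homology_group p X S) (carrier (relative_homology_group p X S)) 1"
    by (rule rank_on_iso[OF group.iso_sym[OF _ Z]])
      (use rank_on_integer_group in \<open>simp_all add: abelian_integer_group\<close>)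
  obtain t where t: "t \<le> 1" "1 - t \<le> b (p - 1)"
      "rank_on (homology_group p X) (carrier (homology_group p X)) (b p + t)"
      "rank_on (homology_group (p - 1) X) (carrier (homology_group (p - 1) X)) (b (p - 1) - (1 - t))"
    using five_term_rank[OF abelian_homology_group abelian_homology_group abelian_relative_homology_group
        abelian_homology_group abelian_homology_group
        hom_induced_hom hom_induced_hom hom_boundary_hom hom_induced_hom
        inclusion_inj_if_trivial homology_exact(3) homology_exact(1) homology_exact(2)
        inclusion_surj_if_trivial b[of p] Z1 b[of "p - 1"]] triv by auto
  show ?thesis
  proof (cases "t = 0")
    case True
    then have "rank_on (homology_group i X) (carrier (homology_group i X)) ((b(p - 1 := b (p - 1) - 1)) i)" for i
      using t iso[of i] by (cases "i = p"; cases "i = p - 1") auto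
    then show ?thesis using t True by simp
  next
    case False
    then have "t = 1" using t by simp
    then have "rank_on (homology_group i X) (carrier (homology_group i X)) ((b(p := b p + 1)) i)" for i
      using t iso[of i] by (cases "i = p"; cases "i = p - 1") auto
    then show ?thesis by simp
  qed
qed

text \<open>Excision of the complement of \<open>U\<close>.\<close>

lemma local_homology_open_subset:
  assumes U: "openin X U" "b \<in> U" "closedin X {b}"
  shows "relative_homology_group i (subtopology X U) (U - {b}) \<cong> relative_homology_group i X (topspace X - {b})"
proof -
  have UX: "U \<subseteq> topspace X" using U openin_subset by blast
  have op: "openin X (topspace X - {b})" using U by blast
  have "X closure_of (topspace X - U) \<subseteq> X interior_of (topspace X - {b})"
    using U UX op by (simp add: interior_of_openin closure_of_closedin closedin_diff) blast
  from homology_excision_axiom[OF this, of "topspace X" i]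
  have "hom_induced i (subtopology X (topspace X - (topspace X - U))) (topspace X - {b} - (topspace X - U))
       (subtopology X (topspace X)) (topspace X - {b}) id
    \<in> iso (relative_homology_group i (subtopology X (topspace X - (topspace X - U)))
             (topspace X - {b} - (topspace X - U)))
           (relative_homology_group i (subtopology X (topspace X)) (topspace X - {b}))" by blast
  moreover have "topspace X - (topspace X - U) = U" "topspace X - {b} - (topspace X - U) = U - {b}"
    using UX by auto
  ultimately show ?thesis by (simp add: is_isoI)
qed

lemma Euclidean_space_0: "topspace (Euclidean_space 0) = {\<lambda>_. 0}"
  by (auto simp: topspace_Euclidean_space)

lemma closedin_Euclidean_space_singleton:
  "x \<in> topspace (Euclidean_space n) \<Longrightarrow> closedin (Euclidean_space n) {x}"
  by (simp add: Hausdorff_Euclidean_space closedin_Hausdorff_singleton)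

text \<open>For the origin this is the \<open>p\<close>-fold suspension of the pair consisting of a point and the empty set.
  The position of the puncture does not matter, because homeomorphic closed sets have complements with the same
  relative homology.\<close>

lemma homology_Euclidean_punctured:
  fixes x :: "nat \<Rightarrow> real"
  assumes x: "x \<in> topspace (Euclidean_space p)"
  shows "relative_homology_group i (Euclidean_space p) (topspace (Euclidean_space p) - {x})
    \<cong> homology_group (i - int p) (Euclidean_space 0)"
proof -
  let ?o = "\<lambda>_::nat. 0::real"
  have o: "?o \<in> topspace (Euclidean_space n)" for n by (simp add: topspace_Euclidean_space)
  have "subtopology (Euclidean_space p) {?o} homeomorphic_space subtopology (Euclidean_space p) {x}"
    unfolding homeomorphic_space_def
    by (intro exI[of _ "\<lambda>_. x"] exI[of _ "\<lambda>_. ?o"])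
      (use x o in \<open>auto simp: homeomorphic_maps_def\<close>)
  then have "relative_homology_group i (Euclidean_space p) (topspace (Euclidean_space p) - {?o})
      \<cong> relative_homology_group i (Euclidean_space p) (topspace (Euclidean_space p) - {x})"
    using isomorphic_relative_homology_groups_Euclidean_complements closedin_Euclidean_space_singleton o x by blast
  moreover have "relative_homology_group (i - int p) (Euclidean_space 0) (topspace (Euclidean_space 0) - {?o})
      \<cong> relative_homology_group (i - int p + int p) (Euclidean_space (0 + p)) (topspace (Euclidean_space (0 + p)) - {?o})"
    by (rule relative_homology_group_Euclidean_complement_step) (rule closedin_Euclidean_space_singleton[OF o])
  ultimately have "homology_group (i - int p) (Euclidean_space 0)
      \<cong> relative_homology_group i (Euclidean_space p) (topspace (Euclidean_space p) - {x})"
    using iso_trans by (fastforce simp: Euclidean_space_0)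
  then show ?thesis by (rule group.iso_sym[OF group_relative_homology_group])
qed

text \<open>The relative interior of \<open>S\<close> is open both in \<open>A \<union> S\<close> and in the affine hull of \<open>S\<close>. Excising
  both complements compares the pair with a punctured Euclidean space.\<close>

lemma homology_cell_punctured:
  fixes A S :: "'a::euclidean_space set"
  assumes A: "closed A" and S: "convex S" "compact S" "A \<inter> S = rel_frontier S" and b: "b \<in> rel_interior S"
    and p: "aff_dim S = int p"
  shows "relative_homology_group i (top_of_set (A \<union> S)) (A \<union> S - {b})
    \<cong> homology_group (i - int p) (Euclidean_space 0)"
proof -
  define U where "U = rel_interior S"
  have ri: "rel_interior S = S - rel_frontier S"
    using rel_interior_subset[of S] S(2) by (auto simp: rel_frontier_def compact_imp_closed)
  then have bU: "b \<in> U" "b \<in> S" "U = (A \<union> S) - A" using b S(3) by (auto simp: U_def)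
  have UA: "(A \<union> S) \<inter> U = U" using bU(3) by blast
  have cl: "closedin (top_of_set T) {b}" if "b \<in> T" for T
    using that by (simp add: closed_subset)
  have "openin (top_of_set (A \<union> S)) U"
    unfolding bU(3) using A by (intro openin_diff) (auto simp: closed_subset)
  from local_homology_open_subset[OF this bU(1) cl, of i]
  have 1: "relative_homology_group i (top_of_set U) (U - {b}) \<cong> relative_homology_group i (top_of_set (A \<union> S)) (A \<union> S - {b})"
    by (simp only: subtopology_subtopology UA topspace_euclidean_subtopology bU(2) UnI2)
  define H where "H = affine hull S"
  have UH: "U \<subseteq> H" using subset_trans[OF rel_interior_subset hull_subset] unfolding U_def H_def .
  have "openin (top_of_set H) U" unfolding U_def H_def by (rule openin_rel_interior)
  from local_homology_open_subset[OF this bU(1) cl, of i]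
  have 2: "relative_homology_group i (top_of_set U) (U - {b}) \<cong> relative_homology_group i (top_of_set H) (H - {b})"
    by (simp only: subtopology_subtopology Int_absorb1[OF UH] topspace_euclidean_subtopology subsetD[OF UH bU(1)])
  have "top_of_set H homeomorphic_space Euclidean_space p"
    unfolding H_def using p by (simp add: homeomorphic_affine_Euclidean_space)
  then obtain h where h: "homeomorphic_map (top_of_set H) (Euclidean_space p) h"
    using homeomorphic_space by blast
  have hb: "h b \<in> topspace (Euclidean_space p)" and him: "h ` H = topspace (Euclidean_space p)" and inj: "inj_on h H"
    using h bU UH by (auto simp: homeomorphic_eq_everything_map)
  have "hom_induced i (top_of_set H) (H - {b}) (Euclidean_space p) (topspace (Euclidean_space p) - {h b}) h
    \<in> iso (relative_homology_group i (top_of_set H) (H - {b}))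
        (relative_homology_group i (Euclidean_space p) (topspace (Euclidean_space p) - {h b}))"
    by (rule homeomorphic_map_relative_homology_iso[OF h]) (use inj him bU UH in \<open>auto simp: inj_on_def\<close>)
  then have 3: "relative_homology_group i (top_of_set H) (H - {b})
      \<cong> relative_homology_group i (Euclidean_space p) (topspace (Euclidean_space p) - {h b})"
    by (rule is_isoI)
  show ?thesis
    by (rule iso_trans[OF group.iso_sym[OF group_relative_homology_group 1]
          iso_trans[OF 2 iso_trans[OF 3 homology_Euclidean_punctured[OF hb]]]])
qed

text \<open>Instead of the pair with \<open>A\<close>, the pair with the punctured space \<open>A \<union> S - {c}\<close> is used: it has the
  same absolute homology, and its relative homology is local at \<open>c\<close>.\<close>

lemma rank_cell_attachment:
  fixes A S :: "'a::euclidean_space set" and b :: "int \<Rightarrow> nat"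
  assumes A: "closed A" and S: "convex S" "compact S" "A \<inter> S = rel_frontier S"
    and p: "aff_dim S = int p"
    and b: "\<And>i. rank_on (homology_group i (top_of_set A)) (carrier (homology_group i (top_of_set A))) (b i)"
  defines "X \<equiv> top_of_set (A \<union> S)"
  shows "(\<forall>i. rank_on (homology_group i X) (carrier (homology_group i X)) ((b(int p := b (int p) + 1)) i)) \<or>
    1 \<le> b (int p - 1) \<and>
    (\<forall>i. rank_on (homology_group i X) (carrier (homology_group i X)) ((b(int p - 1 := b (int p - 1) - 1)) i))"
proof -
  have "S \<noteq> {}" using p by auto
  then obtain c where c: "c \<in> rel_interior S" using S(1) rel_interior_eq_empty by blast
  let ?P = "A \<union> S - {c}"
  have P: "subtopology X ?P = top_of_set ?P"
    unfolding X_def by (simp add: subtopology_subtopology Int_absorb1)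
  have rel: "relative_homology_group i X ?P \<cong> homology_group (i - int p) (Euclidean_space 0)" for i
    unfolding X_def by (rule homology_cell_punctured[OF A S c p])
  show ?thesis
  proof (rule rank_attach_infinite_cyclic[where S = ?P])
    show "trivial_group (relative_homology_group i X ?P)" if "i \<noteq> int p" for i
      using isomorphic_group_triviality[OF rel] homology_dimension_axiom[OF Euclidean_space_0, of "i - int p"] that
      by simp
    show "relative_homology_group (int p) X ?P \<cong> integer_group"
      using iso_trans[OF rel[of "int p"]] homology_coefficients[OF Euclidean_space_0] by simp
    fix i
    have "top_of_set A homotopy_equivalent_space top_of_set ?P"
      using punctured_cell_homotopy_equivalent[OF A S c] homotopy_equivalent_space_sym by blast
    then show "rank_on (homology_group i (subtopology X ?P)) (carrier (homology_group i (subtopology X ?P))) (b i)"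
      unfolding P using rank_on_iso[OF homotopy_equivalent_space_imp_isomorphic_homology_groups _ _ b] by simp
  qed
qed

section \<open>Faces of a simplex and basic fields\<close>

context
  fixes V :: "'a::euclidean_space set"
  assumes V: "\<not> affine_dependent V"
begin

lemma finite_vertices: "finite V"
  using V aff_independent_finite by blast

lemma hull_face: "A \<subseteq> V \<Longrightarrow> convex hull A face_of convex hull V"
  using face_of_convex_hull_affine_independent[OF V] by blast

lemma hull_simplex: "A \<subseteq> V \<Longrightarrow> (int (card A) - 1) simplex (convex hull A)"
  by (rule simplex_convex_hull) (use V affine_independent_subset in auto)

lemma aff_dim_hull: "A \<subseteq> V \<Longrightarrow> aff_dim (convex hull A) = int (card A) - 1"
  using hull_simplex aff_dim_simplex by blast

lemma hull_subset_iff: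
  assumes "A \<subseteq> V" "B \<subseteq> V"
  shows "convex hull A \<subseteq> convex hull B \<longleftrightarrow> A \<subseteq> B"
proof
  assume le: "convex hull A \<subseteq> convex hull B"
  show "A \<subseteq> B"
  proof
    fix a assume a: "a \<in> A"
    show "a \<in> B"
    proof (rule ccontr)
      assume "a \<notin> B"
      then have "B \<subseteq> V - {a}" using assms by blast
      moreover have "a \<in> convex hull B" using a le hull_inc by (metis subsetD)
      ultimately have "a \<in> affine hull (V - {a})"
        using convex_hull_subset_affine_hull hull_mono by blast
      then show False using V a assms unfolding affine_dependent_def by blast
    qed
  qed
qed (rule hull_mono)

lemma hull_eq_iff: "\<lbrakk>A \<subseteq> V; B \<subseteq> V\<rbrakk> \<Longrightarrow> convex hull A = convex hull B \<longleftrightarrow> A = B"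
  using hull_subset_iff by (metis subset_antisym order_refl)

lemma hull_Int: "\<lbrakk>A \<subseteq> V; B \<subseteq> V\<rbrakk> \<Longrightarrow> convex hull A \<inter> convex hull B = convex hull (A \<inter> B)"
  by (rule convex_hull_Int[symmetric]) (use V affine_independent_subset in blast)

lemma face_of_hull_iff: "G face_of convex hull V \<longleftrightarrow> (\<exists>A\<subseteq>V. G = convex hull A)"
  by (rule face_of_convex_hull_affine_independent[OF V])

lemma facets_hull: "facets (convex hull V) = (\<lambda>v. convex hull (V - {v})) ` V"
proof (intro Set.set_eqI iffI)
  fix F assume "F \<in> facets (convex hull V)"
  then obtain A where A: "A \<subseteq> V" "F = convex hull A" "aff_dim F = aff_dim (convex hull V) - 1"
    by (auto simp: facets_def face_of_hull_iff)
  then have "card A = card V - 1" "card V \<ge> 1"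
    using aff_dim_hull[of A] aff_dim_hull[of V] by auto
  then have "card (V - A) = 1" using A finite_vertices by (simp add: card_Diff_subset finite_subset)
  then obtain v where "V - A = {v}" using card_1_singletonE by blast
  then have "v \<in> V" "A = V - {v}" using A by auto
  then show "F \<in> (\<lambda>v. convex hull (V - {v})) ` V" using A by blast
next
  fix F assume "F \<in> (\<lambda>v. convex hull (V - {v})) ` V"
  then obtain v where v: "v \<in> V" "F = convex hull (V - {v})" by blast
  then have "card V = Suc (card (V - {v}))" using card.remove[OF finite_vertices] by simp
  then show "F \<in> facets (convex hull V)"
    using v hull_face[of "V - {v}"] aff_dim_hull[of "V - {v}"] aff_dim_hull[of V] by (auto simp: facets_def)
qed

lemma inj_facets: "inj_on (\<lambda>v. convex hull (V - {v})) V"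
  by (rule inj_onI) (auto simp: hull_eq_iff)

lemma card_facets_hull: "card (facets (convex hull V)) = card V"
  using inj_facets by (simp add: facets_hull card_image)

end

lemma simplex_vertices:
  assumes "n simplex (S :: 'a::euclidean_space set)"
  obtains V where "\<not> affine_dependent V" "S = convex hull V" "int (card V) = n + 1"
  using assms unfolding simplex_def by blast

lemma facets_simplex:
  fixes S :: "'a::euclidean_space set"
  assumes "int n simplex S"
  shows "card (facets S) = n + 1" "finite (facets S)"
proof -
  obtain V where V: "\<not> affine_dependent V" "S = convex hull V" "int (card V) = int n + 1"
    using assms simplex_vertices by blast
  show "card (facets S) = n + 1" using card_facets_hull[OF V(1)] V by simp
  then show "finite (facets S)" by (metis card.infinite Suc_eq_plus1 nat.distinct(1))
qed

lemma facet_simplex: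
  assumes "n simplex (S :: 'a::euclidean_space set)" "F \<in> facets S"
  shows "(n - 1) simplex F" "F face_of S"
proof -
  obtain V where V: "\<not> affine_dependent V" "S = convex hull V" "int (card V) = n + 1"
    using assms simplex_vertices by blast
  then obtain v where v: "v \<in> V" "F = convex hull (V - {v})" using assms facets_hull by blast
  then have "card V = Suc (card (V - {v}))" using card.remove[OF finite_vertices[OF V(1)]] by simp
  then show "(n - 1) simplex F" using hull_simplex[OF V(1), of "V - {v}"] V v by simp
  show "F face_of S" using assms(2) by (simp add: facets_def)
qed

lemma facet_subset_eq:
  assumes "n simplex (S :: 'a::euclidean_space set)" "F \<in> facets S" "G \<in> facets S" "F \<subseteq> G"
  shows "F = G"
proof -
  obtain V where V: "\<not> affine_dependent V" "S = convex hull V" "int (card V) = n + 1"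
    using assms simplex_vertices by blast
  then show ?thesis using assms facets_hull[OF V(1)]
    by (auto simp: hull_subset_iff[OF V(1)])
qed

lemma facet_Int_facet:
  assumes "n simplex (S :: 'a::euclidean_space set)" "F \<in> facets S"
  shows "inj_on ((\<inter>) F) (facets S - {F})" "(\<inter>) F ` (facets S - {F}) \<subseteq> facets F"
proof -
  obtain V where V: "\<not> affine_dependent V" "S = convex hull V" "int (card V) = n + 1"
    using assms simplex_vertices by blast
  then obtain v where v: "v \<in> V" "F = convex hull (V - {v})" using assms facets_hull by blast
  have V': "\<not> affine_dependent (V - {v})" using V affine_independent_subset by blast
  have i: "F \<inter> convex hull (V - {w}) = convex hull (V - {v} - {w})" for w
    using hull_Int[OF V(1), of "V - {v}" "V - {w}"] v by (simp add: Diff_eq Int_ac)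
  have fS: "facets S - {F} = (\<lambda>w. convex hull (V - {w})) ` (V - {v})"
    using inj_facets[OF V(1)] v V facets_hull[OF V(1)] by (auto simp: inj_on_def)
  show "inj_on ((\<inter>) F) (facets S - {F})"
    unfolding fS using inj_facets[OF V'] by (auto simp: inj_on_def i)
  show "(\<inter>) F ` (facets S - {F}) \<subseteq> facets F"
    unfolding fS image_image i using facets_hull[OF V'] v(2) by simp
qed

lemma proper_face_in_facet:
  assumes "n simplex (S :: 'a::euclidean_space set)" "G face_of S" "G \<noteq> S"
  obtains F where "F \<in> facets S" "G \<subseteq> F"
proof -
  obtain V where V: "\<not> affine_dependent V" "S = convex hull V" "int (card V) = n + 1"
    using assms simplex_vertices by blast
  then obtain A where A: "A \<subseteq> V" "G = convex hull A" using assms face_of_hull_iff by blast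
  then have "A \<noteq> V" using assms(3) V(2) by blast
  then obtain v where "v \<in> V" "A \<subseteq> V - {v}" using A by blast
  then show thesis using that[of "convex hull (V - {v})"] A facets_hull[OF V(1)] V hull_mono by blast
qed

text \<open>Unlike the facet itself, a proper face of a facet misses a second vertex.\<close>

lemma proper_face_of_facet:
  assumes "n simplex (S :: 'a::euclidean_space set)" "F \<in> facets S" "G face_of S" "G \<subseteq> F" "G \<noteq> F"
  obtains F' where "F' \<in> facets S" "F' \<noteq> F" "G \<subseteq> F'"
proof -
  obtain V where V: "\<not> affine_dependent V" "S = convex hull V" "int (card V) = n + 1"
    using assms simplex_vertices by blast
  then obtain v where v: "v \<in> V" "F = convex hull (V - {v})" using assms facets_hull by blast
  obtain A where A: "A \<subseteq> V" "G = convex hull A" using assms V face_of_hull_iff by blast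
  then have "A \<subseteq> V - {v}" using assms v hull_subset_iff[OF V(1), of A "V - {v}"] by blast
  moreover have "A \<noteq> V - {v}" using assms(5) A(2) v(2) by blast
  ultimately obtain w where w: "w \<in> V" "w \<noteq> v" "A \<subseteq> V - {w}" using A by blast
  then have "convex hull (V - {w}) \<noteq> F" using v hull_eq_iff[OF V(1), of "V - {w}" "V - {v}"] by blast
  then show thesis using that[of "convex hull (V - {w})"] w A facets_hull[OF V(1)] V hull_mono by blast
qed

text \<open>This reduces statements about open faces inside a difference of faces to the inclusion order of
  faces.\<close>

lemma rel_interior_meets_face_iff:
  fixes S :: "'a::euclidean_space set"
  assumes "G face_of S" "F face_of S" "G \<noteq> {}" "convex S"
  shows "rel_interior G \<inter> F \<noteq> {} \<longleftrightarrow> G \<subseteq> F"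
proof
  assume "rel_interior G \<inter> F \<noteq> {}"
  then show "G \<subseteq> F"
    using subset_of_face_of[OF assms(2), of G] assms(1) face_of_imp_subset by blast
next
  assume "G \<subseteq> F"
  moreover have "rel_interior G \<noteq> {}"
    using assms face_of_imp_convex rel_interior_eq_empty by blast
  ultimately show "rel_interior G \<inter> F \<noteq> {}" using rel_interior_subset by blast
qed

text \<open>The open faces contained in \<open>S - \<Union>R\<close>, described by the inclusion order alone.\<close>

definition open_faces :: "'a::euclidean_space set \<Rightarrow> 'a set set \<Rightarrow> 'a set set" where
  "open_faces S R = {G. G face_of S \<and> G \<noteq> {} \<and> (\<forall>F\<in>R. \<not> G \<subseteq> F)}"

lemma open_simplices_in_faces:
  fixes S :: "'a::euclidean_space set"
  assumes "convex S" "\<And>F. F \<in> R \<Longrightarrow> F face_of S"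
  shows "open_simplices_in (faces S) (S - \<Union>R) = open_faces S R"
proof -
  have "rel_interior G \<subseteq> S - \<Union>R \<longleftrightarrow> (\<forall>F\<in>R. \<not> G \<subseteq> F)" if G: "G face_of S" "G \<noteq> {}" for G
  proof -
    have "rel_interior G \<subseteq> S" using G face_of_imp_subset rel_interior_subset by blast
    then have "rel_interior G \<subseteq> S - \<Union>R \<longleftrightarrow> (\<forall>F\<in>R. rel_interior G \<inter> F = {})" by blast
    also have "\<dots> \<longleftrightarrow> (\<forall>F\<in>R. \<not> G \<subseteq> F)"
      using rel_interior_meets_face_iff[OF G(1) _ G(2) assms(1)] assms(2) by blast
    finally show ?thesis .
  qed
  then show ?thesis by (auto simp: open_simplices_in_def faces_def open_faces_def)
qed

text \<open>The set \<open>C\<close> is the part of \<open>Q\<close> that is left unmatched. It is an argument of its own, because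
  induction on the dimension computes it piece by piece.\<close>

definition face_matching :: "('a::euclidean_space set \<rightharpoonup> 'a set) \<Rightarrow> 'a set set \<Rightarrow> 'a set set \<Rightarrow> bool" where
  "face_matching W Q C \<longleftrightarrow>
     dom W \<union> ran W \<union> C = Q \<and> dom W \<inter> ran W = {} \<and> (dom W \<union> ran W) \<inter> C = {} \<and> inj_on W (dom W) \<and>
     (\<forall>\<sigma> \<tau>. W \<sigma> = Some \<tau> \<longrightarrow> \<sigma> face_of \<tau> \<and> aff_dim \<tau> = aff_dim \<sigma> + 1)"

text \<open>Each piece is matched within itself, so that no pair joins different pieces, and injectivity need
  only be checked inside a piece.\<close>

lemma face_matching_Union:
  assumes disj: "\<And>i j. \<lbrakk>i \<in> I; j \<in> I; i \<noteq> j\<rbrakk> \<Longrightarrow> P i \<inter> P j = {}"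
    and m: "\<And>i. i \<in> I \<Longrightarrow> face_matching (W |` P i) (P i) (C i)"
    and dom: "dom W \<subseteq> (\<Union>i\<in>I. P i)"
  shows "face_matching W (\<Union>i\<in>I. P i) (\<Union>i\<in>I. C i)"
proof -
  have D: "i \<in> I \<Longrightarrow> dom (W |` P i) = dom W \<inter> P i" for i by (auto simp: dom_def restrict_map_def)
  have P: "\<And>i. i \<in> I \<Longrightarrow> dom (W |` P i) \<union> ran (W |` P i) \<union> C i = P i"
    and A: "\<And>i. i \<in> I \<Longrightarrow> dom (W |` P i) \<inter> ran (W |` P i) = {}"
    and B: "\<And>i. i \<in> I \<Longrightarrow> (dom (W |` P i) \<union> ran (W |` P i)) \<inter> C i = {}"
    and E: "\<And>i. i \<in> I \<Longrightarrow> inj_on (W |` P i) (dom (W |` P i))"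
    and F: "\<And>i \<sigma> \<tau>. \<lbrakk>i \<in> I; (W |` P i) \<sigma> = Some \<tau>\<rbrakk> \<Longrightarrow> \<sigma> face_of \<tau> \<and> aff_dim \<tau> = aff_dim \<sigma> + 1"
    using m unfolding face_matching_def by auto
  have W: "(W |` P i) \<sigma> = W \<sigma>" if "\<sigma> \<in> P i" for i \<sigma> using that by simp
  have step: "\<tau> \<in> P i \<and> \<tau> \<in> ran (W |` P i)" if "i \<in> I" "\<sigma> \<in> P i" "W \<sigma> = Some \<tau>" for i \<sigma> \<tau>
  proof -
    have "(W |` P i) \<sigma> = Some \<tau>" using that by simp
    then have "\<tau> \<in> ran (W |` P i)" by (rule ranI)
    then show ?thesis using P[OF that(1)] by blast
  qed
  have uniq: "i = j" if "i \<in> I" "j \<in> I" "x \<in> P i" "x \<in> P j" for i j x using disj that by blast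
  have dW: "dom W = (\<Union>i\<in>I. dom (W |` P i))" using dom D by blast
  have rW: "ran W = (\<Union>i\<in>I. ran (W |` P i))"
  proof (intro Set.set_eqI iffI)
    fix \<tau> assume "\<tau> \<in> ran W"
    then obtain \<sigma> where s: "W \<sigma> = Some \<tau>" by (auto simp: ran_def)
    then obtain i where "i \<in> I" "\<sigma> \<in> P i" using dom by (auto simp: dom_def)
    then show "\<tau> \<in> (\<Union>i\<in>I. ran (W |` P i))" using step s by blast
  next
    fix \<tau> assume "\<tau> \<in> (\<Union>i\<in>I. ran (W |` P i))"
    then show "\<tau> \<in> ran W" by (auto simp: ran_def restrict_map_def split: if_splits)
  qed
  have CP: "i \<in> I \<Longrightarrow> C i \<subseteq> P i" "i \<in> I \<Longrightarrow> dom (W |` P i) \<subseteq> P i" "i \<in> I \<Longrightarrow> ran (W |` P i) \<subseteq> P i" for i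
    using P by blast+
  have cross: "X i \<inter> Y j = {}" if "i \<in> I" "j \<in> I" "X i \<subseteq> P i" "Y j \<subseteq> P j" "X i \<inter> Y i = {}" for X Y i j
  proof (cases "i = j")
    case False
    then have "P i \<inter> P j = {}" using disj that by blast
    then show ?thesis using that(3,4) by blast
  qed (use that in simp)
  show ?thesis
    unfolding face_matching_def
  proof (intro conjI allI impI)
    have "dom W \<union> ran W \<union> (\<Union>i\<in>I. C i) = (\<Union>i\<in>I. dom (W |` P i) \<union> ran (W |` P i) \<union> C i)"
      unfolding dW rW by (simp only: UN_Un_distrib)
    also have "\<dots> = (\<Union>i\<in>I. P i)" by (rule SUP_cong) (use P in auto)
    finally show "dom W \<union> ran W \<union> (\<Union>i\<in>I. C i) = (\<Union>i\<in>I. P i)" .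
    have "dom (W |` P i) \<inter> ran (W |` P j) = {}" if "i \<in> I" "j \<in> I" for i j
      by (rule cross[of i j "\<lambda>i. dom (W |` P i)" "\<lambda>j. ran (W |` P j)"]) (use that CP A in auto)
    then show "dom W \<inter> ran W = {}" unfolding dW rW by blast
    have "(dom (W |` P i) \<union> ran (W |` P i)) \<inter> C j = {}" if "i \<in> I" "j \<in> I" for i j
      by (rule cross[of i j "\<lambda>i. dom (W |` P i) \<union> ran (W |` P i)" C]) (use that CP[of i] CP(1)[of j] B[of i] in auto)
    then show "(dom W \<union> ran W) \<inter> (\<Union>i\<in>I. C i) = {}" unfolding dW rW by blast
    show "inj_on W (dom W)"
    proof (rule inj_onI)
      fix x y assume xy: "x \<in> dom W" "y \<in> dom W" "W x = W y"
      then obtain i j where ij: "i \<in> I" "x \<in> P i" "j \<in> I" "y \<in> P j" using dom by blast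
      obtain t where "W x = Some t" "W y = Some t" using xy by auto
      then have "i = j" using step[of i x t] step[of j y t] ij uniq by blast
      then show "x = y" using E[OF ij(1)] xy ij W by (auto simp: inj_on_def D)
    qed
    fix \<sigma> \<tau> assume s: "W \<sigma> = Some \<tau>"
    then obtain i where "i \<in> I" "\<sigma> \<in> P i" using dom by (auto simp: dom_def)
    then show "\<sigma> face_of \<tau>" "aff_dim \<tau> = aff_dim \<sigma> + 1" using F[of i \<sigma> \<tau>] s by auto
  qed
qed

lemma open_faces_all_facets:
  fixes S :: "'a::euclidean_space set"
  assumes "int n simplex S"
  shows "open_faces S (facets S) = {S}"
proof -
  have "S \<noteq> {}" using assms aff_dim_simplex[OF assms] by auto
  moreover have "\<not> S \<subseteq> F" if "F \<in> facets S" for F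
    using facet_simplex[OF assms that] aff_dim_simplex[OF assms] aff_dim_simplex[of "int n - 1" F] aff_dim_subset[of S F]
    by auto
  moreover have "S face_of S" using assms convex_simplex face_of_refl by blast
  moreover have "G = S" if "G \<in> open_faces S (facets S)" for G
    using that proper_face_in_facet[OF assms, of G] unfolding open_faces_def by blast
  ultimately show ?thesis by (auto simp: open_faces_def)
qed

text \<open>The pieces of the recursive partition of a basic tile. The last facet contributes only its open
  simplex; it is merged with the open top simplex, which is its partner.\<close>

definition facet_piece :: "'a::euclidean_space set \<Rightarrow> 'a set set \<Rightarrow> 'a set list \<Rightarrow> nat \<Rightarrow> 'a set set" where
  "facet_piece S R xs i =
     (if i = length xs - 1 then {last xs, S}
      else open_faces (xs ! i) ((\<inter>) (xs ! i) ` (R \<union> set (take i xs))))"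

lemma in_set_take_iff: "x \<in> set (take i xs) \<longleftrightarrow> (\<exists>j<i. j < length xs \<and> x = xs ! j)"
  by (auto simp: in_set_conv_nth)

lemma open_faces_facet:
  assumes "F face_of S" 
  shows "open_faces F ((\<inter>) F ` E) = {G. G face_of S \<and> G \<subseteq> F \<and> G \<noteq> {} \<and> (\<forall>F'\<in>E. \<not> G \<subseteq> F')}"
  using face_of_face[OF assms] by (auto simp: open_faces_def)

text \<open>A proper face lies in the piece of the first facet of the list that contains it. If this is the last
  facet, then the face is that facet itself, since any smaller face lies in a second facet.\<close>

lemma facet_pieces:
  fixes S :: "'a::euclidean_space set"
  assumes S: "int (Suc m) simplex S" and R: "R \<subseteq> facets S" "R \<noteq> facets S"
    and xs: "distinct xs" "set xs = facets S - R"
  shows "open_faces S R = (\<Union>i<length xs. facet_piece S R xs i)"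
    and "\<lbrakk>i < length xs; j < length xs; i \<noteq> j\<rbrakk> \<Longrightarrow> facet_piece S R xs i \<inter> facet_piece S R xs j = {}"
proof -
  have ne: "xs \<noteq> []" using R xs by auto
  define l where "l = length xs - 1"
  have l: "l < length xs" "last xs = xs ! l" using ne by (auto simp: l_def last_conv_nth)
  have fac: "xs ! i \<in> facets S" "xs ! i face_of S" if "i < length xs" for i
    using that xs nth_mem[OF that] by (auto simp: facets_def)
  have piece: "facet_piece S R xs i = {G. G face_of S \<and> G \<subseteq> xs ! i \<and> G \<noteq> {} \<and> (\<forall>F\<in>R \<union> set (take i xs). \<not> G \<subseteq> F)}"
    if "i < length xs" "i \<noteq> l" for i
    using that open_faces_facet[OF fac(2)[OF that(1)]] by (simp add: facet_piece_def l_def)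
  have lpiece: "facet_piece S R xs l = {xs ! l, S}" unfolding facet_piece_def l_def[symmetric] l(2) by simp
  have nsub: "\<not> xs ! i \<subseteq> F" if "i < length xs" "F \<in> facets S" "xs ! i \<noteq> F" for i F
    using facet_subset_eq[OF S fac(1)] that by blast
  have Snot: "\<not> S \<subseteq> F" if "F \<in> facets S" for F
    using facet_simplex[OF S that] aff_dim_simplex[OF S] aff_dim_simplex[of "int (Suc m) - 1" F] aff_dim_subset[of S F]
    by auto
  have SS: "S face_of S" "S \<noteq> {}" using S convex_simplex face_of_refl aff_dim_simplex[OF S] by auto
  have lne: "xs ! l \<noteq> {}" using facet_simplex(1)[OF S fac(1)[OF l(1)]] by auto
  show "open_faces S R = (\<Union>i<length xs. facet_piece S R xs i)"
  proof (intro Set.set_eqI iffI)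
    fix G assume G: "G \<in> open_faces S R"
    then have G': "G face_of S" "G \<noteq> {}" "\<And>F. F \<in> R \<Longrightarrow> \<not> G \<subseteq> F" by (auto simp: open_faces_def)
    show "G \<in> (\<Union>i<length xs. facet_piece S R xs i)"
    proof (cases "G = S")
      case True
      then show ?thesis using l lpiece by auto
    next
      case False
      then obtain F where F: "F \<in> facets S" "G \<subseteq> F" using proper_face_in_facet[OF S G'(1)] by blast
      then have "F \<in> set xs" using G' xs by blast
      then obtain i where "i < length xs" "G \<subseteq> xs ! i" using F by (metis in_set_conv_nth)
      then have ex: "\<exists>i. i < length xs \<and> G \<subseteq> xs ! i" by blast
      define i where "i = (LEAST i. i < length xs \<and> G \<subseteq> xs ! i)"
      have i: "i < length xs" "G \<subseteq> xs ! i" using LeastI_ex[OF ex] by (auto simp: i_def)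
      have least: "\<not> G \<subseteq> xs ! j" if "j < i" for j
        using not_less_Least[of j "\<lambda>i. i < length xs \<and> G \<subseteq> xs ! i"] that i by (auto simp: i_def)
      have pi: "\<forall>F\<in>R \<union> set (take i xs). \<not> G \<subseteq> F" using least G' by (auto simp: in_set_take_iff)
      show ?thesis
      proof (cases "i = l")
        case False
        then have "G \<in> facet_piece S R xs i" using piece[OF i(1)] G' i pi by auto
        then show ?thesis using i by auto
      next
        case True
        have "G = xs ! l"
        proof (rule ccontr)
          assume "G \<noteq> xs ! l"
          then obtain F' where F': "F' \<in> facets S" "F' \<noteq> xs ! l" "G \<subseteq> F'"
            using proper_face_of_facet[OF S fac(1)[OF i(1)] G'(1) i(2)] True by metis
          then have "F' \<in> set xs" using G' xs by blast
          then obtain j where "j < length xs" "F' = xs ! j" by (metis in_set_conv_nth)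
          moreover have "j < l" using calculation F' l by (cases "j = l") (auto simp: l_def)
          ultimately show False using least True F' by blast
        qed
        then show ?thesis using l lpiece by auto
      qed
    qed
  next
    fix G assume "G \<in> (\<Union>i<length xs. facet_piece S R xs i)"
    then obtain i where i: "i < length xs" "G \<in> facet_piece S R xs i" by blast
    show "G \<in> open_faces S R"
    proof (cases "i = l")
      case True
      then have "G = xs ! l \<or> G = S" using i lpiece by auto
      moreover have "xs ! l \<notin> R" using xs l nth_mem by blast
      ultimately show ?thesis
        using SS lne fac[OF l(1)] nsub[OF l(1)] Snot R by (auto simp: open_faces_def)
    qed (use i piece in \<open>auto simp: open_faces_def\<close>)
  qed
  have disj: "facet_piece S R xs i \<inter> facet_piece S R xs j = {}" if ij: "i < j" "j < length xs" for i j
  proof -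
    have i: "i < length xs" "i \<noteq> l" using ij by (auto simp: l_def)
    show ?thesis
    proof (cases "j = l")
      case True
      have "xs ! l \<noteq> xs ! i" using xs(1) i l by (simp add: nth_eq_iff_index_eq)
      then have "\<not> xs ! l \<subseteq> xs ! i" "\<not> S \<subseteq> xs ! i" using nsub[OF l(1) fac(1)[OF i(1)]] Snot[OF fac(1)[OF i(1)]] by auto
      then show ?thesis using True lpiece piece[OF i] by auto
    next
      case False
      have "xs ! i \<in> set (take j xs)" using ij by (auto simp: in_set_take_iff)
      then show ?thesis unfolding piece[OF i] piece[OF ij(2) False] by blast
    qed
  qed
  show "\<lbrakk>i < length xs; j < length xs; i \<noteq> j\<rbrakk> \<Longrightarrow> facet_piece S R xs i \<inter> facet_piece S R xs j = {}"
    using disj[of i j] disj[of j i] by (cases "i < j") (auto simp: Int_commute)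
qed

text \<open>From the facet with index \<open>i\<close> in the list, \<open>card R + i\<close> facets are removed, which is fewer than
  all of them unless it is the last one. So no piece but the last has lost all its facets, and a piece is a closed simplex only
  if \<open>R\<close> is empty and \<open>i = 0\<close>. By induction this first facet of a closed simplex contributes the only unmatched face.
  A point has the empty set as its only facet, and is unmatched whether or not that facet is removed.\<close>

lemma basic_field_matching:
  fixes S :: "'a::euclidean_space set"
  assumes "basic_field n S R W" "int n simplex S" "R \<subseteq> facets S"
  shows "\<exists>C. face_matching W (open_faces S R) C \<and> (R = {} \<longrightarrow> (\<exists>v. C = {{v}})) \<and>
    (R = facets S \<longrightarrow> C = {S}) \<and> (R \<noteq> {} \<and> R \<noteq> facets S \<longrightarrow> C = {})"
  using assms
proof (induction n arbitrary: S R W)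
  case 0
  have "0 simplex S" using 0 by simp
  then obtain v where v: "S = {v}" unfolding simplex_zero by blast
  have fac: "F \<in> facets S \<longleftrightarrow> F = {}" for F
  proof -
    have "aff_dim F = - 1 \<longleftrightarrow> F = {}"
      by (metis aff_dim_empty aff_dim_negative_iff neg_less_0_iff_less zero_less_one)
    then show ?thesis using v by (auto simp: facets_def)
  qed
  then have fS: "facets S = {{}}" by auto
  then have R0: "R = {} \<or> R = {{}}" using 0(3) by (simp add: subset_singleton_iff)
  have "G face_of S \<and> G \<noteq> {} \<longleftrightarrow> G = S" for G
    unfolding v using face_of_imp_subset[of G "{v}"] face_of_refl[OF convex_singleton[of v]]
    by (metis insert_not_empty subset_singletonD)
  moreover have "\<forall>F\<in>R. \<not> S \<subseteq> F" using R0 v by auto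
  ultimately have "open_faces S R = {S}" unfolding open_faces_def by blast
  moreover have "R = facets S" if "R \<noteq> {}"
    using that R0 fS by simp
  ultimately show ?case using 0 v by (intro exI[of _ "{S}"]) (auto simp: face_matching_def)
next
  case (Suc m)
  note S = Suc.prems(2) and R = Suc.prems(3)
  have facne: "facets S \<noteq> {}" using facets_simplex[OF S] by auto
  show ?case
  proof (cases "R = facets S")
    case True
    then show ?thesis using Suc.prems facne open_faces_all_facets[OF S]
      by (intro exI[of _ "{S}"]) (auto simp: face_matching_def)
  next
    case False
    then obtain xs where xs: "distinct xs" "set xs = facets S - R"
        "dom W \<subseteq> open_simplices_in (faces S) (S - \<Union>R)" "W (last xs) = Some S" "W S = None"
        "\<forall>i < length xs - 1.
           let E = R \<union> set (take i xs); F = xs ! i in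
           basic_field m F ((\<lambda>G. F \<inter> G) ` E) (W |` open_simplices_in (faces F) (F - \<Union>E))"
      using Suc.prems(1) by auto
    have ne: "xs \<noteq> []" using False R xs by auto
    have fR: "finite R" using R facets_simplex[OF S] finite_subset by blast
    have len: "card R + length xs = Suc (Suc m)"
      using facets_simplex[OF S] R xs(1,2) distinct_card[OF xs(1)] fR
        card_Diff_subset[OF fR R] card_mono[OF _ R] by auto
    have cvx: "convex S" using S convex_simplex by blast
    have "open_simplices_in (faces S) (S - \<Union>R) = open_faces S R"
      by (rule open_simplices_in_faces) (use R cvx in \<open>auto simp: facets_def\<close>)
    then have dom: "dom W \<subseteq> (\<Union>i<length xs. facet_piece S R xs i)"
      using xs(3) facet_pieces(1)[OF S R False xs(1,2)] by simp
    have last: "last xs \<in> facets S" using ne xs(2) last_in_set by blast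
    have ex: "\<exists>C. face_matching (W |` facet_piece S R xs i) (facet_piece S R xs i) C \<and>
        (if i = 0 \<and> R = {} then \<exists>v. C = {{v}} else C = {})" if i: "i < length xs" for i
    proof (cases "i = length xs - 1")
      case True
      have neq: "last xs \<noteq> S" using xs(4,5) by auto
      have "W |` {last xs, S} = [last xs \<mapsto> S]"
        using xs(4,5) by (auto simp: restrict_map_def)
      moreover have "last xs face_of S" "aff_dim S = aff_dim (last xs) + 1"
        using last by (auto simp: facets_def)
      moreover have "\<not> (i = 0 \<and> R = {})" using len True by auto
      ultimately show ?thesis using True neq
        by (intro exI[of _ "{}"]) (auto simp: face_matching_def facet_piece_def)
    next
      case False
      define F where "F = xs ! i"
      define E where "E = R \<union> set (take i xs)"
      have F: "F \<in> facets S" "F \<notin> R" using i xs(2) nth_mem[OF i] by (auto simp: F_def)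
      have Fs: "int m simplex F" "F face_of S" using facet_simplex[OF S F(1)] by auto
      have FE: "F \<notin> E" using F i xs(1) by (auto simp: E_def F_def in_set_take_iff nth_eq_iff_index_eq)
      have Esub: "E \<subseteq> facets S - {F}" using FE R xs(2) by (auto simp: E_def dest: in_set_takeD)
      have inj: "inj_on ((\<inter>) F) E"
        by (rule inj_on_subset[OF facet_Int_facet(1)[OF S F(1)] Esub])
      have im: "(\<inter>) F ` E \<subseteq> facets F"
        by (rule subset_trans[OF image_mono[OF Esub] facet_Int_facet(2)[OF S F(1)]])
      have "R \<inter> set (take i xs) = {}" using xs(2) by (auto dest: in_set_takeD)
      then have "card E = card R + i"
        unfolding E_def using fR i distinct_card[OF distinct_take[OF xs(1), of i]]
        by (simp add: card_Un_disjoint)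
      then have cE: "card ((\<inter>) F ` E) = card R + i" using inj by (simp add: card_image)
      have eq: "open_simplices_in (faces F) (F - \<Union>E) = open_faces F ((\<inter>) F ` E)"
      proof -
        have "F - \<Union>E = F - \<Union>((\<inter>) F ` E)" by blast
        moreover have "open_simplices_in (faces F) (F - \<Union>((\<inter>) F ` E)) = open_faces F ((\<inter>) F ` E)"
        proof (rule open_simplices_in_faces[OF convex_simplex[OF Fs(1)]])
          show "G face_of F" if "G \<in> (\<inter>) F ` E" for G
            using subsetD[OF im that] by (simp add: facets_def)
        qed
        ultimately show ?thesis by (simp only:)
      qed
      have pc: "facet_piece S R xs i = open_faces F ((\<inter>) F ` E)"
        using False by (simp add: facet_piece_def F_def E_def)
      have il: "i < length xs - 1" using i False by simp
      have "basic_field m F ((\<inter>) F ` E) (W |` open_faces F ((\<inter>) F ` E))"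
        using xs(6)[rule_format, OF il] unfolding Let_def F_def[symmetric] E_def[symmetric] eq .
      note IH = Suc.IH[OF this Fs(1) im]
      have nf: "(\<inter>) F ` E \<noteq> facets F"
      proof
        assume "(\<inter>) F ` E = facets F"
        then have "card R + i = m + 1" using cE facets_simplex(1)[OF Fs(1)] by (simp only:)
        then show False using len il by linarith
      qed
      have e0: "(\<inter>) F ` E = {} \<longleftrightarrow> i = 0 \<and> R = {}"
        using i by (auto simp: E_def)
      obtain C where C: "face_matching (W |` open_faces F ((\<inter>) F ` E)) (open_faces F ((\<inter>) F ` E)) C"
        "(\<inter>) F ` E = {} \<longrightarrow> (\<exists>v. C = {{v}})"
        "(\<inter>) F ` E \<noteq> {} \<and> (\<inter>) F ` E \<noteq> facets F \<longrightarrow> C = {}"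
        using IH by (elim exE conjE) (rule that)
      have "if i = 0 \<and> R = {} then \<exists>v. C = {{v}} else C = {}"
        using C(2,3) nf e0 by (cases "i = 0 \<and> R = {}") simp_all
      with C(1) show ?thesis unfolding pc by (intro exI conjI)
    qed
    then obtain C where C: "\<And>i. i < length xs \<Longrightarrow> face_matching (W |` facet_piece S R xs i) (facet_piece S R xs i) (C i)"
        "\<And>i. i < length xs \<Longrightarrow> if i = 0 \<and> R = {} then \<exists>v. C i = {{v}} else C i = {}"
      by metis
    have "face_matching W (\<Union>i<length xs. facet_piece S R xs i) (\<Union>i<length xs. C i)"
      by (rule face_matching_Union) (use C(1) dom facet_pieces(2)[OF S R False xs(1,2)] in auto)
    then have "face_matching W (open_faces S R) (\<Union>i<length xs. C i)"
      using facet_pieces(1)[OF S R False xs(1,2)] by simp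
    moreover have "\<exists>v. (\<Union>i<length xs. C i) = {{v}}" if "R = {}"
    proof -
      have l0: "0 < length xs" using ne by simp
      then have "\<exists>v. C 0 = {{v}}" using C(2)[OF l0] that by simp
      then obtain v where v: "C 0 = {{v}}" by blast
      have "C i = {}" if "i < length xs" "i \<noteq> 0" for i using C(2)[of i] that by simp
      then have "(\<Union>i<length xs. C i) = C 0" using l0 by (auto split: if_splits)
      then show ?thesis using v by blast
    qed
    moreover have "(\<Union>i<length xs. C i) = {}" if "R \<noteq> {}"
      using C(2) that by auto
    ultimately show ?thesis using False
      by (intro exI[of _ "\<Union>i<length xs. C i"] conjI impI) (simp_all only: simp_thms)
  qed
qed

section \<open>Unmatched faces of a tile\<close>

lemma simplex_face:
  assumes "n simplex (S :: 'a::euclidean_space set)" "G face_of S"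
  shows "aff_dim G simplex G"
proof -
  obtain V where V: "\<not> affine_dependent V" "S = convex hull V" "int (card V) = n + 1"
    using assms simplex_vertices by blast
  then obtain A where "A \<subseteq> V" "G = convex hull A" using assms face_of_hull_iff by blast
  then show ?thesis using hull_simplex[OF V(1)] aff_dim_hull[OF V(1)] by simp
qed

text \<open>The number is \<open>2 ^ (l + 1) - 1\<close>. That it is odd prevents the faces of a closed simplex from being
  matched completely.\<close>

lemma card_nonempty_faces:
  assumes "int l simplex (S :: 'a::euclidean_space set)"
  shows "odd (card {G. G face_of S \<and> G \<noteq> {}})"
proof -
  obtain V where V: "\<not> affine_dependent V" "S = convex hull V" "int (card V) = int l + 1"
    using assms simplex_vertices by blast
  have "{G. G face_of S} = (\<lambda>A. convex hull A) ` Pow V"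
    using V face_of_hull_iff by blast
  moreover have "inj_on (\<lambda>A. convex hull A) (Pow V)"
    by (rule inj_onI) (use hull_eq_iff[OF V(1)] in auto)
  ultimately have c: "card {G. G face_of S} = 2 ^ card V" "finite {G. G face_of S}"
    using finite_vertices[OF V(1)] by (simp_all add: card_image card_Pow)
  have e: "{G. G face_of S \<and> G \<noteq> {}} = {G. G face_of S} - {{}}" by auto
  have "{} \<in> {G. G face_of S}" using assms convex_simplex by (simp add: empty_face_of)
  then have "card {G. G face_of S \<and> G \<noteq> {}} = 2 ^ card V - 1"
    unfolding e using c by (simp add: card_Diff_singleton)
  moreover have "card V \<ge> 1" using V by linarith
  ultimately show ?thesis by simp
qed

lemma face_matching_even:
  assumes m: "face_matching W Q C" and P: "P \<subseteq> Q" "P \<inter> C = {}" "finite P"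
    and pres: "preserves W P" and down: "\<And>\<sigma> \<tau>. \<lbrakk>\<tau> \<in> P; W \<sigma> = Some \<tau>\<rbrakk> \<Longrightarrow> \<sigma> \<in> P"
  shows "even (card P)"
proof -
  have Q: "dom W \<union> ran W \<union> C = Q" "dom W \<inter> ran W = {}" "inj_on W (dom W)"
    using m unfolding face_matching_def by auto
  have "bij_betw (\<lambda>\<sigma>. the (W \<sigma>)) (P \<inter> dom W) (P \<inter> ran W)"
    unfolding bij_betw_def
  proof
    show "inj_on (\<lambda>\<sigma>. the (W \<sigma>)) (P \<inter> dom W)"
    proof (rule inj_onI)
      fix x y assume xy: "x \<in> P \<inter> dom W" "y \<in> P \<inter> dom W" "the (W x) = the (W y)"
      then have "W x = W y" by auto
      then show "x = y" using Q(3) xy by (auto dest: inj_onD)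
    qed
    show "(\<lambda>\<sigma>. the (W \<sigma>)) ` (P \<inter> dom W) = P \<inter> ran W"
    proof (intro Set.set_eqI iffI)
      fix \<tau> assume "\<tau> \<in> (\<lambda>\<sigma>. the (W \<sigma>)) ` (P \<inter> dom W)"
      then obtain \<sigma> where "\<sigma> \<in> P" "W \<sigma> = Some \<tau>" by auto
      then show "\<tau> \<in> P \<inter> ran W" using pres by (auto simp: preserves_def intro: ranI)
    next
      fix \<tau> assume \<tau>: "\<tau> \<in> P \<inter> ran W"
      then obtain \<sigma> where \<sigma>: "W \<sigma> = Some \<tau>" by (auto simp: ran_def)
      then have "\<sigma> \<in> P \<inter> dom W" using down \<tau> by auto
      then show "\<tau> \<in> (\<lambda>\<sigma>. the (W \<sigma>)) ` (P \<inter> dom W)" using \<sigma> by (metis image_eqI option.sel)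
    qed
  qed
  then have "card (P \<inter> dom W) = card (P \<inter> ran W)" by (rule bij_betw_same_card)
  moreover have "P = (P \<inter> dom W) \<union> (P \<inter> ran W)" using Q P by blast
  moreover have "card ((P \<inter> dom W) \<union> (P \<inter> ran W)) = card (P \<inter> dom W) + card (P \<inter> ran W)"
    by (rule card_Un_disjoint) (use P Q in auto)
  ultimately show ?thesis by (metis dvd_triv_left mult_2)
qed

definition unmatched :: "('a::euclidean_space set \<rightharpoonup> 'a set) \<Rightarrow> 'a set set \<Rightarrow> 'a set set" where
  "unmatched W Q = {\<sigma> \<in> Q. W \<sigma> = None \<and> \<sigma> \<notin> ran W}"

lemma unmatched_face_matching:
  assumes "face_matching W Q C"
  shows "unmatched W Q = C"
  using assms unfolding face_matching_def unmatched_def by blast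

lemma unmatched_restrict_matching:
  assumes "face_matching W Q C"
  shows "W |` Q = W"
proof
  fix x
  have "dom W \<subseteq> Q" using assms unfolding face_matching_def by blast
  then show "(W |` Q) x = W x" by (cases "W x") (auto simp: restrict_map_def)
qed

lemma facet_not_subset_Union:
  assumes S: "int n simplex (S :: 'a::euclidean_space set)" "R \<subseteq> facets S" "F \<in> facets S" "F \<notin> R" "F \<noteq> {}"
  shows "\<not> F \<subseteq> \<Union>R"
proof
  assume "F \<subseteq> \<Union>R"
  moreover have "rel_interior F \<noteq> {}" "rel_interior F \<subseteq> F"
    using facet_simplex[OF S(1,3)] S(5) convex_simplex rel_interior_eq_empty rel_interior_subset by blast+
  ultimately obtain G where "G \<in> R" "rel_interior F \<inter> G \<noteq> {}" by blast
  then have "F \<subseteq> G"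
    using rel_interior_meets_face_iff[of F S G] facet_simplex[OF S(1)] S convex_simplex by blast
  then show False using facet_subset_eq[OF S(1,3)] S \<open>G \<in> R\<close> by blast
qed

text \<open>A basic tile of positive dimension and positive order is also obtained by removing one of its facets as the face
  \<open>\<tau>\<close>, so that basic tiles fall under the same description as the other tiles.\<close>

lemma tile_data_last_facet:
  assumes S: "int n simplex (S :: 'a::euclidean_space set)" "R \<subseteq> facets S" "F \<in> R" "1 \<le> n"
  shows "tile_data n (int n - 1) (card R - 1) S (R - {F}) F" "\<Union>(R - {F}) \<union> F = \<Union>R"
proof -
  have F: "F \<in> facets S" using S by blast
  have fin: "finite R" using S facets_simplex finite_subset by blast
  have "card R \<le> n + 1" using card_mono[OF facets_simplex(2)[OF S(1)] S(2)] facets_simplex(1)[OF S(1)] by simp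
  moreover have "card R \<ge> 1" using S(3) fin by (simp add: card_gt_0_iff Suc_le_eq) blast
  moreover have "F \<noteq> {}" using facet_simplex(1)[OF S(1) F] S(4) by auto
  then have "\<not> F \<subseteq> \<Union>(R - {F})" using facet_not_subset_Union[OF S(1) _ F, of "R - {F}"] S(2) by blast
  ultimately show "tile_data n (int n - 1) (card R - 1) S (R - {F}) F"
    unfolding tile_data_def using S facet_simplex[OF S(1) F] fin by (auto simp: card_Diff_singleton)
  show "\<Union>(R - {F}) \<union> F = \<Union>R" using S(3) by blast
qed

lemma tile_data_closed_simplex:
  "int n simplex (S :: 'a::euclidean_space set) \<Longrightarrow> tile_data n (-1) 0 S {} {}"
  unfolding tile_data_def using convex_simplex by (auto simp: empty_face_of)

lemma tile_data_faces:
  assumes "tile_data n l k S R \<tau>"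
  shows "open_simplices_in (faces S) (S - (\<Union>R \<union> \<tau>)) = {G \<in> open_faces S R. \<not> G \<subseteq> \<tau>}"
proof -
  have "S - (\<Union>R \<union> \<tau>) = S - \<Union>(insert \<tau> R)" by blast
  moreover have "open_simplices_in (faces S) (S - \<Union>(insert \<tau> R)) = open_faces S (insert \<tau> R)"
    by (rule open_simplices_in_faces)
      (use assms convex_simplex in \<open>auto simp: tile_data_def facets_def\<close>)
  moreover have "open_faces S (insert \<tau> R) = {G \<in> open_faces S R. \<not> G \<subseteq> \<tau>}"
    by (auto simp: open_faces_def)
  ultimately show ?thesis by simp
qed

text \<open>A face that lies in no member of \<open>R\<close> contains all vertices opposite to the facets in \<open>R\<close>. By its
  dimension \<open>\<tau>\<close> has no other vertices, so it is the least such face.\<close>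

lemma unique_corner_face:
  assumes S: "int n simplex (S :: 'a::euclidean_space set)" and R: "R \<subseteq> facets S"
    and \<tau>: "\<tau> face_of S" "\<And>F. F \<in> R \<Longrightarrow> \<not> \<tau> \<subseteq> F" "aff_dim \<tau> = int (card R) - 1"
    and G: "G face_of S" "\<And>F. F \<in> R \<Longrightarrow> \<not> G \<subseteq> F" "G \<subseteq> \<tau>"
  shows "G = \<tau>"
proof -
  obtain V where V: "\<not> affine_dependent V" "S = convex hull V" using S simplex_vertices by blast
  define B where "B = {v \<in> V. convex hull (V - {v}) \<in> R}"
  have RB: "R = (\<lambda>v. convex hull (V - {v})) ` B"
  proof
    show "R \<subseteq> (\<lambda>v. convex hull (V - {v})) ` B"
    proof
      fix F assume "F \<in> R"
      moreover from this have "F \<in> (\<lambda>v. convex hull (V - {v})) ` V"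
        using R facets_hull[OF V(1)] V(2) by auto
      ultimately show "F \<in> (\<lambda>v. convex hull (V - {v})) ` B" by (auto simp: B_def)
    qed
  qed (auto simp: B_def)
  have "inj_on (\<lambda>v. convex hull (V - {v})) B"
    by (rule inj_on_subset[OF inj_facets[OF V(1)]]) (auto simp: B_def)
  then have cB: "card B = card R" using RB card_image by metis
  obtain A where A: "A \<subseteq> V" "\<tau> = convex hull A" using \<tau>(1) V face_of_hull_iff by blast
  obtain A' where A': "A' \<subseteq> V" "G = convex hull A'" using G(1) V face_of_hull_iff by blast
  have *: "B \<subseteq> D" if D: "D \<subseteq> V" "\<And>F. F \<in> R \<Longrightarrow> \<not> convex hull D \<subseteq> F" for D
  proof
    fix v assume v: "v \<in> B"
    show "v \<in> D"
    proof (rule ccontr)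
      assume "v \<notin> D"
      then have "D \<subseteq> V - {v}" using D by blast
      then have "convex hull D \<subseteq> convex hull (V - {v})" by (rule hull_mono)
      then show False using D(2) v by (auto simp: B_def)
    qed
  qed
  have "B \<subseteq> A" "B \<subseteq> A'" using * A A' \<tau>(2) G(2) by auto
  moreover have "A' \<subseteq> A" using G(3) A A' hull_subset_iff[OF V(1)] by blast
  moreover have "card A = card B" using aff_dim_hull[OF V(1) A(1)] A(2) \<tau>(3) cB by simp
  moreover have "finite A" using A finite_vertices[OF V(1)] finite_subset by blast
  ultimately have "A = B" using card_subset_eq[of A B] by simp
  then show ?thesis using A A' \<open>B \<subseteq> A'\<close> \<open>A' \<subseteq> A\<close> by auto
qed

text \<open>The set \<open>C\<close> of unmatched faces is as predicted by the type of the tile. The type is quantified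
  existentially, because the same tile arises from several choices of removed faces.\<close>

definition tile_shape :: "'a::euclidean_space set \<Rightarrow> 'a set \<Rightarrow> 'a set set \<Rightarrow> bool" where
  "tile_shape S T C \<longleftrightarrow> (\<exists>n l k. morse_tile n l k S T \<and>
     (l = int k - 1 \<longrightarrow> (\<exists>c. C = {c} \<and> int k simplex c)) \<and> (l \<noteq> int k - 1 \<longrightarrow> C = {}))"

lemma tile_shapeI:
  assumes "tile_data n l k S R \<tau>" "T = S - (\<Union>R \<union> \<tau>)"
    "l = int k - 1 \<Longrightarrow> \<exists>c. C = {c} \<and> int k simplex c" "l \<noteq> int k - 1 \<Longrightarrow> C = {}"
  shows "tile_shape S T C"
  unfolding tile_shape_def morse_tile_def using assms by blast

lemma tile_data_k0:
  assumes "tile_data n l 0 S R \<tau>"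
  shows "R = {}"
  using assms facets_simplex(2) finite_subset unfolding tile_data_def by (metis card_0_eq)

lemma unmatched_basic:
  assumes S: "int n simplex (S :: 'a::euclidean_space set)" and R: "R \<subseteq> facets S"
    and bf: "basic_field n S R V"
  shows "tile_shape S (S - \<Union>R) (unmatched V (open_simplices_in (faces S) (S - \<Union>R)))"
proof -
  have Q: "open_simplices_in (faces S) (S - \<Union>R) = open_faces S R"
    by (rule open_simplices_in_faces) (use S R convex_simplex in \<open>auto simp: facets_def\<close>)
  obtain C where C: "face_matching V (open_faces S R) C" "R = {} \<longrightarrow> (\<exists>v. C = {{v}})"
    "R = facets S \<longrightarrow> C = {S}" "R \<noteq> {} \<and> R \<noteq> facets S \<longrightarrow> C = {}"
    using basic_field_matching[OF bf S R] by (elim exE conjE) (rule that)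
  have U: "unmatched V (open_faces S R) = C" by (rule unmatched_face_matching[OF C(1)])
  have fac: "card (facets S) = n + 1" "finite (facets S)" by (fact facets_simplex[OF S])+
  show ?thesis unfolding Q U
  proof (cases "R = {}")
    case True
    then show "tile_shape S (S - \<Union>R) C"
      using C(2) by (intro tile_shapeI[OF tile_data_closed_simplex[OF S]]) auto
  next
    case ne: False
    then obtain F where F: "F \<in> R" by blast
    show "tile_shape S (S - \<Union>R) C"
    proof (cases "n = 0")
      case True
      \<comment> \<open>the only facet of a point is empty, so the tile is the whole point and its index is 0\<close>
      then have "card R = 1" using ne R fac card_mono[OF fac(2) R] finite_subset[OF R fac(2)]
        by (simp add: le_Suc_eq)
      then have Rf: "R = facets S" using fac True card_subset_eq[OF fac(2) R] by simp
      have "aff_dim F = -1" using F R S True aff_dim_simplex[OF S] by (auto simp: facets_def)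
      then have "F = {}" using aff_dim_negative_iff[of F] by linarith
      then have "R = {{}}" using F \<open>card R = 1\<close> by (metis card_1_singletonE singletonD)
      then have "S - \<Union>R = S - (\<Union>{} \<union> {})" by simp
      then show ?thesis
        by (rule tile_shapeI[OF tile_data_closed_simplex[OF S]])
          (use C(3) Rf S True in auto)
    next
      case False
      then have n: "1 \<le> n" by simp
      note td = tile_data_last_facet[OF S R F n]
      show ?thesis
      proof (rule tile_shapeI[OF td(1)])
        show "S - \<Union>R = S - (\<Union>(R - {F}) \<union> F)" unfolding td(2) ..
        have "card R \<ge> 1" using ne finite_subset[OF R fac(2)] by (simp add: Suc_leI card_gt_0_iff)
        then have iff: "int n - 1 = int (card R - 1) - 1 \<longleftrightarrow> card R = n + 1" by auto
        show "\<exists>c. C = {c} \<and> int (card R - 1) simplex c" if "int n - 1 = int (card R - 1) - 1"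
        proof -
          have "card R = n + 1" using that iff by blast
          moreover from this have "R = facets S" using card_subset_eq[OF fac(2) R] fac by simp
          ultimately show ?thesis using C(3) S by simp
        qed
        show "C = {}" if "int n - 1 \<noteq> int (card R - 1) - 1"
        proof -
          have "R \<noteq> facets S" using that iff fac by metis
          then show ?thesis using C(4) ne by simp
        qed
      qed
    qed
  qed
qed

text \<open>For \<open>k = 0\<close> the tile is a closed simplex with its one unmatched vertex. For positive \<open>k\<close> the field is
  a complete matching of the basic tile, and the only open face in the removed part is the least one, \<open>\<tau>\<close>. Being
  least, it is matched with a face of dimension \<open>k\<close>, which is left without its partner.\<close>

lemma unmatched_critical:
  assumes td: "tile_data n (int k - 1) k S R \<tau>" and bf: "basic_field n S R W"
    and T: "T = S - (\<Union>R \<union> \<tau>)"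
  shows "tile_shape S T (unmatched (W |` open_simplices_in (faces S) T) (open_simplices_in (faces S) T))"
proof -
  have S: "int n simplex S" and R: "R \<subseteq> facets S" "card R = k" and kn: "k \<le> n"
    and \<tau>: "\<tau> face_of S" "(int k - 1) simplex \<tau>" "k = 0 \<or> \<not> \<tau> \<subseteq> \<Union>R"
    using td by (auto simp: tile_data_def)
  define Q where "Q = open_faces S R"
  define P where "P = open_simplices_in (faces S) T"
  have P: "P = {G \<in> Q. \<not> G \<subseteq> \<tau>}" unfolding P_def Q_def T by (rule tile_data_faces[OF td])
  obtain C where C: "face_matching W Q C" "R = {} \<longrightarrow> (\<exists>v. C = {{v}})"
    "R \<noteq> {} \<and> R \<noteq> facets S \<longrightarrow> C = {}"
    using basic_field_matching[OF bf S R(1), folded Q_def] by (elim exE conjE) (rule that)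
  have "\<exists>c. unmatched (W |` P) P = {c} \<and> int k simplex c"
  proof (cases "k = 0")
    case True
    then have "\<tau> = {}" using \<tau> by simp
    have "R = {}" using td tile_data_k0 True by blast
    have "P = Q" unfolding P \<open>\<tau> = {}\<close> by (auto simp: Q_def open_faces_def)
    then have "unmatched (W |` P) P = C"
      using unmatched_restrict_matching[OF C(1)] unmatched_face_matching[OF C(1)] by simp
    then show ?thesis using C(2) \<open>R = {}\<close> True by auto
  next
    case False
    have ne: "R \<noteq> {}" "R \<noteq> facets S" using False R kn facets_simplex(1)[OF S] by auto
    then have C0: "C = {}" using C(3) by blast
    have ad: "aff_dim \<tau> = int (card R) - 1" using \<tau>(2) aff_dim_simplex R by auto
    have \<tau>R: "\<And>F. F \<in> R \<Longrightarrow> \<not> \<tau> \<subseteq> F" using \<tau>(3) False by blast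
    have \<tau>ne: "\<tau> \<noteq> {}" using \<tau>(2) False by auto
    have \<tau>Q: "\<tau> \<in> Q" using \<tau> \<tau>R \<tau>ne by (simp add: Q_def open_faces_def)
    have only: "G = \<tau>" if "G \<in> Q" "G \<subseteq> \<tau>" for G
      using unique_corner_face[OF S R(1) \<tau>(1) \<tau>R ad] that by (simp add: Q_def open_faces_def)
    have M: "dom W \<union> ran W = Q" "dom W \<inter> ran W = {}" "inj_on W (dom W)"
      "\<And>\<sigma> \<tau>. W \<sigma> = Some \<tau> \<Longrightarrow> \<sigma> face_of \<tau> \<and> aff_dim \<tau> = aff_dim \<sigma> + 1"
      using C(1) C0 unfolding face_matching_def by auto
    have "\<tau> \<notin> ran W"
    proof
      assume "\<tau> \<in> ran W"
      then obtain \<nu> where \<nu>: "W \<nu> = Some \<tau>" by (auto simp: ran_def)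
      then have "\<nu> \<in> Q" "\<nu> \<subseteq> \<tau>" using M(1) M(4)[OF \<nu>] face_of_imp_subset by auto
      then have "\<nu> = \<tau>" by (rule only)
      then show False using M(4)[OF \<nu>] by simp
    qed
    then obtain \<mu> where \<mu>: "W \<tau> = Some \<mu>" using \<tau>Q M(1) by blast
    have \<mu>r: "\<mu> \<in> ran W" using \<mu> by (rule ranI)
    have "\<mu> \<noteq> \<tau>" using M(4)[OF \<mu>] by auto
    then have \<mu>P: "\<mu> \<in> P" using \<mu>r M(1) only unfolding P by blast
    have PQ: "P = Q - {\<tau>}" using only \<tau>Q unfolding P by auto
    have "unmatched (W |` P) P = {\<mu>}"
    proof (intro Set.set_eqI iffI)
      fix \<sigma> assume \<sigma>: "\<sigma> \<in> unmatched (W |` P) P"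
      then have s: "\<sigma> \<in> P" "W \<sigma> = None" "\<sigma> \<notin> ran (W |` P)" by (auto simp: unmatched_def)
      then have "\<sigma> \<in> ran W" using M(1) PQ by blast
      then obtain \<nu> where \<nu>: "W \<nu> = Some \<sigma>" by (auto simp: ran_def)
      have "\<nu> \<notin> P" using s(3) \<nu> by (metis ranI restrict_in)
      then have "\<nu> = \<tau>" using \<nu> M(1) PQ by blast
      then show "\<sigma> \<in> {\<mu>}" using \<nu> \<mu> by simp
    next
      fix \<sigma> assume "\<sigma> \<in> {\<mu>}"
      moreover have "W \<mu> = None" using M(2) \<mu>r by blast
      moreover have "\<mu> \<notin> ran (W |` P)"
      proof
        assume "\<mu> \<in> ran (W |` P)"
        then obtain \<nu> where "\<nu> \<in> P" "W \<nu> = Some \<mu>" by (auto simp: ran_def restrict_map_def split: if_splits)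
        then have "\<nu> = \<tau>" using M(3) \<mu> by (metis domI inj_onD)
        then show False using \<open>\<nu> \<in> P\<close> PQ by blast
      qed
      ultimately show "\<sigma> \<in> unmatched (W |` P) P" using \<mu>P by (simp add: unmatched_def)
    qed
    moreover have "int k simplex \<mu>"
    proof -
      have "\<mu> face_of S" using \<mu>r M(1) by (auto simp: Q_def open_faces_def)
      moreover have "aff_dim \<mu> = int k" using M(4)[OF \<mu>] ad R by simp
      ultimately show ?thesis using simplex_face[OF S] by metis
    qed
    ultimately show ?thesis by blast
  qed
  then show ?thesis unfolding P_def[symmetric]
    by (intro tile_shapeI[OF td T]) auto
qed

text \<open>As the field preserves the removed part \<open>N\<close>, and a source of a face in \<open>N\<close> is a face of it and lies
  in \<open>N\<close> as well, no pair is separated. If the order is positive, the basic tile has no unmatched face. Otherwise it is a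
  closed simplex with one unmatched vertex, and parity forces this vertex into the closed simplex \<open>\<tau>\<close>.\<close>

lemma unmatched_regular:
  assumes td: "tile_data n l k S R \<tau>" and lk: "l \<noteq> int k - 1" and bf: "basic_field n S R W"
    and T: "T = S - (\<Union>R \<union> \<tau>)"
    and pres: "preserves W (open_simplices_in (faces S) (\<tau> - \<Union>R))"
  shows "tile_shape S T (unmatched (W |` open_simplices_in (faces S) T) (open_simplices_in (faces S) T))"
proof -
  have S: "int n simplex S" and R: "R \<subseteq> facets S" "card R = k" and kl: "int k \<le> l + 1" "l + 1 \<le> int n"
    and \<tau>: "\<tau> face_of S" "l simplex \<tau>"
    using td by (auto simp: tile_data_def)
  define Q where "Q = open_faces S R"
  define P where "P = open_simplices_in (faces S) T"
  define N where "N = {G \<in> Q. G \<subseteq> \<tau>}"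
  have P: "P = Q - N" unfolding P_def Q_def T N_def tile_data_faces[OF td] by blast
  have cvx: "convex S" using S convex_simplex by blast
  have Neq: "open_simplices_in (faces S) (\<tau> - \<Union>R) = N"
  proof -
    have RS: "\<And>F. F \<in> R \<Longrightarrow> F face_of S" using R by (auto simp: facets_def)
    have "G \<in> open_simplices_in (faces S) (\<tau> - \<Union>R) \<longleftrightarrow> G \<in> N" for G
    proof (cases "G face_of S \<and> G \<noteq> {}")
      case True
      have 1: "rel_interior G \<subseteq> \<tau> \<longleftrightarrow> G \<subseteq> \<tau>"
      proof
        assume "rel_interior G \<subseteq> \<tau>"
        moreover have "rel_interior G \<noteq> {}" using True face_of_imp_convex rel_interior_eq_empty by blast
        ultimately have "rel_interior G \<inter> \<tau> \<noteq> {}" by blast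
        then show "G \<subseteq> \<tau>" using rel_interior_meets_face_iff[OF _ \<tau>(1) _ cvx] True by blast
      qed (use rel_interior_subset in blast)
      have 2: "rel_interior G \<inter> \<Union>R = {} \<longleftrightarrow> (\<forall>F\<in>R. \<not> G \<subseteq> F)"
        using rel_interior_meets_face_iff[OF _ RS _ cvx, of G] True by blast
      have "G \<in> open_simplices_in (faces S) (\<tau> - \<Union>R) \<longleftrightarrow> rel_interior G \<subseteq> \<tau> \<and> rel_interior G \<inter> \<Union>R = {}"
        using True by (auto simp: open_simplices_in_def faces_def)
      also have "\<dots> \<longleftrightarrow> G \<in> N" using True 1 2 by (simp add: N_def Q_def open_faces_def conj_commute)
      finally show ?thesis .
    qed (auto simp: open_simplices_in_def faces_def N_def Q_def open_faces_def)
    then show ?thesis by blast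
  qed
  have presN: "preserves W N" using pres Neq by simp
  obtain C where C: "face_matching W Q C" "R = {} \<longrightarrow> (\<exists>v. C = {{v}})"
    "R \<noteq> {} \<and> R \<noteq> facets S \<longrightarrow> C = {}"
    using basic_field_matching[OF bf S R(1), folded Q_def] by (elim exE conjE) (rule that)
  have M: "dom W \<union> ran W \<union> C = Q" "(dom W \<union> ran W) \<inter> C = {}"
      "\<And>\<sigma> \<tau>. W \<sigma> = Some \<tau> \<Longrightarrow> \<sigma> face_of \<tau> \<and> aff_dim \<tau> = aff_dim \<sigma> + 1"
    using C(1) unfolding face_matching_def by auto
  have down: "\<sigma> \<in> N" if "\<tau>' \<in> N" "W \<sigma> = Some \<tau>'" for \<sigma> \<tau>'
    using that M(1) M(3)[OF that(2)] face_of_imp_subset[of \<sigma> \<tau>'] by (auto simp: N_def)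
  have "C \<inter> P = {}"
  proof (cases "R = {}")
    case True
    then have k0: "k = 0" using R by simp
    have "l \<noteq> -1" using lk k0 by simp
    then have l: "0 \<le> l" using simplex_dim_ge[OF \<tau>(2)] by simp
    then have ls: "int (nat l) simplex \<tau>" using \<tau>(2) by simp
    have N': "N = {G. G face_of \<tau> \<and> G \<noteq> {}}"
      using True face_of_face[OF \<tau>(1)] by (auto simp: N_def Q_def open_faces_def)
    have "odd (card N)" unfolding N' by (rule card_nonempty_faces[OF ls])
    moreover from this have "finite N" by (metis card.infinite even_zero)
    moreover have "even (card N)" if "N \<inter> C = {}" "finite N"
    proof (rule face_matching_even[OF C(1) _ that presN])
      show "N \<subseteq> Q" by (auto simp: N_def)
    qed (rule down)
    ultimately have "N \<inter> C \<noteq> {}" by blast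
    moreover obtain v where "C = {{v}}" using C(2) True by blast
    ultimately show ?thesis using P by auto
  next
    case False
    have "R \<noteq> facets S" using R(2) kl facets_simplex(1)[OF S] by auto
    then show ?thesis using False C(3) by simp
  qed
  have "unmatched (W |` P) P = {}"
  proof (rule ccontr)
    assume "unmatched (W |` P) P \<noteq> {}"
    then obtain \<sigma> where s: "\<sigma> \<in> P" "W \<sigma> = None" "\<sigma> \<notin> ran (W |` P)" by (auto simp: unmatched_def)
    then have "\<sigma> \<in> ran W" using M(1) \<open>C \<inter> P = {}\<close> P by blast
    then obtain \<nu> where \<nu>: "W \<nu> = Some \<sigma>" by (auto simp: ran_def)
    have "\<nu> \<notin> P" using s(3) \<nu> by (metis ranI restrict_in)
    moreover have "\<nu> \<in> Q" using \<nu> M(1) by blast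
    ultimately have "\<nu> \<in> N" using P by blast
    then have "\<sigma> \<in> N" using presN \<nu> unfolding preserves_def by blast
    then show False using s P by blast
  qed
  then show ?thesis unfolding P_def[symmetric]
    by (intro tile_shapeI[OF td T]) (use lk in auto)
qed

lemma tile_field_shape:
  assumes "tile_field S T V"
  shows "tile_shape S T (unmatched V (open_simplices_in (faces S) T))"
  using assms unfolding tile_field_def
proof (elim disjE exE conjE)
  fix n R assume "int n simplex S" "R \<subseteq> facets S" "T = S - \<Union>R" "basic_field n S R V"
  then show ?thesis using unmatched_basic by blast
next
  fix n k R \<tau> W
  assume "tile_data n (int k - 1) k S R \<tau>" "T = S - (\<Union>R \<union> \<tau>)" "basic_field n S R W"
    "V = W |` open_simplices_in (faces S) T"
  then show ?thesis using unmatched_critical by blast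
next
  fix n l k R \<tau> W
  assume "l \<noteq> int k - 1" "tile_data n l k S R \<tau>" "T = S - (\<Union>R \<union> \<tau>)" "basic_field n S R W"
    "preserves W (open_simplices_in (faces S) (\<tau> - \<Union>R))" "V = W |` open_simplices_in (faces S) T"
  then show ?thesis using unmatched_regular by blast
qed

section \<open>Critical tiles and unmatched simplices\<close>

text \<open>A tile contains the relative interior of its simplex and therefore determines the simplex.\<close>

lemma tile_closure:
  fixes S :: "'a::euclidean_space set"
  assumes "tile_data n l k S R \<tau>"
  shows "closure (S - (\<Union>R \<union> \<tau>)) = S"
proof -
  have S: "int n simplex S" and R: "R \<subseteq> facets S" and \<tau>: "\<tau> face_of S" "l simplex \<tau>" "l < int n"
    using assms by (auto simp: tile_data_def)
  have cvx: "convex S" and cl: "closed S" and dim: "aff_dim S = int n" and ne: "S \<noteq> {}"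
    using S convex_simplex closed_simplex aff_dim_simplex[OF S] by auto
  have "rel_interior S \<inter> F = {}" if "F face_of S" "aff_dim F < aff_dim S" for F
    using rel_interior_meets_face_iff[OF face_of_refl[OF cvx] that(1) ne cvx] that(2) aff_dim_subset[of S F] by auto
  moreover have "F face_of S \<and> aff_dim F < aff_dim S" if "F \<in> R \<or> F = \<tau>" for F
    using that R \<tau> aff_dim_simplex[OF \<tau>(2)] dim by (auto simp: facets_def)
  ultimately have "rel_interior S \<inter> F = {}" if "F \<in> R \<or> F = \<tau>" for F
    using that by blast
  then have "rel_interior S \<subseteq> S - (\<Union>R \<union> \<tau>)" using rel_interior_subset[of S] by blast
  then have "closure (rel_interior S) \<subseteq> closure (S - (\<Union>R \<union> \<tau>))" by (rule closure_mono)
  moreover have "closure (rel_interior S) = S" using convex_closure_rel_interior[OF cvx] cl by simp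
  moreover have "closure (S - (\<Union>R \<union> \<tau>)) \<subseteq> S" using cl by (simp add: closure_minimal)
  ultimately show ?thesis by simp
qed

text \<open>A facet is contained in no other face of the same or a smaller dimension. Hence its open simplex is
  missing only if the facet itself is among the removed faces.\<close>

lemma missing_facets:
  fixes S :: "'a::euclidean_space set"
  assumes td: "tile_data n l k S R \<tau>" and n: "1 \<le> n"
  defines "M \<equiv> {F \<in> facets S. F \<notin> {G \<in> open_faces S R. \<not> G \<subseteq> \<tau>}}"
  shows "l < int n - 1 \<Longrightarrow> M = R" "l = int n - 1 \<Longrightarrow> M = insert \<tau> R \<and> card M = k + 1"
proof -
  have S: "int n simplex S" and R: "R \<subseteq> facets S" "card R = k"
    and \<tau>: "\<tau> face_of S" "l simplex \<tau>" "l = -1 \<or> \<not> \<tau> \<subseteq> \<Union>R"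
    using td by (auto simp: tile_data_def)
  have ne: "F \<noteq> {}" if "F \<in> facets S" for F using facet_simplex(1)[OF S that] n by auto
  have M: "F \<in> M \<longleftrightarrow> F \<in> facets S \<and> (F \<in> R \<or> F \<subseteq> \<tau>)" for F
  proof -
    have "(\<exists>G\<in>R. F \<subseteq> G) \<longleftrightarrow> F \<in> R" if "F \<in> facets S"
      using facet_subset_eq[OF S that] R by blast
    then show ?thesis using ne[of F] by (auto simp: M_def open_faces_def facets_def)
  qed
  show "M = R" if "l < int n - 1"
  proof -
    have "\<not> F \<subseteq> \<tau>" if "F \<in> facets S" for F
      using aff_dim_subset[of F \<tau>] aff_dim_simplex[OF \<tau>(2)] aff_dim_simplex[OF facet_simplex(1)[OF S that]]
        \<open>l < int n - 1\<close> by auto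
    then show ?thesis using M R by blast
  qed
  show "M = insert \<tau> R \<and> card M = k + 1" if l: "l = int n - 1"
  proof -
    have \<tau>f: "\<tau> \<in> facets S" using \<tau> l aff_dim_simplex[OF S] aff_dim_simplex[OF \<tau>(2)] by (simp add: facets_def)
    then have "F \<subseteq> \<tau> \<longleftrightarrow> F = \<tau>" if "F \<in> facets S" for F using facet_subset_eq[OF S that] by blast
    then have "M = insert \<tau> R" using M \<tau>f R by blast
    moreover have "\<tau> \<notin> R" using \<tau>(3) l n by auto
    moreover have "finite R" using R facets_simplex(2)[OF S] finite_subset by blast
    ultimately show ?thesis using R by simp
  qed
qed

text \<open>Neither \<open>R\<close> nor \<open>\<tau>\<close> is determined by the tile: if \<open>\<tau>\<close> is a facet, it can be exchanged with
  a member of \<open>R\<close>. The number of missing facets tells the cases apart. It is \<open>n + 1\<close> for a critical tile of index \<open>n\<close>,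
  which no other choice of data attains unless it has the same index. For smaller index it is \<open>k\<close>, and
  \<open>R\<close> is the set of missing facets; then \<open>\<tau>\<close> is the largest of the other missing faces.\<close>

lemma tile_data_critical_unique:
  fixes S :: "'a::euclidean_space set"
  assumes td: "tile_data n l k S R \<tau>" "tile_data n l' k' S R' \<tau>'"
    and eq: "S - (\<Union>R \<union> \<tau>) = S - (\<Union>R' \<union> \<tau>')" and crit: "l = int k - 1"
  shows "l' = int k' - 1 \<and> k = k'"
proof (cases "n = 0")
  case True
  then show ?thesis using td simplex_dim_ge[of l \<tau>] simplex_dim_ge[of l' \<tau>'] by (auto simp: tile_data_def)
next
  case False
  then have n: "1 \<le> n" by simp
  have 1: "int n simplex S" "R \<subseteq> facets S" "card R = k" "\<tau> face_of S" "l simplex \<tau>" "l = -1 \<or> \<not> \<tau> \<subseteq> \<Union>R"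
    "int k \<le> l + 1" "l + 1 \<le> int n"
    using td by (auto simp: tile_data_def)
  have 2: "R' \<subseteq> facets S" "card R' = k'" "\<tau>' face_of S" "l' simplex \<tau>'" "l' = -1 \<or> \<not> \<tau>' \<subseteq> \<Union>R'"
    "int k' \<le> l' + 1" "l' + 1 \<le> int n"
    using td by (auto simp: tile_data_def)
  have E: "{G \<in> open_faces S R. \<not> G \<subseteq> \<tau>} = {G \<in> open_faces S R'. \<not> G \<subseteq> \<tau>'}"
    using tile_data_faces[OF td(1)] tile_data_faces[OF td(2)] eq by simp
  define M where "M = {F \<in> facets S. F \<notin> {G \<in> open_faces S R. \<not> G \<subseteq> \<tau>}}"
  have M': "M = {F \<in> facets S. F \<notin> {G \<in> open_faces S R'. \<not> G \<subseteq> \<tau>'}}" unfolding M_def E ..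
  note m = missing_facets[OF td(1) n, folded M_def] missing_facets[OF td(2) n, folded M']
  have in_open: "\<sigma> \<in> open_faces S Q" if "\<sigma> face_of S" "j simplex \<sigma>" "j = -1 \<or> \<not> \<sigma> \<subseteq> \<Union>Q" "\<sigma> \<noteq> {}"
    for \<sigma> Q j
  proof -
    have "j \<noteq> -1" using that by auto
    then show ?thesis using that unfolding open_faces_def by blast
  qed
  show ?thesis
  proof (cases "l = int n - 1")
    case True
    then have "card M = n + 1" using m(2) crit by auto
    moreover have "l' = int n - 1"
    proof (rule ccontr)
      assume "l' \<noteq> int n - 1"
      then have "l' < int n - 1" using 2 by linarith
      then have "card M = k'" using m(3) 2 by simp
      then show False using \<open>card M = n + 1\<close> \<open>l' < int n - 1\<close> 2 by linarith
    qed
    ultimately show ?thesis using m(4) True crit by auto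
  next
    case False
    then have "l < int n - 1" using 1 by linarith
    then have R: "M = R" by (rule m(1))
    show ?thesis
    proof (cases "l' = int n - 1")
      case True
      then have M2: "R = insert \<tau>' R'" "card R = k' + 1" using m(4) R by auto
      then have "0 \<le> l" using crit 1 by auto
      then have "\<tau> \<noteq> {}" using 1(5) by auto
      then have "\<tau> \<in> open_faces S R" using in_open 1 by blast
      then have "\<tau> \<in> {G \<in> open_faces S R'. \<not> G \<subseteq> \<tau>'}" using M2 by (auto simp: open_faces_def)
      then have "\<tau> \<in> {G \<in> open_faces S R. \<not> G \<subseteq> \<tau>}" using E by simp
      then show ?thesis by simp
    next
      case False
      then have "l' < int n - 1" using 2 by linarith
      then have R': "R' = R" using m(3) R by simp
      have "\<tau> \<subseteq> \<tau>'"
      proof (cases "\<tau> = {}")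
        case False
        then have "\<tau> \<in> open_faces S R" using in_open 1 by blast
        then show ?thesis using E R' by blast
      qed simp
      moreover have "\<tau>' \<subseteq> \<tau>"
      proof (cases "\<tau>' = {}")
        case False
        then have "\<tau>' \<in> open_faces S R'" using in_open 2 by blast
        then show ?thesis using E R' by blast
      qed simp
      ultimately have "l = l'" using aff_dim_simplex[OF 1(5)] aff_dim_simplex[OF 2(4)] by simp
      then show ?thesis using R' 1 2 crit by simp
    qed
  qed
qed

lemma morse_tile_critical_unique:
  fixes S S' :: "'a::euclidean_space set"
  assumes "morse_tile n l k S T" "morse_tile n' l' k' S' T" "l = int k - 1"
  shows "l' = int k' - 1 \<and> k = k'"
proof -
  obtain R \<tau> R' \<tau>' where td: "tile_data n l k S R \<tau>" "T = S - (\<Union>R \<union> \<tau>)"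
      "tile_data n' l' k' S' R' \<tau>'" "T = S' - (\<Union>R' \<union> \<tau>')"
    using assms unfolding morse_tile_def by blast
  then have "S = S'" using tile_closure[OF td(1)] tile_closure[OF td(3)] by simp
  moreover have "n = n'"
    using aff_dim_simplex[of "int n" S] aff_dim_simplex[of "int n'" S'] td(1,3) \<open>S = S'\<close>
    by (simp add: tile_data_def)
  ultimately show ?thesis using tile_data_critical_unique[OF td(1), of l' k' R' \<tau>'] td assms(3) by blast
qed

text \<open>The intersection with \<open>S\<close> is a face of \<open>\<sigma>\<close> that meets its relative interior, hence
  \<open>\<sigma>\<close> itself.\<close>

lemma simplicial_complex_face:
  assumes "simplicial_complex K" "S \<in> K" "\<sigma> \<in> K" "rel_interior \<sigma> \<inter> S \<noteq> {}"
  shows "\<sigma> face_of S"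
proof -
  have f: "(\<sigma> \<inter> S) face_of \<sigma>" "(S \<inter> \<sigma>) face_of S" using assms by (auto simp: simplicial_complex_def)
  have "\<sigma> \<inter> S \<inter> rel_interior \<sigma> \<noteq> {}" using assms(4) rel_interior_subset by blast
  then have "\<sigma> \<subseteq> \<sigma> \<inter> S" by (rule subset_of_face_of[OF f(1) order_refl])
  then have "S \<inter> \<sigma> = \<sigma>" by blast
  then show ?thesis using f(2) by simp
qed

lemma complex_simplex: "\<lbrakk>simplicial_complex K; \<sigma> \<in> K\<rbrakk> \<Longrightarrow> \<exists>n. n simplex \<sigma>"
  by (auto simp: simplicial_complex_def)

lemma complex_rel_interior_ne:
  assumes "simplicial_complex K" "\<sigma> \<in> K" "\<sigma> \<noteq> {}"
  shows "rel_interior \<sigma> \<noteq> {}"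
  using complex_simplex[OF assms(1,2)] assms(3) convex_simplex rel_interior_eq_empty by blast

lemma open_simplices_in_complex:
  assumes K: "simplicial_complex K" "S \<in> K" "T \<subseteq> S"
  shows "open_simplices_in K T = open_simplices_in (faces S) T"
proof (intro Set.set_eqI iffI)
  fix \<sigma> assume "\<sigma> \<in> open_simplices_in K T"
  then have s: "\<sigma> \<in> K" "\<sigma> \<noteq> {}" "rel_interior \<sigma> \<subseteq> T" by (auto simp: open_simplices_in_def)
  then have "rel_interior \<sigma> \<inter> S \<noteq> {}" using complex_rel_interior_ne[OF K(1) s(1,2)] K(3) by blast
  then show "\<sigma> \<in> open_simplices_in (faces S) T"
    using simplicial_complex_face[OF K(1,2) s(1)] s by (simp add: open_simplices_in_def faces_def)
next
  fix \<sigma> assume "\<sigma> \<in> open_simplices_in (faces S) T"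
  then have s: "\<sigma> face_of S" "\<sigma> \<noteq> {}" "rel_interior \<sigma> \<subseteq> T" by (auto simp: open_simplices_in_def faces_def)
  then have "\<sigma> \<in> K" using K by (auto simp: simplicial_complex_def)
  then show "\<sigma> \<in> open_simplices_in K T" using s by (simp add: open_simplices_in_def)
qed

text \<open>Tiles are unions of open simplices: the tile through one point of the relative interior contains
  all of it.\<close>

lemma simplex_in_tile:
  assumes K: "simplicial_complex K" and t: "morse_tiling K \<T>" and \<sigma>: "\<sigma> \<in> K" "\<sigma> \<noteq> {}"
  obtains T where "T \<in> \<T>" "\<sigma> \<in> open_simplices_in K T"
proof -
  have un: "\<Union>\<T> = \<Union>K" using t by (simp add: morse_tiling_def partition_on_def)
  obtain x where x: "x \<in> rel_interior \<sigma>" using complex_rel_interior_ne[OF K \<sigma>] by blast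
  then have "x \<in> \<Union>K" using \<sigma> rel_interior_subset by blast
  then obtain T where T: "T \<in> \<T>" "x \<in> T" using un by blast
  then obtain S n l k where S: "S \<in> K" "morse_tile n l k S T" using t unfolding morse_tiling_def by blast
  then obtain R \<tau> where td: "tile_data n l k S R \<tau>" "T = S - (\<Union>R \<union> \<tau>)" unfolding morse_tile_def by blast
  have "x \<in> rel_interior \<sigma> \<inter> S" using x T td by blast
  then have f: "\<sigma> face_of S" using simplicial_complex_face[OF K S(1) \<sigma>(1)] by blast
  have cvx: "convex S" using td(1) convex_simplex by (auto simp: tile_data_def)
  have "rel_interior \<sigma> \<inter> F = {}" if "F \<in> insert \<tau> R" for F
  proof -
    have "F face_of S" using that td(1) by (auto simp: tile_data_def facets_def)
    moreover have "\<not> \<sigma> \<subseteq> F" using x T td that rel_interior_subset by blast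
    ultimately show ?thesis using rel_interior_meets_face_iff[OF f _ \<sigma>(2) cvx] by blast
  qed
  moreover have "rel_interior \<sigma> \<subseteq> S" using f face_of_imp_subset rel_interior_subset by blast
  ultimately have "rel_interior \<sigma> \<subseteq> T" unfolding td(2) by blast
  then show thesis using that T \<sigma> by (simp add: open_simplices_in_def)
qed

lemma tile_unique:
  assumes K: "simplicial_complex K" and t: "morse_tiling K \<T>" and T: "T \<in> \<T>" "T' \<in> \<T>"
    and \<sigma>: "\<sigma> \<in> open_simplices_in K T" "\<sigma> \<in> open_simplices_in K T'"
  shows "T = T'"
proof -
  have "rel_interior \<sigma> \<noteq> {}" "rel_interior \<sigma> \<subseteq> T \<inter> T'"
    using \<sigma> complex_rel_interior_ne[OF K] by (auto simp: open_simplices_in_def)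
  then have "T \<inter> T' \<noteq> {}" by blast
  moreover have "disjoint \<T>" using t by (simp add: morse_tiling_def partition_on_def)
  ultimately show ?thesis using disjointD[OF _ T] by blast
qed

text \<open>Since the field preserves the tiles, and every simplex lies in exactly one of them, the source of a
  matched pair lies in the tile of its target. So being unmatched in the complex and in the tile mean the same, and critical
  tiles correspond to the unmatched simplices they contain.\<close>

lemma num_critical_eq_unmatched:
  fixes K :: "'a::euclidean_space set set"
  assumes K: "simplicial_complex K" and t: "morse_tiling K \<T>" and c: "compatible_field K \<T> W"
  shows "num_critical k \<T> = card {\<sigma> \<in> unmatched W (K - {{}}). int k simplex \<sigma>}"
proof -
  define Q where "Q = open_simplices_in K"
  have dom: "dom W \<subseteq> K - {{}}" using c by (simp add: compatible_field_def discrete_vector_field_def)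
  have loc: "unmatched (W |` Q T) (Q T) = unmatched W (K - {{}}) \<inter> Q T" if T: "T \<in> \<T>" for T
  proof -
    have r1: "\<sigma> \<in> ran (W |` Q T)" if s: "\<sigma> \<in> Q T" "\<sigma> \<in> ran W" for \<sigma>
    proof -
      obtain \<nu> where \<nu>: "W \<nu> = Some \<sigma>" using s by (auto simp: ran_def)
      then have "\<nu> \<in> K" "\<nu> \<noteq> {}" using dom by auto
      then obtain T' where T': "T' \<in> \<T>" "\<nu> \<in> Q T'" using simplex_in_tile[OF K t] unfolding Q_def by blast
      then have "preserves W (Q T')" using c unfolding compatible_field_def Q_def by blast
      then have "\<sigma> \<in> Q T'" using \<nu> T' unfolding preserves_def by blast
      then have "T' = T" using tile_unique[OF K t T'(1) T] s unfolding Q_def by blast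
      then show ?thesis using \<nu> T' by (metis ranI restrict_in)
    qed
    have r2: "\<sigma> \<in> ran W" if "\<sigma> \<in> ran (W |` Q T)" for \<sigma>
      using that by (auto simp: ran_def restrict_map_def split: if_splits)
    have QK: "\<sigma> \<in> K - {{}}" if "\<sigma> \<in> Q T" for \<sigma>
      using that by (simp add: Q_def open_simplices_in_def)
    show ?thesis
    proof (intro Set.set_eqI)
      fix \<sigma>
      show "\<sigma> \<in> unmatched (W |` Q T) (Q T) \<longleftrightarrow> \<sigma> \<in> unmatched W (K - {{}}) \<inter> Q T"
        using r1[of \<sigma>] r2[of \<sigma>] QK[of \<sigma>] by (cases "\<sigma> \<in> Q T") (auto simp: unmatched_def)
    qed
  qed
  have shape: "\<exists>S. tile_shape S T (unmatched W (K - {{}}) \<inter> Q T)" if T: "T \<in> \<T>" for T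
  proof -
    obtain S where S: "S \<in> K" "tile_field S T (W |` Q T)"
      using c T unfolding compatible_field_def Q_def by blast
    have "T \<subseteq> S" using S(2) unfolding tile_field_def by blast
    then have "Q T = open_simplices_in (faces S) T" unfolding Q_def by (rule open_simplices_in_complex[OF K S(1)])
    then show ?thesis using tile_field_shape[OF S(2)] loc[OF T] by metis
  qed
  have sh: "\<exists>S n l k. morse_tile n l k S T \<and>
      (l = int k - 1 \<longrightarrow> (\<exists>c. unmatched W (K - {{}}) \<inter> Q T = {c} \<and> int k simplex c)) \<and>
      (l \<noteq> int k - 1 \<longrightarrow> unmatched W (K - {{}}) \<inter> Q T = {})" if T: "T \<in> \<T>" for T
    using shape[OF T] unfolding tile_shape_def .
  have crit: "\<exists>c. unmatched W (K - {{}}) \<inter> Q T = {c} \<and> int k simplex c" if T: "T \<in> \<T>" "critical_tile k T" for T k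
  proof -
    obtain S n l k' where S: "morse_tile n l k' S T \<and>
      (l = int k' - 1 \<longrightarrow> (\<exists>c. unmatched W (K - {{}}) \<inter> Q T = {c} \<and> int k' simplex c)) \<and>
      (l \<noteq> int k' - 1 \<longrightarrow> unmatched W (K - {{}}) \<inter> Q T = {})"
      using sh[OF T(1)] by (elim exE) (rule that)
    obtain n2 S2 where "morse_tile n2 (int k - 1) k S2 T" using T(2) unfolding critical_tile_def by blast
    from morse_tile_critical_unique[OF this conjunct1[OF S] refl]
    have "l = int k' - 1" "k = k'" by simp_all
    then show ?thesis using S by simp
  qed
  have critI: "critical_tile k T" if T: "T \<in> \<T>" "\<sigma> \<in> unmatched W (K - {{}}) \<inter> Q T" "int k simplex \<sigma>" for T \<sigma> k
  proof -
    obtain S n l k' where S: "morse_tile n l k' S T \<and>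
      (l = int k' - 1 \<longrightarrow> (\<exists>c. unmatched W (K - {{}}) \<inter> Q T = {c} \<and> int k' simplex c)) \<and>
      (l \<noteq> int k' - 1 \<longrightarrow> unmatched W (K - {{}}) \<inter> Q T = {})"
      using sh[OF T(1)] by (elim exE) (rule that)
    have l: "l = int k' - 1" using S T(2) by (metis emptyE)
    then obtain c where c: "unmatched W (K - {{}}) \<inter> Q T = {c}" "int k' simplex c" using S by blast
    then have "int k' simplex \<sigma>" using T(2) by simp
    then have "k = k'" using aff_dim_simplex[OF T(3)] aff_dim_simplex[of "int k'" \<sigma>] by simp
    then show ?thesis using S l unfolding critical_tile_def by blast
  qed
  define g where "g = (\<lambda>T. the_elem (unmatched W (K - {{}}) \<inter> Q T))"
  have g: "unmatched W (K - {{}}) \<inter> Q T = {g T} \<and> int k simplex g T" if "T \<in> \<T>" "critical_tile k T" for T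
    using crit[OF that] unfolding g_def by force
  have "bij_betw g {T \<in> \<T>. critical_tile k T} {\<sigma> \<in> unmatched W (K - {{}}). int k simplex \<sigma>}"
    unfolding bij_betw_def
  proof
    show "inj_on g {T \<in> \<T>. critical_tile k T}"
    proof (rule inj_onI)
      fix T T' assume T: "T \<in> {T \<in> \<T>. critical_tile k T}" "T' \<in> {T \<in> \<T>. critical_tile k T}" "g T = g T'"
      then have "g T \<in> Q T" "g T \<in> Q T'" using g[of T] g[of T'] by auto
      then show "T = T'" using tile_unique[OF K t] T unfolding Q_def by blast
    qed
    show "g ` {T \<in> \<T>. critical_tile k T} = {\<sigma> \<in> unmatched W (K - {{}}). int k simplex \<sigma>}"
    proof (intro Set.set_eqI iffI)
      fix \<sigma> assume "\<sigma> \<in> g ` {T \<in> \<T>. critical_tile k T}"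
      then obtain T where "T \<in> \<T>" "critical_tile k T" "\<sigma> = g T" by blast
      then show "\<sigma> \<in> {\<sigma> \<in> unmatched W (K - {{}}). int k simplex \<sigma>}" using g[of T] by blast
    next
      fix \<sigma> assume s: "\<sigma> \<in> {\<sigma> \<in> unmatched W (K - {{}}). int k simplex \<sigma>}"
      then have "\<sigma> \<in> K" "\<sigma> \<noteq> {}" by (auto simp: unmatched_def)
      then obtain T where T: "T \<in> \<T>" "\<sigma> \<in> Q T" using simplex_in_tile[OF K t] unfolding Q_def by blast
      then have "critical_tile k T" using critI[of T \<sigma> k] s by blast
      moreover from this have "\<sigma> = g T" using g[OF T(1)] s T by blast
      ultimately show "\<sigma> \<in> g ` {T \<in> \<T>. critical_tile k T}" using T by blast
    qed
  qed
  then show ?thesis unfolding num_critical_def by (rule bij_betw_same_card)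
qed

section \<open>The filtration by the gradient field\<close>

text \<open>The union is star-shaped with respect to the vertex \<open>v\<close> opposite to \<open>F\<close>: adding \<open>v\<close> to the
  vertices of a face other than \<open>F\<close> and \<open>S\<close> gives another such face. So it is a contractible finite union of compact
  convex sets.\<close>

lemma AR_boundary_minus_facet:
  fixes S :: "'a::euclidean_space set"
  assumes S: "n simplex S" and F: "F \<in> facets S" "F \<noteq> {}"
  shows "AR (\<Union>{G. G face_of S \<and> G \<noteq> F \<and> G \<noteq> S})"
proof -
  obtain V where V: "\<not> affine_dependent V" "S = convex hull V" using S simplex_vertices by blast
  then obtain v where v: "v \<in> V" "F = convex hull (V - {v})" using F(1) facets_hull by blast
  define \<F> where "\<F> = {G. G face_of S \<and> G \<noteq> F \<and> G \<noteq> S}"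
  have in\<F>: "convex hull A \<in> \<F> \<longleftrightarrow> A \<noteq> V - {v} \<and> A \<noteq> V" if "A \<subseteq> V" for A
    using hull_face[OF V(1) that] hull_eq_iff[OF V(1) that] v by (simp add: \<F>_def V(2))
  have "V - {v} \<noteq> {}" using F(2) v(2) by auto
  then have "{v} \<noteq> V" "{v} \<noteq> V - {v}" using v(1) by auto
  then have v\<F>: "convex hull {v} \<in> \<F>" using in\<F>[of "{v}"] v(1) by simp
  have poly: "polytope S" using S simplex_imp_polytope by blast
  have fin: "finite \<F>"
    by (rule finite_subset[OF _ finite_polytope_faces[OF poly]]) (auto simp: \<F>_def)
  have "ANR (\<Union>\<F>)"
    by (rule ANR_finite_Union_convex_closed[OF fin])
      (use S in \<open>auto simp: \<F>_def intro: face_of_imp_convex face_of_imp_closed convex_simplex closed_simplex\<close>)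
  moreover have "v \<in> \<Union>\<F>" using v\<F> by auto
  moreover have "closed_segment v x \<subseteq> \<Union>\<F>" if x: "x \<in> \<Union>\<F>" for x
  proof -
    obtain G where G: "x \<in> G" "G \<in> \<F>" using x by (elim UnionE)
    then have "G face_of S" by (simp add: \<F>_def)
    then obtain A where A: "A \<subseteq> V" "G = convex hull A" using face_of_hull_iff[OF V(1)] V(2) by blast
    have "A \<noteq> V - {v} \<and> A \<noteq> V" using G(2) in\<F>[OF A(1)] A(2) by simp
    then have "insert v A \<noteq> V - {v} \<and> insert v A \<noteq> V" using A(1) v(1) by blast
    then have "convex hull (insert v A) \<in> \<F>" using in\<F>[of "insert v A"] A v by simp
    moreover have "closed_segment v x \<subseteq> convex hull (insert v A)"
    proof (rule closed_segment_subset)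
      show "v \<in> convex hull (insert v A)" by (simp add: hull_inc)
      show "x \<in> convex hull (insert v A)" using G(1) A(2) hull_mono[of A "insert v A"] by blast
    qed simp
    ultimately show ?thesis by blast
  qed
  ultimately show ?thesis unfolding \<F>_def[symmetric] AR_ANR
    using starlike_imp_contractible[of "\<Union>\<F>"] unfolding starlike_def by blast
qed

lemma subcomplex_Int_simplex:
  assumes K: "simplicial_complex K" and L: "L \<subseteq> K" "\<And>F S. \<lbrakk>S \<in> L; F face_of S\<rbrakk> \<Longrightarrow> F \<in> L" and S: "S \<in> K"
  shows "\<Union>L \<inter> S = \<Union>{F \<in> L. F face_of S}"
proof (intro Set.set_eqI iffI)
  fix x assume "x \<in> \<Union>L \<inter> S"
  then obtain G where G: "G \<in> L" "x \<in> G \<inter> S" by blast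
  have "(G \<inter> S) face_of G" "(S \<inter> G) face_of S"
    using K S G L(1) unfolding simplicial_complex_def by blast+
  then have "G \<inter> S \<in> L" "(G \<inter> S) face_of S" using L(2)[OF G(1)] by (auto simp: Int_commute)
  then show "x \<in> \<Union>{F \<in> L. F face_of S}" using G(2) by blast
next
  fix x assume "x \<in> \<Union>{F \<in> L. F face_of S}"
  then show "x \<in> \<Union>L \<inter> S" using face_of_imp_subset by blast
qed

lemma closed_subcomplex:
  assumes "simplicial_complex K" "L \<subseteq> K"
  shows "closed (\<Union>L)"
proof (rule closed_Union)
  show "finite L" using assms finite_subset unfolding simplicial_complex_def by blast
  show "\<forall>S\<in>L. closed S" using assms closed_simplex complex_simplex by blast
qed

lemma face_same_dim_eq:
  assumes "simplicial_complex K" "S \<in> K" "F face_of S" "aff_dim S \<le> aff_dim F"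
  shows "F = S"
  using face_of_aff_dim_lt[OF _ assms(3)] complex_simplex[OF assms(1,2)] convex_simplex assms(4)
  by (metis linorder_not_less)

lemma remove_top_simplex:
  assumes K: "simplicial_complex K" and L: "L \<subseteq> K" "\<forall>S F. S \<in> L \<longrightarrow> F face_of S \<longrightarrow> F \<in> L"
    and \<sigma>: "\<sigma> \<in> L" and max: "\<forall>S\<in>L. aff_dim S \<le> aff_dim \<sigma>"
  shows "\<lbrakk>S \<in> L - {\<sigma>}; F face_of S\<rbrakk> \<Longrightarrow> F \<in> L - {\<sigma>}" "\<Union>(L - {\<sigma>}) \<inter> \<sigma> = rel_frontier \<sigma>"
proof -
  have face: "F \<in> L - {\<sigma>}" if S: "S \<in> L - {\<sigma>}" "F face_of S" for S F
  proof -
    have "F \<noteq> \<sigma>"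
    proof
      assume "F = \<sigma>"
      then have "F = S" using face_same_dim_eq[OF K, of S F] S max L(1) by auto
      then show False using \<open>F = \<sigma>\<close> S by simp
    qed
    then show ?thesis using S L(2) by auto
  qed
  then show "\<lbrakk>S \<in> L - {\<sigma>}; F face_of S\<rbrakk> \<Longrightarrow> F \<in> L - {\<sigma>}" .
  have sK: "\<sigma> \<in> K" using \<sigma> L by blast
  obtain n where ds: "n simplex \<sigma>" using complex_simplex[OF K sK] by blast
  have "{F \<in> L - {\<sigma>}. F face_of \<sigma>} = {F. F face_of \<sigma> \<and> F \<noteq> \<sigma>}"
    using L(2) \<sigma> by auto
  moreover have "\<Union>(L - {\<sigma>}) \<inter> \<sigma> = \<Union>{F \<in> L - {\<sigma>}. F face_of \<sigma>}"
    by (rule subcomplex_Int_simplex[OF K _ face sK]) (use L(1) in auto)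
  ultimately show "\<Union>(L - {\<sigma>}) \<inter> \<sigma> = rel_frontier \<sigma>"
    using rel_frontier_of_polyhedron_alt[OF simplex_imp_polyhedron[OF ds]] by (simp only:)
qed

context
  fixes K :: "'a::euclidean_space set set" and f :: "'a set \<Rightarrow> real"
  assumes K: "simplicial_complex K" and f: "discrete_morse_function K f"
    and dvf: "discrete_vector_field K (gradient_field K f)"
begin

abbreviation "grad \<equiv> gradient_field K f"

lemma finite_simplices_dim: "finite (simplices_dim K p)"
  using K unfolding simplicial_complex_def simplices_dim_def by auto

lemma card_le_one_eq:
  assumes "card {x \<in> simplices_dim K p. P x} \<le> 1"
    and "x \<in> {x \<in> simplices_dim K p. P x}" "y \<in> {x \<in> simplices_dim K p. P x}"
  shows "x = y"
proof -
  have fin: "finite {x \<in> simplices_dim K p. P x}" using finite_simplices_dim by simp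
  show ?thesis using assms unfolding One_nat_def card_le_Suc0_iff_eq[OF fin] by metis
qed

lemma simplices_dim_unique: "\<lbrakk>\<sigma> \<in> simplices_dim K p; \<sigma> \<in> simplices_dim K q\<rbrakk> \<Longrightarrow> p = q"
  unfolding simplices_dim_def using aff_dim_simplex by blast

lemma gradient_pair_field:
  assumes "grad \<sigma> = Some \<tau>"
  shows "gradient_pair K f \<sigma> \<tau>"
proof -
  have ex: "\<exists>\<tau>. gradient_pair K f \<sigma> \<tau>" and t: "\<tau> = (THE \<tau>. gradient_pair K f \<sigma> \<tau>)"
    using assms unfolding gradient_field_def by (auto split: if_splits)
  have "\<rho> = \<rho>'" if r: "gradient_pair K f \<sigma> \<rho>" "gradient_pair K f \<sigma> \<rho>'" for \<rho> \<rho>'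
  proof -
    obtain p where p: "\<sigma> \<in> simplices_dim K p" "\<rho> \<in> simplices_dim K (p + 1)" "\<sigma> face_of \<rho> \<and> f \<rho> \<le> f \<sigma>"
      using r(1) unfolding gradient_pair_def by blast
    obtain q where q: "\<sigma> \<in> simplices_dim K q" "\<rho>' \<in> simplices_dim K (q + 1)" "\<sigma> face_of \<rho>' \<and> f \<rho>' \<le> f \<sigma>"
      using r(2) unfolding gradient_pair_def by blast
    have "q = p" using simplices_dim_unique[OF q(1) p(1)] .
    have c: "card {\<tau> \<in> simplices_dim K (p + 1). \<sigma> face_of \<tau> \<and> f \<tau> \<le> f \<sigma>} \<le> 1"
      using f p(1) unfolding discrete_morse_function_def by blast
    show ?thesis by (rule card_le_one_eq[OF c]) (use p q \<open>q = p\<close> in auto)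
  qed
  then have "\<exists>!\<tau>. gradient_pair K f \<sigma> \<tau>" using ex by blast
  then show ?thesis unfolding t by (rule theI')
qed

lemma gradient_dim:
  assumes "grad \<sigma> = Some \<tau>"
  shows "\<sigma> \<in> K" "\<tau> \<in> K" "\<sigma> \<noteq> {}" "\<sigma> face_of \<tau>" "aff_dim \<tau> = aff_dim \<sigma> + 1" "f \<tau> \<le> f \<sigma>"
  using gradient_pair_field[OF assms] unfolding gradient_pair_def simplices_dim_def
  by (auto dest!: aff_dim_simplex)

lemma simplices_dim_aff_dim: "\<lbrakk>\<sigma> \<in> K; \<sigma> \<noteq> {}\<rbrakk> \<Longrightarrow> \<sigma> \<in> simplices_dim K (aff_dim \<sigma>)"
  using complex_simplex[OF K, of \<sigma>] aff_dim_simplex by (auto simp: simplices_dim_def)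

text \<open>The acyclicity of the gradient field. Of the facets of \<open>\<tau>\<close> only \<open>\<sigma>\<close> may have a value
  at least \<open>f \<tau>\<close>, and \<open>f \<tau> \<le> f \<sigma>\<close>.\<close>

lemma gradient_other_facet:
  assumes pair: "grad \<sigma> = Some \<tau>" and \<nu>: "\<nu> face_of \<tau>" "aff_dim \<nu> = aff_dim \<sigma>" "\<nu> \<noteq> \<sigma>"
  shows "f \<nu> < f \<sigma>"
proof -
  note g = gradient_dim[OF pair]
  have "aff_dim \<nu> \<noteq> -1" using g \<nu>(2) aff_dim_negative_iff[of \<sigma>] by linarith
  then have ne: "\<nu> \<noteq> {}" by auto
  have \<nu>K: "\<nu> \<in> K" using K g(2) \<nu>(1) unfolding simplicial_complex_def by blast
  have "\<tau> \<noteq> {}" using g(3,4) face_of_imp_subset by blast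
  then have "\<tau> \<in> simplices_dim K (aff_dim \<tau>)" using g simplices_dim_aff_dim by blast
  then have c: "card {\<nu> \<in> simplices_dim K (aff_dim \<tau> - 1). \<nu> face_of \<tau> \<and> f \<nu> \<ge> f \<tau>} \<le> 1"
    using f unfolding discrete_morse_function_def by blast
  have s: "\<sigma> \<in> simplices_dim K (aff_dim \<tau> - 1)" using simplices_dim_aff_dim[OF g(1,3)] g(5) by simp
  have n: "\<nu> \<in> simplices_dim K (aff_dim \<tau> - 1)" using simplices_dim_aff_dim[OF \<nu>K ne] g(5) \<nu>(2) by simp
  have "\<not> f \<nu> \<ge> f \<tau>"
  proof
    assume "f \<nu> \<ge> f \<tau>"
    then have "\<nu> = \<sigma>" by (intro card_le_one_eq[OF c]) (use n s \<nu>(1) g in auto)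
    then show False using \<nu>(3) by simp
  qed
  then show ?thesis using g(6) by simp
qed

lemma gradient_inj:
  assumes "grad \<sigma> = Some \<tau>" "grad \<sigma>' = Some \<tau>"
  shows "\<sigma> = \<sigma>'"
proof -
  note g = gradient_dim[OF assms(1)] and g' = gradient_dim[OF assms(2)]
  have "\<tau> \<noteq> {}" using g(3,4) face_of_imp_subset by blast
  then have "\<tau> \<in> simplices_dim K (aff_dim \<tau>)" using g simplices_dim_aff_dim by blast
  then have c: "card {v \<in> simplices_dim K (aff_dim \<tau> - 1). grad v = Some \<tau>} \<le> 1"
    using dvf unfolding discrete_vector_field_def by blast
  have "\<sigma> \<in> simplices_dim K (aff_dim \<tau> - 1)" "\<sigma>' \<in> simplices_dim K (aff_dim \<tau> - 1)"
    using simplices_dim_aff_dim[OF g(1,3)] simplices_dim_aff_dim[OF g'(1,3)] g(5) g'(5) by simp_all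
  then show ?thesis by (intro card_le_one_eq[OF c]) (use assms in auto)
qed

lemma gradient_no_chain:
  assumes "grad \<nu> = Some \<sigma>"
  shows "grad \<sigma> = None"
proof -
  note g = gradient_dim[OF assms]
  have "\<sigma> \<noteq> {}" using g(3,4) face_of_imp_subset by blast
  then have "\<sigma> \<in> simplices_dim K (aff_dim \<sigma>)" using g simplices_dim_aff_dim by blast
  then show ?thesis using dvf assms unfolding discrete_vector_field_def by (blast intro: ranI)
qed

definition num_unmatched :: "'a set set \<Rightarrow> int \<Rightarrow> nat" where
  "num_unmatched L i = card {\<sigma> \<in> unmatched grad (L - {{}}). i simplex \<sigma>}"

text \<open>The subcomplexes that do not separate matched pairs. Closure under faces contains the converse of the last condition,
  as the source of a pair is a face of its target.\<close>

definition gradient_closed :: "'a set set \<Rightarrow> bool" where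
  "gradient_closed L \<longleftrightarrow> L \<subseteq> K \<and> (\<forall>S F. S \<in> L \<longrightarrow> F face_of S \<longrightarrow> F \<in> L) \<and>
     (\<forall>\<sigma> \<tau>. \<sigma> \<in> L \<longrightarrow> grad \<sigma> = Some \<tau> \<longrightarrow> \<tau> \<in> L)"

text \<open>In terms of generating polynomials, \<open>\<Sum>u\<^sub>i t\<^sup>i = \<Sum>b\<^sub>i t\<^sup>i + (1 + t) \<Sum>q\<^sub>i t\<^sup>i\<close> with natural coefficients. Degrees are integers,
  as for homology groups; degree \<open>0\<close> then needs no special treatment.\<close>

definition morse_relation :: "'a set set \<Rightarrow> bool" where
  "morse_relation L \<longleftrightarrow> (\<exists>b q :: int \<Rightarrow> nat.
     (\<forall>i. rank_on (homology_group i (top_of_set (\<Union>L))) (carrier (homology_group i (top_of_set (\<Union>L)))) (b i)) \<and>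
     (\<forall>i. num_unmatched L i = b i + q i + q (i - 1)))"

lemma morse_relation_empty:
  assumes "L \<subseteq> {{}}"
  shows "morse_relation L"
proof -
  have L: "L - {{}} = {}" "\<Union>L = {}" using assms by auto
  have "rank_on (homology_group i (top_of_set (\<Union>L))) (carrier (homology_group i (top_of_set (\<Union>L)))) 0" for i
  proof -
    have "trivial_group (homology_group i (top_of_set (\<Union>L)))"
      by (rule trivial_homology_group_empty) (simp add: L)
    then show ?thesis using rank_on_trivial[OF abelian_homology_group] by (simp add: trivial_group_def)
  qed
  moreover have "num_unmatched L i = 0" for i by (simp add: num_unmatched_def L unmatched_def)
  ultimately show ?thesis unfolding morse_relation_def
    by (intro exI[of _ "\<lambda>_. 0"]) simp
qed

lemma gradient_closedD:
  assumes "gradient_closed L"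
  shows "L \<subseteq> K" "\<lbrakk>S \<in> L; F face_of S\<rbrakk> \<Longrightarrow> F \<in> L" "\<lbrakk>\<sigma> \<in> L; grad \<sigma> = Some \<tau>\<rbrakk> \<Longrightarrow> \<tau> \<in> L"
  using assms unfolding gradient_closed_def by blast+

text \<open>If the new cell creates a class of degree \<open>d\<close>, then \<open>b\<^sub>d\<close> grows with the number of
  unmatched \<open>d\<close>-simplices. If it kills a class of degree \<open>d - 1\<close>, then \<open>q\<^sub>d\<^sub>-\<^sub>1\<close> grows; this
  makes up for the loss in degree \<open>d - 1\<close> and accounts for the additional simplex in degree \<open>d\<close>.\<close>

lemma attach_critical_simplex:
  assumes L: "gradient_closed L" and \<sigma>: "\<sigma> \<in> L" "\<sigma> \<noteq> {}" "grad \<sigma> = None" "\<sigma> \<notin> ran grad"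
    and max: "\<And>S. S \<in> L \<Longrightarrow> aff_dim S \<le> aff_dim \<sigma>"
  shows "gradient_closed (L - {\<sigma>})" "morse_relation (L - {\<sigma>}) \<Longrightarrow> morse_relation L"
proof -
  have LK: "L \<subseteq> K" "\<And>S F. \<lbrakk>S \<in> L; F face_of S\<rbrakk> \<Longrightarrow> F \<in> L" "\<And>\<sigma> \<tau>. \<lbrakk>\<sigma> \<in> L; grad \<sigma> = Some \<tau>\<rbrakk> \<Longrightarrow> \<tau> \<in> L"
    by (fact gradient_closedD[OF L])+
  define L' where "L' = L - {\<sigma>}"
  have "\<forall>S F. S \<in> L \<longrightarrow> F face_of S \<longrightarrow> F \<in> L" "\<forall>S\<in>L. aff_dim S \<le> aff_dim \<sigma>"
    using LK(2) max by blast+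
  note top = remove_top_simplex[OF K LK(1) this(1) \<sigma>(1) this(2), folded L'_def]
  note face = top(1) and int = top(2)
  have "\<tau> \<noteq> \<sigma>" if "grad \<nu> = Some \<tau>" for \<nu> \<tau> using that \<sigma>(4) by (auto intro: ranI)
  then have W': "\<tau> \<in> L'" if "\<nu> \<in> L'" "grad \<nu> = Some \<tau>" for \<nu> \<tau> using that LK(3) by (auto simp: L'_def)
  show "gradient_closed (L - {\<sigma>})"
    using face W' LK(1) unfolding gradient_closed_def L'_def by blast
  assume "morse_relation (L - {\<sigma>})"
  then obtain b q :: "int \<Rightarrow> nat" where
    b: "\<And>i. rank_on (homology_group i (top_of_set (\<Union>L'))) (carrier (homology_group i (top_of_set (\<Union>L')))) (b i)"
    and q: "\<And>i. num_unmatched L' i = b i + q i + q (i - 1)"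
    unfolding morse_relation_def L'_def[symmetric] by blast
  define d where "d = aff_dim \<sigma>"
  have sK: "\<sigma> \<in> K" using \<sigma> LK by blast
  obtain n where "n simplex \<sigma>" using complex_simplex[OF K sK] by blast
  then have ds: "d simplex \<sigma>" using aff_dim_simplex d_def by metis
  have "0 \<le> d" using \<sigma>(2) aff_dim_negative_iff[of \<sigma>] unfolding d_def by linarith
  then obtain p where p: "d = int p" using nonneg_int_cases by blast
  have un: "\<Union>L = \<Union>L' \<union> \<sigma>" using \<sigma>(1) by (auto simp: L'_def)
  have cl: "closed (\<Union>L')" by (rule closed_subcomplex[OF K]) (use LK(1) in \<open>auto simp: L'_def\<close>)
  have "unmatched grad (L - {{}}) = insert \<sigma> (unmatched grad (L' - {{}}))" "\<sigma> \<notin> unmatched grad (L' - {{}})"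
    using \<sigma> by (auto simp: unmatched_def L'_def)
  moreover have "finite (unmatched grad (L' - {{}}))"
    using K LK(1) finite_subset[of L K] unfolding simplicial_complex_def by (auto simp: unmatched_def L'_def)
  moreover have "i simplex \<sigma> \<longleftrightarrow> i = d" for i using ds aff_dim_simplex by blast
  ultimately have c: "num_unmatched L i = num_unmatched L' i + (if i = d then 1 else 0)" for i
  proof -
    assume a: "unmatched grad (L - {{}}) = insert \<sigma> (unmatched grad (L' - {{}}))" "\<sigma> \<notin> unmatched grad (L' - {{}})"
      "finite (unmatched grad (L' - {{}}))" "\<And>i. i simplex \<sigma> \<longleftrightarrow> i = d"
    have "{s \<in> unmatched grad (L - {{}}). i simplex s} =
        (if i = d then insert \<sigma> {s \<in> unmatched grad (L' - {{}}). i simplex s} else {s \<in> unmatched grad (L' - {{}}). i simplex s})"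
      using a(1,4) by auto
    then show ?thesis using a(2,3) by (simp add: num_unmatched_def)
  qed
  note rank = rank_cell_attachment[OF cl convex_simplex[OF ds] compact_simplex[OF ds] int p[unfolded d_def] b,
      folded un p d_def]
  from rank show "morse_relation L"
  proof
    assume r: "\<forall>i. rank_on (homology_group i (top_of_set (\<Union>L))) (carrier (homology_group i (top_of_set (\<Union>L))))
        ((b(d := b d + 1)) i)"
    have "\<forall>i. num_unmatched L i = (b(d := b d + 1)) i + q i + q (i - 1)" using c q by simp
    with r show ?thesis unfolding morse_relation_def by blast
  next
    assume r: "1 \<le> b (d - 1) \<and> (\<forall>i. rank_on (homology_group i (top_of_set (\<Union>L)))
        (carrier (homology_group i (top_of_set (\<Union>L)))) ((b(d - 1 := b (d - 1) - 1)) i))"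
    \<comment> \<open>the cell kills a class of degree \<open>d - 1\<close>\<close>
    have "\<forall>i. num_unmatched L i = (b(d - 1 := b (d - 1) - 1)) i + (q(d - 1 := q (d - 1) + 1)) i
        + (q(d - 1 := q (d - 1) + 1)) (i - 1)"
      using c q r by auto
    with r show ?thesis unfolding morse_relation_def by blast
  qed
qed

text \<open>Freeness of \<open>\<sigma>\<close> leaves a subcomplex, which meets \<open>\<tau>\<close> in all its proper faces except
  \<open>\<sigma>\<close>. Neither homology nor the unmatched simplices change.\<close>

lemma collapse_gradient_pair:
  assumes L: "gradient_closed L" and \<sigma>: "\<sigma> \<in> L" "grad \<sigma> = Some \<tau>"
    and max: "\<And>S. S \<in> L \<Longrightarrow> aff_dim S \<le> aff_dim \<tau>"
    and free: "\<And>S. \<lbrakk>S \<in> L; \<sigma> face_of S\<rbrakk> \<Longrightarrow> S = \<sigma> \<or> S = \<tau>"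
  shows "gradient_closed (L - {\<sigma>, \<tau>})" "morse_relation (L - {\<sigma>, \<tau>}) \<Longrightarrow> morse_relation L"
proof -
  have LK: "L \<subseteq> K" "\<And>S F. \<lbrakk>S \<in> L; F face_of S\<rbrakk> \<Longrightarrow> F \<in> L" "\<And>\<sigma> \<tau>. \<lbrakk>\<sigma> \<in> L; grad \<sigma> = Some \<tau>\<rbrakk> \<Longrightarrow> \<tau> \<in> L"
    by (fact gradient_closedD[OF L])+
  note g = gradient_dim[OF \<sigma>(2)]
  have \<tau>L: "\<tau> \<in> L" using LK(3)[OF \<sigma>] .
  define L' where "L' = L - {\<sigma>, \<tau>}"
  have face: "F \<in> L'" if S: "S \<in> L'" "F face_of S" for S F
  proof -
    have "F \<noteq> \<sigma>" using free[of S] S by (auto simp: L'_def)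
    moreover have "F \<noteq> \<tau>"
    proof
      assume "F = \<tau>"
      then have "F = S" using face_same_dim_eq[OF K, of S F] S max[of S] LK(1) by (auto simp: L'_def)
      then show False using \<open>F = \<tau>\<close> S by (simp add: L'_def)
    qed
    ultimately show ?thesis using S LK(2) by (auto simp: L'_def)
  qed
  have W': "\<rho> \<in> L'" if \<nu>: "\<nu> \<in> L'" "grad \<nu> = Some \<rho>" for \<nu> \<rho>
  proof -
    have "\<rho> \<noteq> \<tau>" using gradient_inj[OF \<sigma>(2), of \<nu>] \<nu> by (auto simp: L'_def)
    moreover have "\<rho> \<noteq> \<sigma>" using gradient_no_chain[OF \<nu>(2)] \<sigma>(2) by auto
    ultimately show ?thesis using LK(3) \<nu> by (auto simp: L'_def)
  qed
  show "gradient_closed (L - {\<sigma>, \<tau>})"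
    using face W' LK(1) unfolding gradient_closed_def L'_def by blast
  assume m: "morse_relation (L - {\<sigma>, \<tau>})"
  obtain n where ts: "n simplex \<tau>" using complex_simplex[OF K g(2)] by blast
  have un: "\<Union>L = \<Union>L' \<union> \<tau>" using \<sigma>(1) \<tau>L face_of_imp_subset[OF g(4)] by (auto simp: L'_def)
  have "\<sigma> \<in> facets \<tau>" using g(4,5) by (simp add: facets_def)
  from AR_boundary_minus_facet[OF ts this g(3)]
  have "AR (\<Union>L' \<inter> \<tau>)"
  proof -
    have "{F \<in> L'. F face_of \<tau>} = {F. F face_of \<tau> \<and> F \<noteq> \<sigma> \<and> F \<noteq> \<tau>}"
      using LK(2)[OF \<tau>L] by (auto simp: L'_def)
    moreover have "\<Union>L' \<inter> \<tau> = \<Union>{F \<in> L'. F face_of \<tau>}"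
      by (rule subcomplex_Int_simplex[OF K _ face g(2)]) (use LK(1) in \<open>auto simp: L'_def\<close>)
    ultimately show ?thesis using \<open>AR (\<Union>{G. G face_of \<tau> \<and> G \<noteq> \<sigma> \<and> G \<noteq> \<tau>})\<close> by simp
  qed
  moreover have "closed (\<Union>L')" by (rule closed_subcomplex[OF K]) (use LK(1) in \<open>auto simp: L'_def\<close>)
  ultimately have "top_of_set (\<Union>L) homotopy_equivalent_space top_of_set (\<Union>L')"
    unfolding un by (intro collapse_homotopy_equivalent convex_simplex[OF ts] compact_simplex[OF ts])
  then have iso: "homology_group i (top_of_set (\<Union>L')) \<cong> homology_group i (top_of_set (\<Union>L))" for i
    using homotopy_equivalent_space_imp_isomorphic_homology_groups homotopy_equivalent_space_sym by blast
  have "unmatched grad (L' - {{}}) = unmatched grad (L - {{}})"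
    using \<sigma>(2) ranI[of grad \<sigma> \<tau>] by (auto simp: unmatched_def L'_def)
  then have c: "num_unmatched L' i = num_unmatched L i" for i by (simp add: num_unmatched_def)
  obtain b q :: "int \<Rightarrow> nat" where
    b: "\<And>i. rank_on (homology_group i (top_of_set (\<Union>L'))) (carrier (homology_group i (top_of_set (\<Union>L')))) (b i)"
    and q: "\<And>i. num_unmatched L' i = b i + q i + q (i - 1)"
    using m unfolding morse_relation_def L'_def[symmetric] by blast
  have "rank_on (homology_group i (top_of_set (\<Union>L))) (carrier (homology_group i (top_of_set (\<Union>L)))) (b i)" for i
    by (rule rank_on_iso[OF iso abelian_homology_group abelian_homology_group b])
  then show "morse_relation L" unfolding morse_relation_def using q c by auto
qed

text \<open>If no simplex of top dimension is unmatched, then all of them are targets. Let \<open>\<sigma>\<close> be the source with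
  the largest value. If \<open>\<sigma>\<close> had a second coface \<open>S\<close>, the source paired with \<open>S\<close> would have a larger
  value still, by \<open>gradient_other_facet\<close>.\<close>

lemma morse_relation_gradient_closed:
  assumes "gradient_closed L"
  shows "morse_relation L"
  using assms
proof (induction "card L" arbitrary: L rule: less_induct)
  case less
  have LK: "L \<subseteq> K" "\<And>S F. \<lbrakk>S \<in> L; F face_of S\<rbrakk> \<Longrightarrow> F \<in> L" "\<And>\<sigma> \<tau>. \<lbrakk>\<sigma> \<in> L; grad \<sigma> = Some \<tau>\<rbrakk> \<Longrightarrow> \<tau> \<in> L"
    by (fact gradient_closedD[OF less.prems])+
  have fin: "finite L" using LK(1) K finite_subset unfolding simplicial_complex_def by blast
  show ?case
  proof (cases "L \<subseteq> {{}}")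
    case True
    then show ?thesis by (rule morse_relation_empty)
  next
    case False
    then obtain \<rho> where \<rho>: "\<rho> \<in> L" "\<rho> \<noteq> {}" by blast
    define d where "d = Max (aff_dim ` L)"
    have max: "\<And>S. S \<in> L \<Longrightarrow> aff_dim S \<le> d" unfolding d_def using fin by simp
    have "d \<in> aff_dim ` L" unfolding d_def by (rule Max_in) (use fin \<rho> in auto)
    then obtain \<mu> where \<mu>: "\<mu> \<in> L" "aff_dim \<mu> = d" by auto
    have d0: "0 \<le> d" using max[OF \<rho>(1)] \<rho>(2) aff_dim_negative_iff[of \<rho>] by linarith
    show ?thesis
    proof (cases "\<exists>\<sigma>\<in>L. aff_dim \<sigma> = d \<and> grad \<sigma> = None \<and> \<sigma> \<notin> ran grad")
      case True
      then obtain \<sigma> where \<sigma>: "\<sigma> \<in> L" "aff_dim \<sigma> = d" "grad \<sigma> = None" "\<sigma> \<notin> ran grad" by blast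
      have "\<sigma> \<noteq> {}" using \<sigma>(2) d0 by auto
      note a = attach_critical_simplex[OF less.prems \<sigma>(1) this \<sigma>(3,4)]
      have m: "\<And>S. S \<in> L \<Longrightarrow> aff_dim S \<le> aff_dim \<sigma>" using max \<sigma>(2) by simp
      have "card (L - {\<sigma>}) < card L" using fin \<sigma>(1) by (intro psubset_card_mono) auto
      then show ?thesis using less.hyps a m by blast
    next
      case False
      have up: "grad \<sigma> = None" if "\<sigma> \<in> L" "aff_dim \<sigma> = d" for \<sigma>
      proof (cases "grad \<sigma>")
        case (Some \<tau>)
        then show ?thesis using max[OF LK(3)[OF that(1) Some]] gradient_dim(5)[OF Some] that(2) by simp
      qed
      define A where "A = {\<sigma> \<in> L. \<exists>\<tau>\<in>L. aff_dim \<tau> = d \<and> grad \<sigma> = Some \<tau>}"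
      have top: "\<exists>\<sigma>\<in>A. grad \<sigma> = Some \<tau>" if \<tau>: "\<tau> \<in> L" "aff_dim \<tau> = d" for \<tau>
      proof -
        have "\<tau> \<in> ran grad" using False \<tau> up by blast
        then obtain \<sigma> where \<sigma>: "grad \<sigma> = Some \<tau>" by (auto simp: ran_def)
        then have "\<sigma> \<in> L" using LK(2)[OF \<tau>(1)] gradient_dim(4) by blast
        then show ?thesis using \<sigma> \<tau> by (auto simp: A_def)
      qed
      have finA: "finite A" using fin by (simp add: A_def)
      have neA: "A \<noteq> {}" using top[OF \<mu>] by blast
      have "Max (f ` A) \<in> f ` A" by (rule Max_in) (use finA neA in auto)
      then obtain \<sigma> where sA1: "\<sigma> \<in> A" "f \<sigma> = Max (f ` A)" by auto
      then have sA: "\<sigma> \<in> A" "\<And>\<nu>. \<nu> \<in> A \<Longrightarrow> f \<nu> \<le> f \<sigma>"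
        using finA by simp_all
      obtain \<tau> where \<tau>: "\<tau> \<in> L" "aff_dim \<tau> = d" "grad \<sigma> = Some \<tau>" using sA(1) by (auto simp: A_def)
      have \<sigma>L: "\<sigma> \<in> L" using sA(1) by (simp add: A_def)
      have m: "\<And>S. S \<in> L \<Longrightarrow> aff_dim S \<le> aff_dim \<tau>" using max \<tau>(2) by simp
      have free: "S = \<sigma> \<or> S = \<tau>" if S: "S \<in> L" "\<sigma> face_of S" for S
      proof (rule ccontr)
        assume neg: "\<not> (S = \<sigma> \<or> S = \<tau>)"
        have "\<not> aff_dim S \<le> aff_dim \<sigma>" using face_same_dim_eq[OF K, of S \<sigma>] S neg LK(1) by blast
        then have dS: "aff_dim S = d" using max[OF S(1)] gradient_dim(5)[OF \<tau>(3)] \<tau>(2) by simp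
        then obtain \<sigma>' where s': "\<sigma>' \<in> A" "grad \<sigma>' = Some S" using top[OF S(1)] by blast
        have "\<sigma> \<noteq> \<sigma>'" using s'(2) \<tau>(3) neg by auto
        moreover have "aff_dim \<sigma> = aff_dim \<sigma>'" using gradient_dim(5)[OF \<tau>(3)] gradient_dim(5)[OF s'(2)] \<tau>(2) dS by simp
        ultimately have "f \<sigma> < f \<sigma>'" using gradient_other_facet[OF s'(2) S(2)] by blast
        then show False using sA(2)[OF s'(1)] by simp
      qed
      note c = collapse_gradient_pair[OF less.prems \<sigma>L \<tau>(3) m free]
      have "card (L - {\<sigma>, \<tau>}) < card L" using fin \<sigma>L by (intro psubset_card_mono) auto
      then show ?thesis using less.hyps c by blast
    qed
  qed
qed

lemma morse_relation_complex: "morse_relation K"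
proof (rule morse_relation_gradient_closed)
  show "gradient_closed K"
    using K gradient_dim(2) unfolding gradient_closed_def simplicial_complex_def by blast
qed

end

section \<open>Dimension and the Morse inequalities\<close>

text \<open>If \<open>n < p\<close>, then \<open>n\<close> is at most the dimension of the ambient space of \<open>H\<close>, which thus contains a copy of
  Euclidean \<open>n\<close>-space. This brings both spaces into the same type, where invariance of dimension applies.\<close>

lemma open_cell_manifold_dim_le:
  fixes H U :: "'a::euclidean_space set" and X :: "'x topology"
  assumes U: "openin (top_of_set H) U" "U \<noteq> {}" and H: "affine H" "aff_dim H = int p"
    and g: "continuous_map (top_of_set U) (Euclidean_space n) g" "inj_on g U"
  shows "p \<le> n"
proof (rule ccontr)
  assume "\<not> p \<le> n"
  moreover have "p \<le> DIM('a)" using H(2) aff_dim_le_DIM[of H] by simp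
  ultimately have "n \<le> dim (UNIV :: 'a set)" by simp
  then obtain T :: "'a set" where T: "subspace T" "dim T = n"
    using choose_subspace_of_subspace by metis
  then have "Euclidean_space n homeomorphic_space top_of_set T"
    by (metis homeomorphic_space_sym homeomorphic_subspace_Euclidean_space_dim)
  then obtain e where e: "homeomorphic_map (Euclidean_space n) (top_of_set T) e"
    using homeomorphic_space by blast
  have ce: "continuous_map (Euclidean_space n) (top_of_set T) e" "inj_on e (topspace (Euclidean_space n))"
    using e by (auto simp: homeomorphic_eq_everything_map)
  have c: "continuous_map (top_of_set U) (top_of_set T) (e \<circ> g)"
    by (rule continuous_map_compose[OF g(1) ce(1)])
  have "g ` U \<subseteq> topspace (Euclidean_space n)"
    using g(1) by (auto simp: continuous_map_def Pi_iff)
  then have "inj_on (e \<circ> g) U" using g(2) ce(2) by (blast intro: comp_inj_on inj_on_subset)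
  moreover have "continuous_on U (e \<circ> g)" "(e \<circ> g) ` U \<subseteq> T" using c by auto
  ultimately have "aff_dim H \<le> aff_dim T"
    using invariance_of_dimension_affine_sets[OF U(1) H(1) subspace_imp_affine[OF T(1)]] U(2) by blast
  then show False using H(2) T \<open>\<not> p \<le> n\<close> by (simp add: aff_dim_subspace)
qed

text \<open>The relative interior of a simplex of top dimension is open in the polyhedron, so a chart of the manifold
  embeds an open part of it into Euclidean \<open>n\<close>-space.\<close>

lemma triangulated_manifold_dim_le:
  fixes K :: "'a::euclidean_space set set" and X :: "'x topology"
  assumes X: "closed_manifold n X" and K: "simplicial_complex K" and h: "X homeomorphic_space top_of_set (\<Union>K)"
    and \<rho>: "\<rho> \<in> K"
  shows "aff_dim \<rho> \<le> int n"
proof -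
  have fin: "finite K" using K by (simp add: simplicial_complex_def)
  define d where "d = Max (aff_dim ` K)"
  have max: "\<And>S. S \<in> K \<Longrightarrow> aff_dim S \<le> d" unfolding d_def using fin by simp
  have "d \<in> aff_dim ` K" unfolding d_def by (rule Max_in) (use fin \<rho> in auto)
  then obtain \<sigma> where \<sigma>: "\<sigma> \<in> K" "aff_dim \<sigma> = d" by auto
  have "d \<le> int n"
  proof (cases "d < 0")
    case False
    then obtain p where p: "d = int p" by (metis nonneg_int_cases not_less)
    obtain m where m: "m simplex \<sigma>" using complex_simplex[OF K \<sigma>(1)] by blast
    define U where "U = rel_interior \<sigma>"
    define A where "A = \<Union>(K - {\<sigma>})"
    have "\<sigma> \<noteq> {}" using \<sigma>(2) False by auto
    then have neU: "U \<noteq> {}" unfolding U_def by (rule complex_rel_interior_ne[OF K \<sigma>(1)])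
    have "\<forall>S F. S \<in> K \<longrightarrow> F face_of S \<longrightarrow> F \<in> K" "\<forall>S\<in>K. aff_dim S \<le> aff_dim \<sigma>"
      using K max \<sigma>(2) by (auto simp: simplicial_complex_def)
    then have fr: "A \<inter> \<sigma> = rel_frontier \<sigma>"
      unfolding A_def by (rule remove_top_simplex(2)[OF K order_refl _ \<sigma>(1)])
    have "\<Union>K = A \<union> \<sigma>" using \<sigma>(1) by (auto simp: A_def)
    moreover have "U = \<sigma> - rel_frontier \<sigma>"
      using rel_interior_subset[of \<sigma>] closed_simplex[OF m] by (auto simp: U_def rel_frontier_def)
    ultimately have UA: "U = \<Union>K - A" using fr by blast
    have "closed A" unfolding A_def by (rule closed_subcomplex[OF K]) auto
    then have opU: "openin (top_of_set (\<Union>K)) U"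
      unfolding UA by (intro openin_diff closed_subset) (auto simp: A_def)
    obtain k where k: "homeomorphic_map (top_of_set (\<Union>K)) X k"
      using h homeomorphic_space_sym homeomorphic_space by blast
    then have ck: "continuous_map (top_of_set (\<Union>K)) X k" "inj_on k (\<Union>K)"
      by (auto simp: homeomorphic_eq_everything_map)
    obtain x where x: "x \<in> U" using neU by blast
    have "k x \<in> topspace X" using ck(1) x UA by (auto simp: continuous_map_def Pi_iff)
    then obtain N V where N: "openin X N" "k x \<in> N" "openin (Euclidean_space n) V"
        "subtopology X N homeomorphic_space subtopology (Euclidean_space n) V"
      using X unfolding closed_manifold_def by meson
    then obtain g where g: "homeomorphic_map (subtopology X N) (subtopology (Euclidean_space n) V) g"
      using homeomorphic_space by blast
    have NX: "N \<subseteq> topspace X" using N(1) openin_subset by blast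
    have cg: "continuous_map (subtopology X N) (Euclidean_space n) g" "inj_on g N"
      using g NX by (auto simp: homeomorphic_eq_everything_map continuous_map_in_subtopology Int_absorb1)
    define U' where "U' = U \<inter> {y \<in> \<Union>K. k y \<in> N}"
    have "openin (top_of_set (\<Union>K)) {y \<in> topspace (top_of_set (\<Union>K)). k y \<in> N}"
      by (rule openin_continuous_map_preimage[OF ck(1) N(1)])
    then have op': "openin (top_of_set (\<Union>K)) U'" unfolding U'_def using opU by (auto intro: openin_Int)
    have U'U: "U' \<subseteq> U" "U \<subseteq> \<Union>K" unfolding U'_def UA by auto
    have "openin (top_of_set U) U'" by (rule openin_subset_trans[OF op' U'U])
    moreover have "openin (top_of_set (affine hull \<sigma>)) U" unfolding U_def by (rule openin_rel_interior)
    ultimately have op: "openin (top_of_set (affine hull \<sigma>)) U'" by (rule openin_trans)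
    have "continuous_map (top_of_set U') X k"
      using continuous_map_from_subtopology[OF ck(1), of U'] U'U by (simp add: subtopology_subtopology Int_absorb1)
    then have "continuous_map (top_of_set U') (subtopology X N) k"
      by (auto simp: continuous_map_in_subtopology U'_def)
    then have c: "continuous_map (top_of_set U') (Euclidean_space n) (g \<circ> k)"
      using cg(1) by (rule continuous_map_compose)
    have "k ` U' \<subseteq> N" by (auto simp: U'_def)
    moreover have "inj_on k U'" by (rule inj_on_subset[OF ck(2)]) (use U'U in blast)
    ultimately have i: "inj_on (g \<circ> k) U'" using cg(2) by (blast intro: comp_inj_on inj_on_subset)
    have "x \<in> U'" using x N(2) UA by (auto simp: U'_def)
    then have "U' \<noteq> {}" by blast
    from open_cell_manifold_dim_le[OF op this affine_affine_hull _ c i, of p]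
    show ?thesis using \<sigma>(2) p by simp
  qed simp
  then show ?thesis using max[OF \<rho>] by simp
qed

lemma alternating_sum_telescope:
  fixes a q :: "nat \<Rightarrow> int"
  assumes "a 0 = q 0" "\<And>i. a (Suc i) = q (Suc i) + q i"
  shows "(\<Sum>i\<le>k. (-1) ^ (k - i) * a i) = q k"
proof (induction k)
  case 0
  then show ?case using assms by simp
next
  case (Suc k)
  have "(\<Sum>i\<le>k. (-1) ^ (Suc k - i) * a i) = (\<Sum>i\<le>k. - ((-1) ^ (k - i) * a i))"
    by (rule sum.cong) (auto simp: Suc_diff_le)
  also have "\<dots> = - q k" using Suc by (simp add: sum_negf)
  finally show ?case using assms(2)[of k] by simp
qed

theorem corollary1p5:
  fixes X :: "'x topology" and K :: "'a::euclidean_space set set" and \<T> :: "'a set set" and n :: nat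
  assumes manifold: "closed_manifold n X"
    and complex: "simplicial_complex K"
    and triangulated: "X homeomorphic_space top_of_set (\<Union>K)"
    and tiling: "morse_tiling K \<T>"
    and compatible: "\<exists>f. compatible_morse_function K \<T> f"
  shows "(\<forall>k. betti k X \<le> num_critical k \<T>) \<and>
    (\<forall>k \<le> n. (\<Sum>i\<le>k. (-1) ^ (k - i) * int (betti i X))
               \<le> (\<Sum>i\<le>k. (-1) ^ (k - i) * int (num_critical i \<T>))) \<and>
    (\<Sum>i\<le>n. (-1) ^ (n - i) * int (betti i X))
      = (\<Sum>i\<le>n. (-1) ^ (n - i) * int (num_critical i \<T>))"
proof -
  obtain f where f: "discrete_morse_function K f" "compatible_field K \<T> (gradient_field K f)"
    using compatible unfolding compatible_morse_function_def by blast
  have dvf: "discrete_vector_field K (gradient_field K f)" using f(2) by (simp add: compatible_field_def)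
  obtain b q :: "int \<Rightarrow> nat" where
    b: "\<And>i. rank_on (homology_group i (top_of_set (\<Union>K))) (carrier (homology_group i (top_of_set (\<Union>K)))) (b i)"
    and q: "\<And>i. num_unmatched K f K i = b i + q i + q (i - 1)"
    using morse_relation_complex[OF complex f(1) dvf] unfolding morse_relation_def[OF complex f(1) dvf] by blast
  have num: "num_unmatched K f K i = card {\<sigma> \<in> unmatched (gradient_field K f) (K - {{}}). i simplex \<sigma>}" for i
    by (rule num_unmatched_def[OF complex f(1) dvf])
  have crit: "int (num_critical k \<T>) = int (b (int k)) + int (q (int k)) + int (q (int k - 1))" for k
    using num_critical_eq_unmatched[OF complex tiling f(2), of k] num[of "int k"] q[of "int k"] by simp
  have betti: "betti k X = b (int k)" for k
  proof -
    have "homology_group (int k) (top_of_set (\<Union>K)) \<cong> homology_group (int k) X"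
      using triangulated homeomorphic_space_imp_isomorphic_homology_groups homeomorphic_space_sym by blast
    then have "rank_on (homology_group (int k) X) (carrier (homology_group (int k) X)) (b (int k))"
      by (rule rank_on_iso[OF _ abelian_homology_group abelian_homology_group b])
    then show ?thesis unfolding betti_def by (rule rank_on_imp_abelian_rank)
  qed
  have "{\<sigma> \<in> unmatched (gradient_field K f) (K - {{}}). - 1 simplex \<sigma>} = {}"
    by (auto simp: unmatched_def)
  then have "num_unmatched K f K (- 1) = 0" unfolding num by (simp only: card.empty)
  then have q1: "q (- 1) = 0" using q[of "-1"] by simp
  have "\<not> int n + 1 simplex \<sigma>" if "\<sigma> \<in> K" for \<sigma>
    using triangulated_manifold_dim_le[OF manifold complex triangulated that] aff_dim_simplex[of "int n + 1" \<sigma>] by auto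
  then have "{\<sigma> \<in> unmatched (gradient_field K f) (K - {{}}). int n + 1 simplex \<sigma>} = {}"
    by (auto simp: unmatched_def)
  then have "num_unmatched K f K (int n + 1) = 0" unfolding num by (simp only: card.empty)
  then have qn: "q (int n) = 0" using q[of "int n + 1"] by simp
  have "(\<Sum>i\<le>k. (-1) ^ (k - i) * (int (num_critical i \<T>) - int (betti i X))) = int (q (int k))" for k
    by (rule alternating_sum_telescope) (use q1 in \<open>auto simp: crit betti\<close>)
  then have "(\<Sum>i\<le>k. (-1) ^ (k - i) * int (num_critical i \<T>)) - (\<Sum>i\<le>k. (-1) ^ (k - i) * int (betti i X))
      = int (q (int k))" for k
    by (simp add: right_diff_distrib sum_subtractf)
  note diff = this
  show ?thesis
  proof (intro conjI allI impI)
    show "betti k X \<le> num_critical k \<T>" for k using crit[of k] betti[of k] by simp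
    show "(\<Sum>i\<le>k. (-1) ^ (k - i) * int (betti i X)) \<le> (\<Sum>i\<le>k. (-1) ^ (k - i) * int (num_critical i \<T>))" for k
      using diff[of k] by linarith
    show "(\<Sum>i\<le>n. (-1) ^ (n - i) * int (betti i X)) = (\<Sum>i\<le>n. (-1) ^ (n - i) * int (num_critical i \<T>))"
      using diff[of n] qn by simp
  qed
qed

end
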